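(* Let $n=5$ and let $\mathbf c=\{c_i^{kj}\}$ be a real parameter collection such that for all $i,j\in\{1,\dots,5\}$ with $i\ne j$ the following two conditions hold: (1) $c_i^{kj}c_j^{li}\ne c_j^{ki}c_i^{lj}$ for all $k\ne l$ with $k,l\notin\{i,j\}$; (2) for all $p\notin\{i,j\}$, with $k,l,m$ chosen so that $\{i,j,k,l,m\}=\{1,\dots,5\}$, $$c_p^{kI}\big(c_i^{lj}c_j^{mi}-c_j^{li}c_i^{mj}\big)+c_p^{lI}\big(c_j^{ki}c_i^{mj}-c_i^{kj}c_j^{mi}\big)+c_p^{mI}\big(c_i^{kj}c_j^{li}-c_j^{ki}c_i^{lj}\big)\ne 0$$ for $I=i$ or $I=j$. Then for any sufficiently small $t>0$, $\Sigma_{\rm sing}(t\mathbf c)\cap\mathbb P^4$ contains ten points. Moreover, there is a further generic condition on the parameters (that is, a finite collection of homogeneous polynomials in the entries of $\mathbf c$, none identically zero, all required to be nonvanishing at $\mathbf c$) such that, if $\mathbf c$ also satisfies this further condition, then for any sufficiently small $t>0$, $\Sigma_{\rm sing}(t\mathbf c)\cap\mathbb P^4$ consists of $10+\alpha+2\beta+3\gamma$ points, where $\alpha,\beta,\gamma$ are nonnegative integers with $\alpha+\gamma=10$ and $\beta\le 5$.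
   Context: A parameter collection (for general $n$; here $n=5$) is a family of real numbers $\mathbf c=\{c_i^{kj}\}$, with $i,j,k\in\{1,\dots,n\}$, $k\ne j$, satisfying $c_i^{kj}=c_i^{jk}$ (the index $i$ may coincide with $j$ or $k$). For real $t$ write $t\mathbf c=\{tc_i^{kj}\}_{k\neq j}$. For $\xi=(\xi_1,\dots,\xi_n)\in\mathbb R^n$ the principal symbol is the $n\times n$ matrix $P(\xi,\mathbf c)=(p_{ij})$ with $$p_{ii}=\xi_i+\sum_{k\ne i}c_i^{ki}\xi_k,\qquad p_{ij}=\sum_{k\ne j}c_i^{kj}\xi_k\quad (i\ne j).$$ Set $\Sigma_{\rm sing}(\mathbf c)=\{\xi\in\mathbb R^n\setminus\{0\}: \operatorname{rank}P(\xi,\mathbf c)\le n-2\}$, which is invariant under nonzero real scaling. $\mathbb P^{4}$ denotes real projective space (lines through the origin in $\mathbb R^5$), and $\Sigma_{\rm sing}(t\mathbf c)\cap\mathbb P^4$ denotes the image of $\Sigma_{\rm sing}(t\mathbf c)$ in $\mathbb P^4$. *)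

theory Defs
  imports "HOL-Analysis.Analysis"
begin

text \<open>The entry \<open>c\<^sub>i\<^sup>k\<^sup>j\<close> is written \<open>c i k j\<close>. The values \<open>c i k k\<close> are not entries of the
  family: they are left unconstrained, and nothing below depends on them.\<close>

type_synonym 'n params = "'n \<Rightarrow> 'n \<Rightarrow> 'n \<Rightarrow> real"

definition parameter_collection :: "'n params \<Rightarrow> bool" where
  "parameter_collection c \<longleftrightarrow> (\<forall>i j k. k \<noteq> j \<longrightarrow> c i k j = c i j k)"

definition scale_params :: "real \<Rightarrow> 'n params \<Rightarrow> 'n params" where
  "scale_params t c = (\<lambda>i k j. t * c i k j)"

definition principal_symbol :: "real ^ 'n \<Rightarrow> 'n::finite params \<Rightarrow> real ^ 'n ^ 'n" where
  "principal_symbol \<xi> c =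
    (\<chi> i j. if i = j then \<xi> $ i + (\<Sum>k\<in>UNIV - {i}. c i k i * \<xi> $ k)
           else (\<Sum>k\<in>UNIV - {j}. c i k j * \<xi> $ k))"

text \<open>The bound \<open>rank \<le> n - 2\<close> is written without truncated subtraction.\<close>

definition Sigma_sing :: "'n::finite params \<Rightarrow> (real ^ 'n) set" where
  "Sigma_sing c = {\<xi>. \<xi> \<noteq> 0 \<and> rank (principal_symbol \<xi> c) + 2 \<le> CARD('n)}"

text \<open>Image in real projective space, whose points are the lines through the origin.\<close>

definition projective_image :: "'a::real_vector set \<Rightarrow> 'a set set" where
  "projective_image S = (\<lambda>\<xi>. span {\<xi>}) ` S"

definition condition1 :: "5 params \<Rightarrow> 5 \<Rightarrow> 5 \<Rightarrow> bool" where
  "condition1 c i j \<longleftrightarrow>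
    (\<forall>k l. k \<noteq> l \<and> k \<notin> {i, j} \<and> l \<notin> {i, j} \<longrightarrow> c i k j * c j l i \<noteq> c j k i * c i l j)"

text \<open>For fixed \<open>i\<close>, \<open>j\<close>, \<open>p\<close>, \<open>I\<close> the expression below changes only its sign when \<open>k\<close>, \<open>l\<close>, \<open>m\<close> are
  permuted, so it does not matter which enumeration of the three remaining indices is chosen.\<close>

definition condition2 :: "5 params \<Rightarrow> 5 \<Rightarrow> 5 \<Rightarrow> bool" where
  "condition2 c i j \<longleftrightarrow>
    (\<forall>p k l m. p \<notin> {i, j} \<and> {i, j, k, l, m} = UNIV \<longrightarrow>
      (\<exists>I\<in>{i, j}.
        c p k I * (c i l j * c j m i - c j l i * c i m j)
        + c p l I * (c j k i * c i m j - c i k j * c j m i)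
        + c p m I * (c i k j * c j l i - c j k i * c i l j) \<noteq> 0))"

text \<open>\<open>homogeneous_polynomial d f\<close>: \<open>f\<close> is the function of \<open>c\<close> given by a homogeneous polynomial of
  degree \<open>d\<close> (or the zero polynomial) in the entries \<open>c i k j\<close>, \<open>k \<noteq> j\<close>.\<close>

inductive homogeneous_polynomial :: "nat \<Rightarrow> ('n params \<Rightarrow> real) \<Rightarrow> bool" where
  const: "homogeneous_polynomial 0 (\<lambda>c. a)"
| entry: "k \<noteq> j \<Longrightarrow> homogeneous_polynomial 1 (\<lambda>c. c i k j)"
| add: "homogeneous_polynomial d f \<Longrightarrow> homogeneous_polynomial d g
    \<Longrightarrow> homogeneous_polynomial d (\<lambda>c. f c + g c)"
| mult: "homogeneous_polynomial d f \<Longrightarrow> homogeneous_polynomial e g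
    \<Longrightarrow> homogeneous_polynomial (d + e) (\<lambda>c. f c * g c)"

text \<open>Being not identically zero refers to the space of parameter collections; a polynomial such as
  \<open>c i k j - c i j k\<close> vanishes identically there.\<close>

definition generic_condition :: "('n params \<Rightarrow> real) set \<Rightarrow> bool" where
  "generic_condition F \<longleftrightarrow> finite F \<and>
    (\<forall>f\<in>F. (\<exists>d. homogeneous_polynomial d f) \<and> (\<exists>c. parameter_collection c \<and> f c \<noteq> 0))"

end

theory Submission
  imports Defs
begin

text \<open>
  Write \<open>P(\<xi>, t c) = diag \<xi> + t A(\<xi>)\<close> and let \<open>t\<close> tend to \<open>0\<close> from the right.  At \<open>t = 0\<close> the singular
  set consists of the ten planes \<open>\<xi>\<^sub>i = \<xi>\<^sub>j = 0\<close> of projective 4-space; the proof finds out which of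
  their points survive, and how often.

  \<^emph>\<open>Limits.\<close>  Let \<open>\<xi>\<close> run through unit vectors with \<open>P(\<xi>, t c)\<close> of rank at most \<open>3\<close>, and let \<open>I\<close> be the set
  of indices \<open>a\<close> for which \<open>\<xi>\<^sub>a / t\<close> stays bounded.  Dividing row \<open>a\<close> of \<open>P\<close> by \<open>\<bar>\<xi>\<^sub>a\<bar> + t\<close> does not change
  the rank and keeps all rows bounded.  In the limit the rows outside \<open>I\<close> become unit vectors up to sign, and the
  rows in \<open>I\<close> show that the \<open>I \<times> I\<close> matrix \<open>core\<close>, which is \<open>A\<close> of the limit direction with
  \<open>lim \<xi>\<^sub>a / t\<close> added on the diagonal, has rank at most \<open>\<bar>I\<bar> - 2\<close> (\<open>limit_configuration\<close>).

  \<^emph>\<open>Persistence.\<close>  Conversely, put \<open>\<xi>\<^sub>a = t y\<^sub>a\<close> for \<open>a \<in> I\<close> and \<open>\<xi>\<^sub>k = y\<^sub>k\<close> otherwise.  After division of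
  the rows in \<open>I\<close> by \<open>t\<close> the rank condition makes sense at \<open>t = 0\<close> as well, where it is the condition
  on \<open>core\<close>.  Gaussian elimination turns it into four polynomial equations, and the implicit function
  theorem continues every nondegenerate solution to exactly one solution for each small \<open>t > 0\<close>
  (\<open>persists_by_pivots\<close>).  Hence, for small \<open>t\<close>, the singular points correspond bijectively to the limit
  configurations, provided that these are finitely many and nondegenerate (\<open>branches\<close>).

  \<^emph>\<open>Counting.\<close>  As \<open>core\<close> has rank at most \<open>\<bar>I\<bar> - 2\<close> and \<open>I\<close> is not everything, \<open>\<bar>I\<bar>\<close> is \<open>2\<close>, \<open>3\<close> or \<open>4\<close>.  The
  diagonal entries of \<open>core\<close> are free, and its other entries are linear forms in the \<open>y\<^sub>k\<close>, \<open>k \<notin> I\<close>.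

  \<^item> If \<open>I = {i, j}\<close>, the matrix vanishes.  Its two off-diagonal entries are linear forms in three
    variables whose \<open>2 \<times> 2\<close> minors are nonzero by \<open>condition1\<close>, so they have one common zero up to
    scaling.  This gives the ten points of the first part.
  \<^item> If \<open>I = {i, j, p}\<close>, the rank is at most one.  Eliminating the diagonal leaves the equation
    \<open>n\<^sub>i\<^sub>j n\<^sub>j\<^sub>p n\<^sub>p\<^sub>i = n\<^sub>j\<^sub>i n\<^sub>p\<^sub>j n\<^sub>i\<^sub>p\<close>, a binary cubic, which has one or three real zeros when its
    discriminant is nonzero.  Over the ten sets \<open>I\<close> this gives \<open>\<alpha> + 3 \<gamma>\<close> points with \<open>\<alpha> + \<gamma> = 10\<close>.
  \<^item> If \<open>I = {i, j, p, q}\<close>, the off-diagonal entries are constants and the rank is at most two.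
    Eliminating two of the diagonal entries leaves two bilinear equations for the other two, and
    thus a quadratic equation, which has no or two real roots when its discriminant is nonzero.  Over
    the five sets \<open>I\<close> this gives \<open>2 \<beta>\<close> points with \<open>\<beta> \<le> 5\<close>.

  The further generic condition asks for these discriminants, and for some entries, minors and cubic
  expressions that keep the eliminations reversible, to be nonzero.
\<close>

section \<open>Rank and pivoting\<close>

text \<open>One step of fraction-free Gaussian elimination.  Avoiding division keeps the entries polynomial, which is
  what the implicit function theorem is applied to later.\<close>

definition pivot :: "'m \<Rightarrow> 'n \<Rightarrow> real^'n^'m \<Rightarrow> real^'n^'m" where
  "pivot p q M = (\<chi> a b. M $ p $ q * M $ a $ b - M $ a $ q * M $ p $ b)"

text \<open>The rows of \<open>M\<close> are spanned by row \<open>p\<close> and the rows of \<open>pivot p q M\<close>; the latter vanish in column \<open>q\<close>, and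
  row \<open>p\<close> does not.\<close>

lemma rank_pivot:
  fixes M :: "real^'n::finite^'m::finite"
  assumes "M $ p $ q \<noteq> 0"
  shows "rank M = Suc (rank (pivot p q M))"
proof -
  let ?m = "M $ p $ q" and ?r = "row p M" and ?N = "pivot p q M"
  have N: "row a ?N = ?m *\<^sub>R row a M - M $ a $ q *\<^sub>R ?r" for a
    by (simp add: row_def pivot_def vec_eq_iff)
  then have M: "row a M = inverse ?m *\<^sub>R (row a ?N + M $ a $ q *\<^sub>R ?r)" for a
    using assms by simp
  have eq: "span (rows M) = span (insert ?r (rows ?N))"
    unfolding span_eq
  proof
    show "rows M \<subseteq> span (insert ?r (rows ?N))"
    proof
      fix x assume "x \<in> rows M"
      then obtain a where "x = row a M" by (auto simp: rows_def)
      then have x: "x = inverse ?m *\<^sub>R (row a ?N + M $ a $ q *\<^sub>R ?r)"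
        using M by metis
      show "x \<in> span (insert ?r (rows ?N))"
        unfolding x by (intro span_scale span_add span_base) (auto simp: rows_def)
    qed
    show "insert ?r (rows ?N) \<subseteq> span (rows M)"
    proof
      fix x assume "x \<in> insert ?r (rows ?N)"
      then consider "x = ?r" | a where "x = row a ?N" by (auto simp: rows_def)
      then show "x \<in> span (rows M)"
      proof cases
        case 1
        then show ?thesis by (auto simp: rows_def intro: span_base)
      next
        case 2
        show ?thesis
          unfolding 2 N by (intro span_scale span_diff span_base) (auto simp: rows_def)
      qed
    qed
  qed
  have "?r \<notin> span (rows ?N)"
  proof
    assume "?r \<in> span (rows ?N)"
    moreover have "span (rows ?N) \<subseteq> {x. x $ q = 0}"
      by (rule span_minimal) (auto simp: subspace_def rows_def row_def pivot_def)
    ultimately have "?r $ q = 0" by blast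
    then show False using assms by (simp add: row_def)
  qed
  then have "dim (insert ?r (rows ?N)) = Suc (dim (rows ?N))"
    by (simp add: dim_insert)
  then show ?thesis
    unfolding row_rank_def using eq dim_span[of "rows M"] dim_span[of "insert ?r (rows ?N)"] by simp
qed

lemma rank_scale_rows:
  fixes M :: "real^'n::finite^'m::finite"
  assumes "\<And>a. w a \<noteq> 0"
  shows "rank (\<chi> a b. w a * M $ a $ b) = rank M"
proof -
  let ?N = "\<chi> a b. w a * M $ a $ b"
  have N: "row a ?N = w a *\<^sub>R row a M" for a
    by (simp add: row_def vec_eq_iff)
  then have M: "row a M = inverse (w a) *\<^sub>R row a ?N" for a
    using assms[of a] by simp
  have "span (rows M) = span (rows ?N)"
    unfolding span_eq
  proof
    show "rows M \<subseteq> span (rows ?N)"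
    proof
      fix x assume "x \<in> rows M"
      then obtain a where "x = row a M" by (auto simp: rows_def)
      then have x: "x = inverse (w a) *\<^sub>R row a ?N" using M by metis
      show "x \<in> span (rows ?N)"
        unfolding x by (intro span_scale span_base) (auto simp: rows_def)
    qed
    show "rows ?N \<subseteq> span (rows M)"
    proof
      fix x assume "x \<in> rows ?N"
      then obtain a where "x = row a ?N" by (auto simp: rows_def)
      then have x: "x = w a *\<^sub>R row a M" using N by metis
      show "x \<in> span (rows M)"
        unfolding x by (intro span_scale span_base) (auto simp: rows_def)
    qed
  qed
  then show ?thesis
    unfolding row_rank_def using dim_span[of "rows M"] dim_span[of "rows ?N"] by simp
qed

lemma rank_scaleR:
  fixes M :: "real^'n::finite^'m::finite"
  assumes "r \<noteq> 0"
  shows "rank (r *\<^sub>R M) = rank M"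
proof -
  have "r *\<^sub>R M = (\<chi> a b. r * M $ a $ b)" by (simp add: vec_eq_iff)
  then show ?thesis using rank_scale_rows[of "\<lambda>_. r" M] assms by simp
qed

text \<open>The \<open>2 \<times> 2\<close> minors of a matrix of rank at most one vanish, whether or not the pivot does.\<close>

lemma pivot_eq_0_of_rank_le_1:
  fixes M :: "real^'n::finite^'m::finite"
  assumes "rank M \<le> 1"
  shows "pivot p q M = 0"
proof -
  have *: "pivot p q M = 0" if "M $ p $ q \<noteq> 0" for p q
    using rank_pivot[of M p q, OF that] assms by (simp add: rank_eq_0)
  have **: "M $ p $ q * M $ a $ b = M $ a $ q * M $ p $ b" if "M $ p $ q \<noteq> 0" for p q a b
    using *[OF that] by (simp add: pivot_def vec_eq_iff)
  have "M $ p $ q * M $ a $ b = M $ a $ q * M $ p $ b" for a b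
  proof (cases "M $ p $ q = 0")
    case True
    then show ?thesis
      using **[of a q p b] by (cases "M $ a $ q = 0") auto
  qed (rule **)
  then show ?thesis by (simp add: pivot_def vec_eq_iff)
qed

lemma tendsto_pivot:
  fixes X :: "'a \<Rightarrow> real^'n::finite^'m::finite"
  assumes "(X \<longlongrightarrow> M) F"
  shows "((\<lambda>n. pivot p q (X n)) \<longlongrightarrow> pivot p q M) F"
  unfolding pivot_def by (intro tendsto_vec_lambda tendsto_intros assms)

text \<open>Lower semicontinuity of the rank, by induction on the bound: a nonzero entry of the limit is a nonzero
  entry of nearby matrices, and pivoting on it is continuous and lowers all the ranks by one.\<close>

lemma rank_le_of_tendsto:
  fixes X :: "'a \<Rightarrow> real^'n::finite^'m::finite"
  assumes "(X \<longlongrightarrow> M) F" "\<forall>\<^sub>F n in F. rank (X n) \<le> r" "F \<noteq> bot"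
  shows "rank M \<le> r"
  using assms(1,2)
proof (induction r arbitrary: X M)
  case 0
  then have "\<forall>\<^sub>F n in F. X n = 0" by (simp add: rank_eq_0)
  then have "(X \<longlongrightarrow> 0) F" by (simp add: tendsto_eventually)
  then have "M = 0" using 0(1) assms(3) tendsto_unique by blast
  then show ?case by simp
next
  case (Suc r)
  show ?case
  proof (cases "M = 0")
    case False
    then obtain p q where pq: "M $ p $ q \<noteq> 0" by (auto simp: vec_eq_iff)
    have "((\<lambda>n. X n $ p $ q) \<longlongrightarrow> M $ p $ q) F"
      by (intro tendsto_intros Suc)
    then have "\<forall>\<^sub>F n in F. X n $ p $ q \<noteq> 0"
      using pq tendsto_imp_eventually_ne by blast
    with Suc.prems(2) have "\<forall>\<^sub>F n in F. rank (pivot p q (X n)) \<le> r"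
      by eventually_elim (simp add: rank_pivot)
    then have "rank (pivot p q M) \<le> r"
      using Suc.IH tendsto_pivot[OF Suc.prems(1)] by blast
    then show ?thesis using rank_pivot[of M p q, OF pq] by simp
  qed simp
qed

text \<open>Pivoting on the diagonal entries in the rows indexed by \<open>K\<close> clears these rows and the corresponding columns
  and leaves the rest of the matrix as it is.\<close>

lemma rank_unit_rows:
  fixes M :: "real^'n::finite^'n"
  assumes "\<And>k b. k \<in> K \<Longrightarrow> M $ k $ b = (if b = k then d k else 0)" "\<And>k. k \<in> K \<Longrightarrow> d k \<noteq> 0"
  shows "rank M = card K + rank (\<chi> a b. if a \<in> K \<or> b \<in> K then 0 else M $ a $ b)"
proof -
  have "finite K" by simp
  then show ?thesis using assms
  proof (induction K arbitrary: M rule: finite_induct)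
    case empty
    then show ?case by (simp add: vec_lambda_eta)
  next
    case (insert k K)
    define N :: "real^'n^'n" where "N = (\<chi> a b. if a = k \<or> b = k then 0 else M $ a $ b)"
    have kk: "M $ k $ b = (if b = k then d k else 0)" for b using insert.prems(1)[of k b] by simp
    have "pivot k k M = d k *\<^sub>R N"
      using kk by (auto simp: pivot_def N_def vec_eq_iff)
    then have "rank M = Suc (rank N)"
      using rank_pivot[of M k k] rank_scaleR[of "d k" N] kk[of k] insert.prems(2)[of k] by simp
    also have "rank N = card K + rank (\<chi> a b. if a \<in> K \<or> b \<in> K then 0 else N $ a $ b)"
      by (rule insert.IH) (use insert in \<open>auto simp: N_def\<close>)
    also have "(\<chi> a b. if a \<in> K \<or> b \<in> K then 0 else N $ a $ b)
        = (\<chi> a b. if a \<in> insert k K \<or> b \<in> insert k K then 0 else M $ a $ b)"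
      by (auto simp: N_def vec_eq_iff)
    finally show ?case using insert.hyps by simp
  qed
qed

section \<open>Polynomial maps and the implicit function theorem\<close>

lemma C1_real_polynomial:
  assumes "real_polynomial_function (p :: 'a::euclidean_space \<Rightarrow> real)"
  shows "\<exists>p' :: 'a \<Rightarrow> 'a \<Rightarrow>\<^sub>L real. (\<forall>x. (p has_derivative blinfun_apply (p' x)) (at x)) \<and> continuous_on UNIV p'"
  using assms
proof induction
  case (linear f)
  then show ?case
    by (intro exI[of _ "\<lambda>x. Blinfun f"])
      (auto simp: bounded_linear_Blinfun_apply bounded_linear_imp_has_derivative)
next
  case (const c)
  then show ?case by (intro exI[of _ "\<lambda>x. 0"]) auto
next
  case (add f g)
  then obtain f' g' where "\<forall>x. (f has_derivative blinfun_apply (f' x)) (at x)" "continuous_on UNIV f'"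
    "\<forall>x. (g has_derivative blinfun_apply (g' x)) (at x)" "continuous_on UNIV g'" by blast
  then show ?case
    by (intro exI[of _ "\<lambda>x. f' x + g' x"])
      (auto intro!: continuous_intros derivative_eq_intros simp: blinfun.add_left)
next
  case (mult f g)
  then obtain f' g' where fg: "\<forall>x. (f has_derivative blinfun_apply (f' x)) (at x)" "continuous_on UNIV f'"
    "\<forall>x. (g has_derivative blinfun_apply (g' x)) (at x)" "continuous_on UNIV g'" by blast
  then have "continuous_on UNIV f" "continuous_on UNIV g"
    by (meson continuous_at_imp_continuous_on has_derivative_continuous)+
  with fg show ?case
    by (intro exI[of _ "\<lambda>x. f x *\<^sub>R g' x + g x *\<^sub>R f' x"])
      (auto intro!: continuous_intros derivative_eq_intros simp: blinfun.add_left blinfun.scaleR_left)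
qed

lemma C1_polynomial:
  fixes p :: "'a::euclidean_space \<Rightarrow> 'b::euclidean_space"
  assumes "polynomial_function p"
  obtains p' :: "'a \<Rightarrow> 'a \<Rightarrow>\<^sub>L 'b"
  where "\<And>x. (p has_derivative blinfun_apply (p' x)) (at x)" "continuous_on UNIV p'"
proof -
  have "\<forall>b. \<exists>q :: 'a \<Rightarrow> 'a \<Rightarrow>\<^sub>L real.
      (\<forall>x. ((\<lambda>x. p x \<bullet> b) has_derivative blinfun_apply (q x)) (at x)) \<and> continuous_on UNIV q"
  proof
    fix b
    have "real_polynomial_function (\<lambda>x. p x \<bullet> b)"
      using assms bounded_linear_inner_left[of b] by (auto simp: polynomial_function_def o_def)
    then show "\<exists>q :: 'a \<Rightarrow> 'a \<Rightarrow>\<^sub>L real.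
      (\<forall>x. ((\<lambda>x. p x \<bullet> b) has_derivative blinfun_apply (q x)) (at x)) \<and> continuous_on UNIV q"
      by (rule C1_real_polynomial)
  qed
  then obtain q :: "'b \<Rightarrow> 'a \<Rightarrow> 'a \<Rightarrow>\<^sub>L real" where
    q: "\<And>b x. ((\<lambda>x. p x \<bullet> b) has_derivative blinfun_apply (q b x)) (at x)" "\<And>b. continuous_on UNIV (q b)"
    by metis
  define p' where "p' x = (\<Sum>b\<in>Basis. blinfun_scaleR_left b o\<^sub>L q b x)" for x
  have "(p has_derivative blinfun_apply (p' x)) (at x)" for x
  proof -
    have "((\<lambda>x. \<Sum>b\<in>Basis. (p x \<bullet> b) *\<^sub>R b) has_derivative (\<lambda>v. \<Sum>b\<in>Basis. q b x v *\<^sub>R b)) (at x)"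
      by (intro has_derivative_sum has_derivative_scaleR_left q)
    moreover have "(\<lambda>v. \<Sum>b\<in>Basis. q b x v *\<^sub>R b) = blinfun_apply (p' x)"
      by (simp add: fun_eq_iff p'_def blinfun.sum_left)
    ultimately show ?thesis by (simp add: euclidean_representation)
  qed
  moreover have "continuous_on UNIV p'"
    unfolding p'_def by (intro continuous_intros q)
  ultimately show ?thesis using that by blast
qed

text \<open>The inverse function theorem for \<open>(t, y) \<mapsto> (t, G (t, y))\<close>.  Nondegeneracy in \<open>y\<close> is expressed by derivatives along
  lines, which in the applications are computed from explicit polynomials.\<close>

lemma implicit_function_polynomial:
  fixes G :: "real \<times> 'b::euclidean_space \<Rightarrow> 'b"
  assumes G: "polynomial_function G" "G (0, y0) = 0"
    and nondeg: "\<And>v. ((\<lambda>s. G (0, y0 + s *\<^sub>R v)) has_vector_derivative 0) (at 0) \<Longrightarrow> v = 0"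
  obtains g \<epsilon> where "\<epsilon> > 0" "(g \<longlongrightarrow> y0) (at_right 0)" "\<forall>\<^sub>F t in at_right 0. G (t, g t) = 0"
    "\<forall>\<^sub>F t in at_right 0. \<forall>y\<in>ball y0 \<epsilon>. G (t, y) = 0 \<longrightarrow> y = g t"
proof -
  obtain G' :: "real \<times> 'b \<Rightarrow> (real \<times> 'b) \<Rightarrow>\<^sub>L 'b"
    where G': "\<And>x. (G has_derivative blinfun_apply (G' x)) (at x)" "continuous_on UNIV G'"
    using C1_polynomial[OF G(1)] by blast
  define F where "F x = (fst x, G x)" for x
  define E1 :: "(real \<times> 'b) \<Rightarrow>\<^sub>L (real \<times> 'b)" where "E1 = Blinfun (\<lambda>h. (fst h, 0))"
  define E2 :: "'b \<Rightarrow>\<^sub>L (real \<times> 'b)" where "E2 = Blinfun (\<lambda>u. (0, u))"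
  have E1: "E1 h = (fst h, 0)" for h
    unfolding E1_def by (rule bounded_linear_Blinfun_apply[THEN fun_cong]) (intro bounded_linear_intros)
  have E2: "E2 u = (0, u)" for u
    unfolding E2_def by (rule bounded_linear_Blinfun_apply[THEN fun_cong]) (intro bounded_linear_intros)
  define F' where "F' x = E1 + (E2 o\<^sub>L G' x)" for x
  have F'_apply: "F' x h = (fst h, G' x h)" for x h
    by (simp add: F'_def E1 E2 blinfun.add_left)
  have derF: "(F has_derivative blinfun_apply (F' x)) (at x)" for x
  proof -
    have "(F has_derivative (\<lambda>h. (fst h, G' x h))) (at x)"
      unfolding F_def by (intro derivative_intros G')
    moreover have "(\<lambda>h. (fst h, G' x h)) = blinfun_apply (F' x)"
      by (simp add: fun_eq_iff F'_apply)
    ultimately show ?thesis by simp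
  qed
  have contF: "continuous_on UNIV F'"
    unfolding F'_def by (intro continuous_intros G')
  have "inj (blinfun_apply (F' (0, y0)))"
    unfolding linear_injective_0[OF bounded_linear.linear[OF blinfun.bounded_linear_right]]
  proof (intro allI impI)
    fix h assume h: "F' (0, y0) h = 0"
    then obtain v where v: "h = (0, v)" by (cases h) (auto simp: F'_apply zero_prod_def)
    have "((\<lambda>s. (0, y0 + s *\<^sub>R v)) has_derivative (\<lambda>s. (0, s *\<^sub>R v))) (at 0)"
      by (auto intro!: derivative_eq_intros)
    moreover have "(G has_derivative blinfun_apply (G' (0, y0))) (at (0, y0 + 0 *\<^sub>R v))"
      using G'(1) by simp
    ultimately have "((\<lambda>s. G (0, y0 + s *\<^sub>R v)) has_derivative (\<lambda>s. G' (0, y0) (0, s *\<^sub>R v))) (at 0)"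
      using has_derivative_compose by blast
    moreover have "G' (0, y0) (0, s *\<^sub>R v) = 0" for s
    proof -
      have "(0, s *\<^sub>R v) = s *\<^sub>R h" by (simp add: v)
      then show ?thesis
        using h by (simp add: blinfun.scaleR_right F'_apply zero_prod_def)
    qed
    ultimately have "v = 0"
      by (intro nondeg) (simp add: has_vector_derivative_def)
    then show "h = 0" by (simp add: v zero_prod_def)
  qed
  then obtain L where L: "linear L" "L \<circ> blinfun_apply (F' (0, y0)) = id"
    using linear_injective_left_inverse blinfun.bounded_linear_right bounded_linear.linear by blast
  have "Blinfun L o\<^sub>L F' (0, y0) = id_blinfun"
    using L(1) pointfree_idE[OF L(2)] by (intro blinfun_eqI)
      (simp add: bounded_linear_Blinfun_apply linear_conv_bounded_linear)
  from inverse_function_theorem[OF open_UNIV derF contF UNIV_I this]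
  obtain U V H where UV: "open U" "(0, y0) \<in> U" "open V" "F (0, y0) \<in> V" "homeomorphism U V F H"
    by metis
  have F0: "F (0, y0) = (0, 0)" by (simp add: F_def G)
  define g where "g t = snd (H (t, 0))" for t
  have "((\<lambda>t. (t, 0)) \<longlongrightarrow> (0, 0)) (at_right (0::real))"
    by (intro tendsto_intros)
  then have inV: "\<forall>\<^sub>F t in at_right 0. (t, 0) \<in> V"
    using UV F0 topological_tendstoD by fastforce
  have "isCont H (0, 0)"
    using UV F0 by (metis continuous_on_eq_continuous_at homeomorphism_def)
  then have "((\<lambda>t. H (t, 0)) \<longlongrightarrow> H (0, 0)) (at_right 0)"
    by (rule isCont_tendsto_compose) (intro tendsto_intros)
  moreover have "H (0, 0) = (0, y0)"
    using UV F0 by (metis homeomorphism_def)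
  ultimately have g1: "(g \<longlongrightarrow> y0) (at_right 0)"
    unfolding g_def by (metis snd_conv tendsto_snd)
  have g2: "\<forall>\<^sub>F t in at_right 0. G (t, g t) = 0"
    using inV
  proof eventually_elim
    case (elim t)
    then have "F (H (t, 0)) = (t, 0)" using UV by (metis homeomorphism_def)
    then show ?case by (cases "H (t, 0)") (auto simp: F_def g_def)
  qed
  obtain A B where AB: "open A" "open B" "0 \<in> A" "y0 \<in> B" "A \<times> B \<subseteq> U"
    using UV open_prod_elim by (metis mem_Sigma_iff)
  obtain \<epsilon> where \<epsilon>: "\<epsilon> > 0" "ball y0 \<epsilon> \<subseteq> B"
    using AB openE by blast
  have "\<forall>\<^sub>F t in at_right 0. t \<in> A"
    using AB by (intro topological_tendstoD[of "\<lambda>t. t"] tendsto_intros) auto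
  then have g3: "\<forall>\<^sub>F t in at_right 0. \<forall>y\<in>ball y0 \<epsilon>. G (t, y) = 0 \<longrightarrow> y = g t"
  proof eventually_elim
    case (elim t)
    show ?case
    proof (intro ballI impI)
      fix y assume "y \<in> ball y0 \<epsilon>" "G (t, y) = 0"
      then have "(t, y) \<in> U" "F (t, y) = (t, 0)"
        using elim AB \<epsilon> by (auto simp: F_def)
      then have "H (t, 0) = (t, y)" using UV by (metis homeomorphism_def)
      then show "y = g t" by (simp add: g_def)
    qed
  qed
  show ?thesis using that[OF \<epsilon>(1) g1 g2 g3] .
qed

section \<open>The symbol in rescaled coordinates\<close>

definition symbol_entry :: "'n::finite params \<Rightarrow> real^'n \<Rightarrow> 'n \<Rightarrow> 'n \<Rightarrow> real" where
  "symbol_entry c \<xi> a b = (\<Sum>k\<in>UNIV - {b}. c a k b * \<xi> $ k)"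

lemma principal_symbol_nth:
  "principal_symbol \<xi> c $ a $ b = (if a = b then \<xi> $ a else 0) + symbol_entry c \<xi> a b"
  by (auto simp: principal_symbol_def symbol_entry_def)

lemma symbol_entry_scale [simp]: "symbol_entry (scale_params t c) \<xi> a b = t * symbol_entry c \<xi> a b"
  by (simp add: symbol_entry_def scale_params_def sum_distrib_left mult_ac)

lemma symbol_entry_scaleR [simp]: "symbol_entry c (r *\<^sub>R \<xi>) a b = r * symbol_entry c \<xi> a b"
  by (simp add: symbol_entry_def sum_distrib_left mult_ac)

lemma Sigma_sing_scaleR:
  assumes "\<xi> \<in> Sigma_sing c" "r \<noteq> 0"
  shows "r *\<^sub>R \<xi> \<in> Sigma_sing c"
proof -
  have "principal_symbol (r *\<^sub>R \<xi>) c = r *\<^sub>R principal_symbol \<xi> c"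
    by (simp add: vec_eq_iff principal_symbol_nth algebra_simps)
  then show ?thesis using assms by (simp add: Sigma_sing_def rank_scaleR)
qed

text \<open>In the coordinates \<open>y\<close> of \<open>blowup I t y\<close>, the directions in \<open>I\<close> are measured on the scale \<open>t\<close>.\<close>

definition blowup :: "'n set \<Rightarrow> real \<Rightarrow> real^'n \<Rightarrow> real^'n" where
  "blowup I t y = (\<chi> a. if a \<in> I then t * y $ a else y $ a)"

definition blowdown :: "'n set \<Rightarrow> real \<Rightarrow> real^'n \<Rightarrow> real^'n" where
  "blowdown I t y = (\<chi> a. if a \<in> I then y $ a / t else y $ a)"

lemma blowup_blowdown: "t \<noteq> 0 \<Longrightarrow> blowup I t (blowdown I t y) = y"
  by (simp add: blowup_def blowdown_def vec_eq_iff)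

lemma blowdown_scaleR: "blowdown I t (r *\<^sub>R y) = r *\<^sub>R blowdown I t y"
  by (simp add: blowdown_def vec_eq_iff)

text \<open>The symbol at \<open>blowup I t y\<close> for the parameters \<open>t c\<close>, with the rows in \<open>I\<close> divided by \<open>t\<close>.  Unlike the symbol
  it carries nontrivial information at \<open>t = 0\<close>.\<close>

definition scaled_symbol :: "'n::finite params \<Rightarrow> 'n set \<Rightarrow> real \<Rightarrow> real^'n \<Rightarrow> real^'n^'n" where
  "scaled_symbol c I t y = (\<chi> a b. (if a = b then y $ a else 0)
      + (if a \<in> I then 1 else t) * symbol_entry c (blowup I t y) a b)"

text \<open>The \<open>I \<times> I\<close> block of \<open>scaled_symbol c I 0 y\<close>.  It decides the rank at \<open>t = 0\<close>, because there the remaining rows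
  are diagonal.  It is kept as a matrix over all indices, padded with zeros, so that \<open>I\<close> may vary.\<close>

definition core :: "'n::finite params \<Rightarrow> 'n set \<Rightarrow> real^'n \<Rightarrow> real^'n^'n" where
  "core c I y = (\<chi> a b. if a \<in> I \<and> b \<in> I
      then (if a = b then y $ a else 0) + (\<Sum>k\<in>-I. c a k b * y $ k) else 0)"

lemma core_scaleR: "core c I (r *\<^sub>R y) = r *\<^sub>R core c I y"
  by (simp add: core_def vec_eq_iff algebra_simps sum_distrib_left)

lemma rank_scaled_symbol:
  assumes "t \<noteq> 0"
  shows "rank (principal_symbol (blowup I t y) (scale_params t c)) = rank (scaled_symbol c I t y)"
proof -
  have "principal_symbol (blowup I t y) (scale_params t c)
      = (\<chi> a b. (if a \<in> I then t else 1) * scaled_symbol c I t y $ a $ b)"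
    by (auto simp: vec_eq_iff principal_symbol_nth scaled_symbol_def blowup_def algebra_simps)
  then show ?thesis
    using rank_scale_rows[of "\<lambda>a. if a \<in> I then t else 1" "scaled_symbol c I t y"] assms by simp
qed

lemma symbol_entry_supported:
  assumes "b \<in> I" "\<And>k. k \<in> I \<Longrightarrow> \<xi> $ k = 0"
  shows "symbol_entry c \<xi> a b = (\<Sum>k\<in>-I. c a k b * \<xi> $ k)"
  unfolding symbol_entry_def by (rule sum.mono_neutral_right) (use assms in auto)

lemma scaled_symbol_0:
  "scaled_symbol c I 0 y $ a $ b =
    (if a \<in> I \<and> b \<in> I then core c I y $ a $ b
     else if a \<in> I then symbol_entry c (blowup I 0 y) a b
     else if a = b then y $ a else 0)"
proof -
  have "symbol_entry c (blowup I 0 y) a b = (\<Sum>k\<in>-I. c a k b * blowup I 0 y $ k)" if "b \<in> I"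
    by (rule symbol_entry_supported[OF that]) (simp add: blowup_def)
  also have "\<dots> = (\<Sum>k\<in>-I. c a k b * y $ k)"
    by (rule sum.cong) (auto simp: blowup_def)
  finally show ?thesis
    by (auto simp: scaled_symbol_def core_def)
qed

section \<open>Limits of singular points\<close>

text \<open>The set \<open>I\<close> collects the coordinates of size \<open>O(t)\<close>.  The coordinates that tend to zero more slowly than \<open>t\<close> are
  outside \<open>I\<close> although they vanish in the limit; this is why only some coordinate of \<open>\<zeta>\<close> outside \<open>I\<close> is
  claimed to be nonzero here.\<close>

lemma limit_configuration:
  fixes c :: "'n::finite params" and T :: "nat \<Rightarrow> real" and X :: "nat \<Rightarrow> real^'n"
  assumes T: "\<And>n. T n > 0" "T \<longlonglongrightarrow> 0" and X: "\<And>n. X n \<in> Sigma_sing (scale_params (T n) c)"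
  obtains r I \<zeta> where "strict_mono r"
    "(\<lambda>n. blowdown I (T (r n)) ((1 / norm (X (r n))) *\<^sub>R X (r n))) \<longlonglongrightarrow> \<zeta>"
    "\<exists>k. k \<notin> I \<and> \<zeta> $ k \<noteq> 0" "rank (core c I \<zeta>) + 2 \<le> card I"
proof -
  have X0: "X n \<noteq> 0" for n using X[of n] by (simp add: Sigma_sing_def)
  define Y where "Y n = (1 / norm (X n)) *\<^sub>R X n" for n
  have Y: "Y n \<in> Sigma_sing (scale_params (T n) c)" for n
    unfolding Y_def using X X0 by (intro Sigma_sing_scaleR) auto
  have nY: "norm (Y n) = 1" for n using X0 by (simp add: Y_def)
  \<comment> \<open>The entries of \<open>diag w + diag v A(Y)\<close> are those of the symbol with row \<open>a\<close> divided by \<open>\<bar>Y\<^sub>a\<bar> + T\<close>; all of them are bounded.\<close>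
  define w :: "nat \<Rightarrow> real^'n" where "w n = (\<chi> a. Y n $ a / (\<bar>Y n $ a\<bar> + T n))" for n
  define v :: "nat \<Rightarrow> real^'n" where "v n = (\<chi> a. T n / (\<bar>Y n $ a\<bar> + T n))" for n
  have den: "\<bar>Y n $ a\<bar> + T n > 0" for n a using T(1)[of n] by linarith
  have wv: "\<bar>w n $ a\<bar> + v n $ a = 1" "v n $ a \<ge> 0" for n a
    using den[of n a] T(1)[of n] by (simp_all add: w_def v_def abs_divide add_divide_distrib[symmetric])
  have wv1: "\<bar>w n $ a\<bar> \<le> 1" "\<bar>v n $ a\<bar> \<le> 1" for n a using wv[of n a] by linarith+
  have nw: "norm (w n) \<le> real CARD('n)" "norm (v n) \<le> real CARD('n)" for n
  proof -
    have "norm (w n) \<le> (\<Sum>a\<in>UNIV. \<bar>w n $ a\<bar>)" "norm (v n) \<le> (\<Sum>a\<in>UNIV. \<bar>v n $ a\<bar>)"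
      by (rule norm_le_l1_cart)+
    also have "(\<Sum>a\<in>UNIV. \<bar>w n $ a\<bar>) \<le> (\<Sum>a\<in>(UNIV::'n set). 1)" by (intro sum_mono wv1)
    moreover have "(\<Sum>a\<in>UNIV. \<bar>v n $ a\<bar>) \<le> (\<Sum>a\<in>(UNIV::'n set). 1)" by (intro sum_mono wv1)
    ultimately show "norm (w n) \<le> real CARD('n)" "norm (v n) \<le> real CARD('n)" by simp_all
  qed
  have "bounded (range (\<lambda>n. (Y n, w n, v n)))"
  proof (rule bounded_subset)
    show "bounded (cball 0 1 \<times> cball 0 (real CARD('n)) \<times> cball 0 (real CARD('n)) :: ((real^'n) \<times> (real^'n) \<times> (real^'n)) set)"
      by (intro bounded_Times bounded_cball)
    show "range (\<lambda>n. (Y n, w n, v n)) \<subseteq> cball 0 1 \<times> cball 0 (real CARD('n)) \<times> cball 0 (real CARD('n))"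
      using nY nw by auto
  qed
  then obtain l r where r: "strict_mono r" "((\<lambda>n. (Y n, w n, v n)) \<circ> r) \<longlonglongrightarrow> l"
    using bounded_imp_convergent_subsequence by blast
  obtain Y0 w0 v0 where l: "l = (Y0, w0, v0)" by (cases l) auto
  have lim: "(\<lambda>n. Y (r n)) \<longlonglongrightarrow> Y0" "(\<lambda>n. w (r n)) \<longlonglongrightarrow> w0" "(\<lambda>n. v (r n)) \<longlonglongrightarrow> v0"
    using tendsto_fst[OF r(2)] tendsto_fst[OF tendsto_snd[OF r(2)]] tendsto_snd[OF tendsto_snd[OF r(2)]]
    by (simp_all add: l o_def)
  have limT: "(\<lambda>n. T (r n)) \<longlonglongrightarrow> 0" using LIMSEQ_subseq_LIMSEQ[OF T(2) r(1)] by (simp add: o_def)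
  have nY0: "norm Y0 = 1" using tendsto_norm[OF lim(1)] nY by (simp add: LIMSEQ_const_iff)
  have wv0: "\<bar>w0 $ a\<bar> + v0 $ a = 1" for a
  proof -
    have "(\<lambda>n. \<bar>w (r n) $ a\<bar> + v (r n) $ a) \<longlonglongrightarrow> \<bar>w0 $ a\<bar> + v0 $ a"
      by (intro tendsto_intros lim)
    then show ?thesis using wv by (simp add: LIMSEQ_const_iff)
  qed
  define R where "R Y w v = (\<chi> a b. (if a = b then w $ a else 0) + v $ a * symbol_entry c Y a b)"
    for Y w v :: "real^'n"
  have rank_R: "rank (R (Y n) (w n) (v n)) + 2 \<le> CARD('n)" for n
  proof -
    have "R (Y n) (w n) (v n) = (\<chi> a b. inverse (\<bar>Y n $ a\<bar> + T n) *
        principal_symbol (Y n) (scale_params (T n) c) $ a $ b)"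
      by (auto simp: R_def vec_eq_iff principal_symbol_nth w_def v_def divide_inverse algebra_simps)
    then have "rank (R (Y n) (w n) (v n)) = rank (principal_symbol (Y n) (scale_params (T n) c))"
      using rank_scale_rows[of "\<lambda>a. inverse (\<bar>Y n $ a\<bar> + T n)"] den[of n] by (simp add: less_imp_neq[symmetric])
    then show ?thesis using Y[of n] by (simp add: Sigma_sing_def)
  qed
  have two: "CARD('n) \<ge> 2" using rank_R[of 0] by linarith
  have "rank (R (Y (r n)) (w (r n)) (v (r n))) \<le> CARD('n) - 2" for n
    using rank_R[of "r n"] by linarith
  then have "\<forall>\<^sub>F n in sequentially. rank (R (Y (r n)) (w (r n)) (v (r n))) \<le> CARD('n) - 2"
    by simp
  moreover have "(\<lambda>n. R (Y (r n)) (w (r n)) (v (r n))) \<longlonglongrightarrow> R Y0 w0 v0"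
  proof -
    have ite: "((\<lambda>n. if P then f n else 0) \<longlongrightarrow> (if P then x else 0)) F"
      if "(f \<longlongrightarrow> x) F" for f :: "nat \<Rightarrow> real" and x F P using that by simp
    show ?thesis
      unfolding R_def symbol_entry_def
      by (intro tendsto_vec_lambda ite tendsto_intros lim)
  qed
  ultimately have "rank (R Y0 w0 v0) \<le> CARD('n) - 2"
    using rank_le_of_tendsto[of "\<lambda>n. R (Y (r n)) (w (r n)) (v (r n))"] by simp
  then have rR: "rank (R Y0 w0 v0) + 2 \<le> CARD('n)" using two by linarith
  \<comment> \<open>The limit of \<open>T / (\<bar>Y\<^sub>a\<bar> + T)\<close> is nonzero exactly when \<open>Y\<^sub>a / T\<close> stays bounded.\<close>
  define I where "I = {a. v0 $ a \<noteq> 0}"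
  define \<zeta> :: "real^'n" where "\<zeta> = (\<chi> a. if a \<in> I then w0 $ a / v0 $ a else Y0 $ a)"
  have quot: "(\<lambda>n. Y (r n) $ a / T (r n)) \<longlonglongrightarrow> w0 $ a / v0 $ a" if "a \<in> I" for a
  proof -
    have "Y n $ a / T n = w n $ a / v n $ a" for n
      using den[of n a] T(1)[of n] by (simp add: w_def v_def)
    moreover have "(\<lambda>n. w (r n) $ a / v (r n) $ a) \<longlonglongrightarrow> w0 $ a / v0 $ a"
      by (intro tendsto_intros lim) (use that in \<open>auto simp: I_def\<close>)
    ultimately show ?thesis by simp
  qed
  have Y0I: "Y0 $ a = 0" if "a \<in> I" for a
  proof -
    have "(\<lambda>n. Y (r n) $ a / T (r n) * T (r n)) \<longlonglongrightarrow> w0 $ a / v0 $ a * 0"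
      by (intro tendsto_intros quot that limT)
    moreover have "Y (r n) $ a / T (r n) * T (r n) = Y (r n) $ a" for n
      using T(1)[of "r n"] by simp
    ultimately have "(\<lambda>n. Y (r n) $ a) \<longlonglongrightarrow> 0" by simp
    moreover have "(\<lambda>n. Y (r n) $ a) \<longlonglongrightarrow> Y0 $ a" by (intro tendsto_intros lim)
    ultimately show ?thesis using LIMSEQ_unique by blast
  qed
  have "(\<lambda>n. blowdown I (T (r n)) (Y (r n))) \<longlonglongrightarrow> \<zeta>"
  proof (rule vec_tendstoI)
    fix a
    have "(\<lambda>n. Y (r n) $ a) \<longlonglongrightarrow> Y0 $ a" by (intro tendsto_intros lim)
    then show "(\<lambda>n. blowdown I (T (r n)) (Y (r n)) $ a) \<longlonglongrightarrow> \<zeta> $ a"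
      using quot by (simp add: blowdown_def \<zeta>_def)
  qed
  moreover have "\<exists>k. k \<notin> I \<and> \<zeta> $ k \<noteq> 0"
  proof (rule ccontr)
    assume "\<not> ?thesis"
    then have "Y0 $ a = 0" for a
      by (cases "a \<in> I") (auto simp: Y0I \<zeta>_def split: if_splits)
    then have "Y0 = 0" by (simp add: vec_eq_iff)
    then show False using nY0 by simp
  qed
  moreover have "rank (core c I \<zeta>) + 2 \<le> card I"
  proof -
    have "rank (R Y0 w0 v0) = card (-I) + rank (\<chi> a b. if a \<in> -I \<or> b \<in> -I then 0 else R Y0 w0 v0 $ a $ b)"
    proof (rule rank_unit_rows[where d = "\<lambda>k. w0 $ k"])
      fix k assume "k \<in> -I"
      then have "v0 $ k = 0" by (simp add: I_def)
      then show "R Y0 w0 v0 $ k $ b = (if b = k then w0 $ k else 0)" "w0 $ k \<noteq> 0" for b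
        using wv0[of k] by (auto simp: R_def)
    qed
    also have "(\<chi> a b. if a \<in> -I \<or> b \<in> -I then 0 else R Y0 w0 v0 $ a $ b)
        = (\<chi> a b. (if a \<in> I then v0 $ a else 1) * core c I \<zeta> $ a $ b)"
    proof -
      have "symbol_entry c Y0 a b = (\<Sum>k\<in>-I. c a k b * \<zeta> $ k)" if "b \<in> I" for a b
      proof -
        have "symbol_entry c Y0 a b = (\<Sum>k\<in>-I. c a k b * Y0 $ k)"
          by (rule symbol_entry_supported[OF that Y0I])
        also have "\<dots> = (\<Sum>k\<in>-I. c a k b * \<zeta> $ k)" by (rule sum.cong) (auto simp: \<zeta>_def)
        finally show ?thesis .
      qed
      then show ?thesis
        by (auto simp: vec_eq_iff R_def core_def I_def algebra_simps) (auto simp: \<zeta>_def I_def)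
    qed
    also have "rank \<dots> = rank (core c I \<zeta>)"
      by (rule rank_scale_rows) (auto simp: I_def)
    finally have "card (-I) + rank (core c I \<zeta>) + 2 \<le> CARD('n)" using rR by simp
    moreover have "CARD('n) = card I + card (-I)"
      using card_Un_disjoint[of I "-I"] by (simp add: Compl_partition)
    ultimately show ?thesis by simp
  qed
  ultimately show ?thesis using that r(1) unfolding Y_def by blast
qed

section \<open>Branches of singular points\<close>

text \<open>The configuration \<open>y\<close>, normalized by \<open>y $ k = 1\<close>, lies on exactly one branch of singular points as \<open>t\<close> leaves \<open>0\<close>.
  The normalization picks one vector on each line.\<close>

definition persists :: "'n::finite params \<Rightarrow> 'n set \<Rightarrow> 'n \<Rightarrow> real^'n \<Rightarrow> bool" where
  "persists c I k y \<longleftrightarrow> (\<exists>g \<epsilon>. \<epsilon> > 0 \<and> (g \<longlongrightarrow> y) (at_right 0) \<and>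
    (\<forall>\<^sub>F t in at_right 0. g t $ k = 1 \<and> rank (scaled_symbol c I t (g t)) + 2 \<le> CARD('n)) \<and>
    (\<forall>\<^sub>F t in at_right 0. \<forall>y'\<in>ball y \<epsilon>.
      y' $ k = 1 \<and> rank (scaled_symbol c I t y') + 2 \<le> CARD('n) \<longrightarrow> y' = g t))"

text \<open>Different configurations give different points: for the same \<open>I\<close> the normalized vectors have different
  limits, and for different \<open>I\<close> the points have coordinates vanishing at different rates.  If \<open>Z\<close> contains all
  limit configurations then the branches exhaust the singular set, since otherwise points off the branches
  would, by \<open>limit_configuration\<close>, accumulate at a configuration in \<open>Z\<close> and contradict the uniqueness of its
  branch.\<close>

lemma branches:
  fixes c :: "'n::finite params" and Z :: "('n set \<times> (real^'n)) set"
  assumes fin: "finite Z"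
    and nz: "\<And>I y l. (I, y) \<in> Z \<Longrightarrow> l \<notin> I \<Longrightarrow> y $ l \<noteq> 0"
    and k: "\<And>I y. (I, y) \<in> Z \<Longrightarrow> kk I \<notin> I"
    and pers: "\<And>I y. (I, y) \<in> Z \<Longrightarrow> persists c I (kk I) y"
  obtains \<Phi>
  where "\<forall>\<^sub>F t in at_right 0. inj_on (\<Phi> t) Z \<and> \<Phi> t ` Z \<subseteq> projective_image (Sigma_sing (scale_params t c))"
    and "(\<forall>I \<zeta> l. l \<notin> I \<and> \<zeta> $ l \<noteq> 0 \<and> rank (core c I \<zeta>) + 2 \<le> card I \<longrightarrow>
        \<zeta> $ kk I \<noteq> 0 \<and> (I, (1 / \<zeta> $ kk I) *\<^sub>R \<zeta>) \<in> Z)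
      \<longrightarrow> (\<forall>\<^sub>F t in at_right 0. projective_image (Sigma_sing (scale_params t c)) \<subseteq> \<Phi> t ` Z)"
proof -
  define Q where "Q z g \<epsilon> \<longleftrightarrow> \<epsilon> > 0 \<and> (g \<longlongrightarrow> snd z) (at_right 0) \<and>
    (\<forall>\<^sub>F t in at_right 0. g t $ kk (fst z) = 1 \<and> rank (scaled_symbol c (fst z) t (g t)) + 2 \<le> CARD('n)) \<and>
    (\<forall>\<^sub>F t in at_right 0. \<forall>y'\<in>ball (snd z) \<epsilon>.
      y' $ kk (fst z) = 1 \<and> rank (scaled_symbol c (fst z) t y') + 2 \<le> CARD('n) \<longrightarrow> y' = g t)"
    for z :: "'n set \<times> (real^'n)" and g :: "real \<Rightarrow> real^'n" and \<epsilon>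
  have "\<forall>z\<in>Z. \<exists>g \<epsilon>. Q z g \<epsilon>"
    using pers unfolding persists_def Q_def by auto
  from bchoice[OF this] obtain g where "\<forall>z\<in>Z. \<exists>\<epsilon>. Q z (g z) \<epsilon>" ..
  from bchoice[OF this] obtain \<epsilon> where "\<forall>z\<in>Z. Q z (g z) (\<epsilon> z)" ..
  then have g: "\<And>z. z \<in> Z \<Longrightarrow> \<epsilon> z > 0" "\<And>z. z \<in> Z \<Longrightarrow> (g z \<longlongrightarrow> snd z) (at_right 0)"
    "\<And>z. z \<in> Z \<Longrightarrow> \<forall>\<^sub>F t in at_right 0. g z t $ kk (fst z) = 1 \<and> rank (scaled_symbol c (fst z) t (g z t)) + 2 \<le> CARD('n)"
    "\<And>z. z \<in> Z \<Longrightarrow> \<forall>\<^sub>F t in at_right 0. \<forall>y'\<in>ball (snd z) (\<epsilon> z).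
      y' $ kk (fst z) = 1 \<and> rank (scaled_symbol c (fst z) t y') + 2 \<le> CARD('n) \<longrightarrow> y' = g z t"
    unfolding Q_def by blast+
  define \<Phi> where "\<Phi> t z = span {blowup (fst z) t (g z t)}" for t z
  have pos: "\<forall>\<^sub>F t in at_right (0::real). t > 0"
    by (simp add: eventually_at_right_less)
  have ev: "\<forall>\<^sub>F t in at_right 0. \<forall>z\<in>Z. g z t $ kk (fst z) = 1 \<and> rank (scaled_symbol c (fst z) t (g z t)) + 2 \<le> CARD('n)"
    using g(3) fin by (simp add: eventually_ball_finite_distrib)
  have img: "\<forall>\<^sub>F t in at_right 0. \<Phi> t ` Z \<subseteq> projective_image (Sigma_sing (scale_params t c))"
    using ev pos
  proof eventually_elim
    case (elim t)
    have "blowup (fst z) t (g z t) \<in> Sigma_sing (scale_params t c)" if "z \<in> Z" for z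
    proof -
      have "kk (fst z) \<notin> fst z" using that k[of "fst z" "snd z"] by simp
      then have "blowup (fst z) t (g z t) $ kk (fst z) = 1"
        using elim that by (simp add: blowup_def)
      then have "blowup (fst z) t (g z t) \<noteq> 0" by auto
      then show ?thesis using elim that by (simp add: Sigma_sing_def rank_scaled_symbol)
    qed
    then show ?case by (auto simp: \<Phi>_def projective_image_def)
  qed
  have sep: "\<forall>\<^sub>F t in at_right 0. \<Phi> t z \<noteq> \<Phi> t z'" if z: "z \<in> Z" "z' \<in> Z" "z \<noteq> z'"
      and sub: "fst z = fst z' \<or> \<not> fst z \<subseteq> fst z'" for z z'
  proof -
    obtain I y I' y' where zz: "z = (I, y)" "z' = (I', y')" by (cases z, cases z')
    have lim: "((\<lambda>t. g z t $ a) \<longlongrightarrow> y $ a) (at_right 0)" "((\<lambda>t. g z' t $ a) \<longlongrightarrow> y' $ a) (at_right 0)" for a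
      using tendsto_vec_nth[OF g(2)[OF z(1)]] tendsto_vec_nth[OF g(2)[OF z(2)]] by (simp_all add: zz)
    have lam: "\<exists>\<mu>. blowup I t (g z t) = \<mu> *\<^sub>R blowup I' t (g z' t)" if "\<Phi> t z = \<Phi> t z'" for t
    proof -
      have "blowup I t (g z t) \<in> span {blowup I' t (g z' t)}"
        using that span_base[of "blowup I t (g z t)" "{blowup I t (g z t)}"] by (simp add: \<Phi>_def zz)
      then show ?thesis by (auto simp: span_singleton)
    qed
    show ?thesis
    proof (cases "I = I'")
      case True
      then have "y \<noteq> y'" using z zz by simp
      then obtain a where a: "y $ a \<noteq> y' $ a" by (auto simp: vec_eq_iff)
      have "((\<lambda>t. g z t $ a - g z' t $ a) \<longlongrightarrow> y $ a - y' $ a) (at_right 0)"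
        by (intro tendsto_intros lim)
      then have "\<forall>\<^sub>F t in at_right 0. g z t $ a - g z' t $ a \<noteq> 0"
        using a by (intro tendsto_imp_eventually_ne) auto
      then show ?thesis using ev pos
      proof eventually_elim
        case (elim t)
        show ?case
        proof
          assume "\<Phi> t z = \<Phi> t z'"
          then obtain \<mu> where "blowup I t (g z t) = \<mu> *\<^sub>R blowup I' t (g z' t)" using lam by blast
          then have l: "blowup I t (g z t) $ b = \<mu> * blowup I' t (g z' t) $ b" for b by simp
          have "\<mu> = 1"
            using l[of "kk I"] bspec[OF elim(2) z(1)] bspec[OF elim(2) z(2)] k[of I y] z True
            by (simp add: blowup_def zz)
          then show False
            using l[of a] elim True by (auto simp: blowup_def split: if_splits)
        qed
      qed
    next
      case False
      then obtain a where a: "a \<in> I" "a \<notin> I'" using sub zz by auto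
      \<comment> \<open>If both lines agreed, the factor between the vectors would be \<open>?\<mu> t\<close>, by coordinate \<open>a\<close>, and tend to \<open>0\<close>; coordinate \<open>?k\<close> then
        gives \<open>1 = ?\<mu> t * ?b t\<close> with \<open>?b\<close> convergent.\<close>
      have ya: "y' $ a \<noteq> 0" using nz[of I' y' a] z a zz by simp
      let ?k = "kk I"
      have k0: "?k \<notin> I" using k[of I y] z zz by simp
      let ?\<mu> = "\<lambda>t. t * g z t $ a / g z' t $ a"
      let ?b = "\<lambda>t. if ?k \<in> I' then t * g z' t $ ?k else g z' t $ ?k"
      have tt: "((\<lambda>t. t) \<longlongrightarrow> 0) (at_right (0::real))" by (intro tendsto_intros)
      have 1: "(?\<mu> \<longlongrightarrow> 0 * y $ a / y' $ a) (at_right 0)"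
        by (intro tendsto_intros lim tt ya)
      have 2: "(?b \<longlongrightarrow> (if ?k \<in> I' then 0 * y' $ ?k else y' $ ?k)) (at_right 0)"
      proof (cases "?k \<in> I'")
        case True
        have "((\<lambda>t. t * g z' t $ ?k) \<longlongrightarrow> 0 * y' $ ?k) (at_right 0)" by (intro tendsto_intros lim tt)
        with True show ?thesis by simp
      next
        case False
        then show ?thesis using lim by simp
      qed
      have "((\<lambda>t. ?\<mu> t * ?b t) \<longlongrightarrow> 0) (at_right 0)"
        using tendsto_mult[OF 1 2] by simp
      then have "\<forall>\<^sub>F t in at_right 0. ?\<mu> t * ?b t < 1" by (rule order_tendstoD) simp
      moreover have "\<forall>\<^sub>F t in at_right 0. g z' t $ a \<noteq> 0"
        using lim ya by (intro tendsto_imp_eventually_ne)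
      ultimately show ?thesis using ev pos
      proof eventually_elim
        case (elim t)
        show ?case
        proof
          assume "\<Phi> t z = \<Phi> t z'"
          then obtain \<mu> where "blowup I t (g z t) = \<mu> *\<^sub>R blowup I' t (g z' t)" using lam by blast
          then have l: "blowup I t (g z t) $ b = \<mu> * blowup I' t (g z' t) $ b" for b by simp
          have "\<mu> = ?\<mu> t" using l[of a] a elim by (simp add: blowup_def field_simps)
          moreover have "g z t $ ?k = 1" using elim z zz by auto
          then have "1 = \<mu> * ?b t" using l[of ?k] k0 by (simp add: blowup_def)
          ultimately show False using elim by simp
        qed
      qed
    qed
  qed
  have sep': "\<forall>\<^sub>F t in at_right 0. z \<noteq> z' \<longrightarrow> \<Phi> t z \<noteq> \<Phi> t z'" if z: "z \<in> Z" "z' \<in> Z" for z z'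
  proof (cases "z = z'")
    case False
    show ?thesis
    proof (cases "fst z = fst z' \<or> \<not> fst z \<subseteq> fst z'")
      case True
      from sep[OF z False True] show ?thesis by simp
    next
      case False': False
      then have "fst z' = fst z \<or> \<not> fst z' \<subseteq> fst z" by blast
      from sep[OF z(2,1) False[symmetric] this] show ?thesis by eventually_elim simp
    qed
  qed simp
  have "\<forall>\<^sub>F t in at_right 0. \<forall>z\<in>Z. \<forall>z'\<in>Z. z \<noteq> z' \<longrightarrow> \<Phi> t z \<noteq> \<Phi> t z'"
    using sep' fin by (simp add: eventually_ball_finite_distrib)
  then have inj: "\<forall>\<^sub>F t in at_right 0. inj_on (\<Phi> t) Z"
    by eventually_elim (auto simp: inj_on_def)
  have surj: "\<forall>\<^sub>F t in at_right 0. projective_image (Sigma_sing (scale_params t c)) \<subseteq> \<Phi> t ` Z"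
    if complete: "\<forall>I \<zeta> l. l \<notin> I \<and> \<zeta> $ l \<noteq> 0 \<and> rank (core c I \<zeta>) + 2 \<le> card I \<longrightarrow>
        \<zeta> $ kk I \<noteq> 0 \<and> (I, (1 / \<zeta> $ kk I) *\<^sub>R \<zeta>) \<in> Z"
  proof (rule ccontr)
    let ?bad = "\<lambda>t. t > 0 \<and> \<not> projective_image (Sigma_sing (scale_params t c)) \<subseteq> \<Phi> t ` Z"
    assume "\<not> ?thesis"
    then have freq: "\<exists>\<^sub>F t in at_right 0. \<not> projective_image (Sigma_sing (scale_params t c)) \<subseteq> \<Phi> t ` Z"
      by (simp add: frequently_def)
    have "\<exists>t. ?bad t \<and> t < 1 / real (Suc n)" for n
    proof -
      have "\<forall>\<^sub>F t in at_right (0::real). t < 1 / real (Suc n)"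
        by (rule order_tendstoD[of "\<lambda>t. t" 0]) (auto intro: tendsto_intros)
      from frequently_ex[OF frequently_eventually_frequently[OF freq eventually_conj[OF pos this]]]
      show ?thesis by blast
    qed
    then obtain T where T: "\<And>n. ?bad (T n)" "\<And>n. T n < 1 / real (Suc n)" by metis
    then have "\<forall>n. \<exists>x. x \<in> Sigma_sing (scale_params (T n) c) \<and> span {x} \<notin> \<Phi> (T n) ` Z"
      by (fastforce simp: projective_image_def)
    then obtain X where X: "\<And>n. X n \<in> Sigma_sing (scale_params (T n) c)" "\<And>n. span {X n} \<notin> \<Phi> (T n) ` Z"
      by metis
    have Tpos: "T n > 0" for n using T(1) by blast
    have T0: "T \<longlonglongrightarrow> 0"
    proof (rule real_tendsto_sandwich[of "\<lambda>_. 0" T _ "\<lambda>n. 1 / real (Suc n)"])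
      show "(\<lambda>n. 1 / real (Suc n)) \<longlonglongrightarrow> 0" by (rule LIMSEQ_Suc[OF lim_1_over_n])
      show "\<forall>\<^sub>F n in sequentially. 0 \<le> T n"
        by (rule always_eventually) (use Tpos less_imp_le in blast)
      show "\<forall>\<^sub>F n in sequentially. T n \<le> 1 / real (Suc n)"
        by (rule always_eventually) (use T(2) less_imp_le in blast)
    qed simp
    obtain r I \<zeta> where r: "strict_mono r"
      "(\<lambda>n. blowdown I (T (r n)) ((1 / norm (X (r n))) *\<^sub>R X (r n))) \<longlonglongrightarrow> \<zeta>"
      "\<exists>k. k \<notin> I \<and> \<zeta> $ k \<noteq> 0" "rank (core c I \<zeta>) + 2 \<le> card I"
      using limit_configuration[OF Tpos T0 X(1)] by blast
    define k0 where "k0 = kk I"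
    define y where "y = (1 / \<zeta> $ k0) *\<^sub>R \<zeta>"
    have zk: "\<zeta> $ k0 \<noteq> 0" and yZ: "(I, y) \<in> Z"
      using complete r(3,4) unfolding k0_def y_def by blast+
    have kI: "k0 \<notin> I" using k[OF yZ] by (simp add: k0_def)
    define B where "B n = blowdown I (T (r n)) ((1 / norm (X (r n))) *\<^sub>R X (r n))" for n
    define Y where "Y n = (1 / B n $ k0) *\<^sub>R B n" for n
    have limB: "B \<longlonglongrightarrow> \<zeta>" using r(2) by (simp add: B_def[abs_def])
    have "(\<lambda>n. B n $ k0) \<longlonglongrightarrow> \<zeta> $ k0" by (intro tendsto_intros limB)
    then have evB: "\<forall>\<^sub>F n in sequentially. B n $ k0 \<noteq> 0" using zk tendsto_imp_eventually_ne by blast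
    have "Y \<longlonglongrightarrow> y" unfolding Y_def y_def by (intro tendsto_intros limB zk)
    then have evY: "\<forall>\<^sub>F n in sequentially. Y n \<in> ball y (\<epsilon> (I, y))"
      using g(1)[OF yZ] by (intro topological_tendstoD) auto
    have "filterlim (\<lambda>n. T (r n)) (at_right 0) sequentially"
      using LIMSEQ_subseq_LIMSEQ[OF T0 r(1)] Tpos
      by (simp add: filterlim_at o_def less_imp_neq[THEN not_sym])
    from eventually_compose_filterlim[OF g(4)[OF yZ] this] evB evY
    have "\<forall>\<^sub>F n in sequentially. False"
    proof eventually_elim
      case (elim n)
      have XY: "X (r n) \<noteq> 0" using X(1)[of "r n"] by (simp add: Sigma_sing_def)
      define s where "s = (1 / B n $ k0) * (1 / norm (X (r n)))"
      have s: "s \<noteq> 0" using elim XY by (simp add: s_def)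
      have "blowup I (T (r n)) (Y n) = s *\<^sub>R X (r n)"
        unfolding Y_def B_def blowdown_scaleR[symmetric] s_def
        using Tpos[of "r n"] by (simp add: blowup_blowdown)
      moreover have "s *\<^sub>R X (r n) \<in> Sigma_sing (scale_params (T (r n)) c)"
        using X(1) s by (intro Sigma_sing_scaleR)
      ultimately have "rank (scaled_symbol c I (T (r n)) (Y n)) + 2 \<le> CARD('n)"
        using rank_scaled_symbol[of "T (r n)" I "Y n" c] Tpos[of "r n"] by (simp add: Sigma_sing_def)
      moreover have "Y n $ k0 = 1" using elim by (simp add: Y_def)
      ultimately have "Y n = g (I, y) (T (r n))" using elim by (simp add: k0_def)
      with \<open>blowup I (T (r n)) (Y n) = s *\<^sub>R X (r n)\<close>
      have "\<Phi> (T (r n)) (I, y) = span {s *\<^sub>R X (r n)}" by (simp add: \<Phi>_def)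
      also have "\<dots> = span {X (r n)}"
      proof -
        have "range (\<lambda>q. q *\<^sub>R s *\<^sub>R X (r n)) = range (\<lambda>q. q *\<^sub>R X (r n))"
        proof
          show "range (\<lambda>q. q *\<^sub>R X (r n)) \<subseteq> range (\<lambda>q. q *\<^sub>R s *\<^sub>R X (r n))"
          proof (rule image_subsetI)
            fix q show "q *\<^sub>R X (r n) \<in> range (\<lambda>q. q *\<^sub>R s *\<^sub>R X (r n))"
              using s by (intro range_eqI[of _ _ "q / s"]) simp
          qed
        qed auto
        then show ?thesis by (simp add: span_singleton)
      qed
      finally show False using X(2)[of "r n"] yZ by (metis imageI)
    qed
    then show False by simp
  qed
  show ?thesis
  proof (rule that[of \<Phi>])
    show "\<forall>\<^sub>F t in at_right 0. inj_on (\<Phi> t) Z \<and> \<Phi> t ` Z \<subseteq> projective_image (Sigma_sing (scale_params t c))"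
      by (rule eventually_conj[OF inj img])
  qed (use surj in blast)
qed

section \<open>Persistence from a regular system of equations\<close>

lemma real_polynomial_function_pivot:
  assumes "\<And>a b. real_polynomial_function (\<lambda>z. M z $ a $ b)"
  shows "real_polynomial_function (\<lambda>z. pivot p q (M z) $ a $ b)"
  unfolding pivot_def by (simp add: assms real_polynomial_function_diff real_polynomial_function.intros(4))

lemma real_polynomial_function_nth:
  "real_polynomial_function (\<lambda>y :: real^'n::finite. y $ a)"
  "real_polynomial_function (\<lambda>z :: real \<times> (real^'n::finite). snd z $ a)"
  "real_polynomial_function (\<lambda>z :: real \<times> (real^'n::finite). fst z)"
  using bounded_linear_vec_nth bounded_linear_compose[OF bounded_linear_vec_nth bounded_linear_snd]
    bounded_linear_fst
  by (auto intro!: real_polynomial_function.intros(1))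

lemma real_polynomial_function_scaled_symbol:
  fixes c :: "'n::finite params"
  shows "real_polynomial_function (\<lambda>z. scaled_symbol c I (fst z) (snd z) $ a $ b)"
proof -
  note poly = real_polynomial_function_nth real_polynomial_function.intros(2-4)
  have 1: "real_polynomial_function (\<lambda>z. blowup I (fst z) (snd z) $ k)" for k
    by (cases "k \<in> I") (simp_all add: blowup_def poly)
  have 2: "real_polynomial_function (\<lambda>z. symbol_entry c (blowup I (fst z) (snd z)) a b)"
    unfolding symbol_entry_def by (intro real_polynomial_function_sum) (simp_all add: 1 poly)
  have 3: "real_polynomial_function (\<lambda>z :: real \<times> (real^'n). if a = b then snd z $ a else 0)"
    by (cases "a = b") (simp_all add: poly)
  have 4: "real_polynomial_function (\<lambda>z :: real \<times> (real^'n). if a \<in> I then 1 else fst z)"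
    by (cases "a \<in> I") (simp_all add: poly)
  show ?thesis
    unfolding scaled_symbol_def by (simp add: 1 2 3 4 poly)
qed

lemma has_real_derivative_along_line:
  fixes p :: "'a::euclidean_space \<Rightarrow> real"
  assumes "real_polynomial_function p"
  shows "\<exists>D. ((\<lambda>s. p (y + s *\<^sub>R v)) has_real_derivative D) (at 0)"
proof -
  from C1_real_polynomial[OF assms] obtain p' :: "'a \<Rightarrow> 'a \<Rightarrow>\<^sub>L real"
    where p': "\<forall>x. (p has_derivative blinfun_apply (p' x)) (at x)" by blast
  have "((\<lambda>s. y + s *\<^sub>R v) has_derivative (\<lambda>s. s *\<^sub>R v)) (at 0)"
    by (auto intro!: derivative_eq_intros)
  moreover have "(p has_derivative blinfun_apply (p' y)) (at (y + 0 *\<^sub>R v))" using p' by simp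
  ultimately have "((\<lambda>s. p (y + s *\<^sub>R v)) has_derivative (\<lambda>s. p' y (s *\<^sub>R v))) (at 0)"
    using has_derivative_compose by blast
  moreover have "p' y (s *\<^sub>R v) = p' y v * s" for s by (simp add: blinfun.scaleR_right)
  ultimately show ?thesis by (auto simp: has_field_derivative_def)
qed

lemma distinct_UNIV_5:
  assumes "distinct [i, j, k, l, m :: 5]"
  shows "UNIV = {i, j, k, l, m}"
proof -
  have "card {i, j, k, l, m} = 5" using assms by simp
  then show ?thesis
    using card_subset_eq[of "UNIV :: 5 set" "{i, j, k, l, m}"] by simp
qed

text \<open>The \<open>(p, q)\<close> pivots clear three rows and three columns, so that four entries remain.\<close>

lemma rank_le_3_iff:
  fixes M :: "real^5^5"
  assumes rows: "distinct [p1, p2, p3, r1, r2]" and cols: "distinct [q1, q2, q3, s1, s2]"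
    and nz: "M $ p1 $ q1 \<noteq> 0" "pivot p1 q1 M $ p2 $ q2 \<noteq> 0" "pivot p2 q2 (pivot p1 q1 M) $ p3 $ q3 \<noteq> 0"
  shows "rank M + 2 \<le> CARD(5) \<longleftrightarrow>
    (\<forall>r\<in>{r1, r2}. \<forall>s\<in>{s1, s2}. pivot p3 q3 (pivot p2 q2 (pivot p1 q1 M)) $ r $ s = 0)"
proof -
  let ?W = "pivot p3 q3 (pivot p2 q2 (pivot p1 q1 M))"
  have "rank M = 3 + rank ?W"
    using rank_pivot[OF nz(1)] rank_pivot[OF nz(2)] rank_pivot[OF nz(3)] by simp
  then have "rank M + 2 \<le> CARD(5) \<longleftrightarrow> ?W = 0" by (simp add: rank_eq_0)
  also have "\<dots> \<longleftrightarrow> (\<forall>r\<in>{r1, r2}. \<forall>s\<in>{s1, s2}. ?W $ r $ s = 0)"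
  proof
    assume *: "\<forall>r\<in>{r1, r2}. \<forall>s\<in>{s1, s2}. ?W $ r $ s = 0"
    have "?W $ a $ b = 0" for a b
    proof (cases "a \<in> {p1, p2, p3} \<or> b \<in> {q1, q2, q3}")
      case True
      then show ?thesis by (auto simp: pivot_def)
    next
      case False
      moreover have "a \<in> {p1, p2, p3, r1, r2}" "b \<in> {q1, q2, q3, s1, s2}"
        using distinct_UNIV_5[OF rows] distinct_UNIV_5[OF cols] by blast+
      ultimately have "a \<in> {r1, r2}" "b \<in> {s1, s2}" by blast+
      then show ?thesis using * by blast
    qed
    then show "?W = 0" by (simp add: vec_eq_iff)
  qed simp
  finally show ?thesis .
qed

text \<open>Near the configuration the three pivots stay nonzero, so the singular points are the zeros of the four
  remaining entries.  At \<open>t = 0\<close> these entries are \<open>h\<close> times simpler polynomials \<open>f\<close>; the factor \<open>h\<close>, a product of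
  powers of the coordinates outside \<open>I\<close>, affects neither the zeros nor their nondegeneracy.\<close>

lemma persists_by_pivots:
  fixes c :: "5 params" and f :: "5 \<Rightarrow> 5 \<Rightarrow> real^5 \<Rightarrow> real" and h :: "real^5 \<Rightarrow> real"
  assumes rows: "distinct [p1, p2, p3, r1, r2]" and cols: "distinct [q1, q2, q3, s1, s2]"
    and yk: "y0 $ k = 1"
    and nz: "scaled_symbol c I 0 y0 $ p1 $ q1 \<noteq> 0"
      "pivot p1 q1 (scaled_symbol c I 0 y0) $ p2 $ q2 \<noteq> 0"
      "pivot p2 q2 (pivot p1 q1 (scaled_symbol c I 0 y0)) $ p3 $ q3 \<noteq> 0"
    and fac: "\<And>r s y. r \<in> {r1, r2} \<Longrightarrow> s \<in> {s1, s2} \<Longrightarrow>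
      pivot p3 q3 (pivot p2 q2 (pivot p1 q1 (scaled_symbol c I 0 y))) $ r $ s = h y * f r s y"
    and poly: "real_polynomial_function h"
      "\<And>r s. r \<in> {r1, r2} \<Longrightarrow> s \<in> {s1, s2} \<Longrightarrow> real_polynomial_function (f r s)"
    and h: "h y0 \<noteq> 0" and f: "\<And>r s. r \<in> {r1, r2} \<Longrightarrow> s \<in> {s1, s2} \<Longrightarrow> f r s y0 = 0"
    and nondeg: "\<And>v. v $ k = 0 \<Longrightarrow>
      (\<And>r s. r \<in> {r1, r2} \<Longrightarrow> s \<in> {s1, s2} \<Longrightarrow>
        ((\<lambda>x. f r s (y0 + x *\<^sub>R v)) has_real_derivative 0) (at 0)) \<Longrightarrow> v = 0"
  shows "persists c I k y0"
proof -
  define S where "S z = scaled_symbol c I (fst z) (snd z)" for z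
  define W where "W z = pivot p3 q3 (pivot p2 q2 (pivot p1 q1 (S z)))" for z
  have polyS: "real_polynomial_function (\<lambda>z. S z $ a $ b)" for a b
    unfolding S_def by (rule real_polynomial_function_scaled_symbol)
  note poly1 = real_polynomial_function_pivot[of S, OF polyS]
  note poly2 = real_polynomial_function_pivot[of "\<lambda>z. pivot p1 q1 (S z)", OF poly1]
  have polyW: "real_polynomial_function (\<lambda>z. W z $ a $ b)" for a b
    unfolding W_def by (rule real_polynomial_function_pivot[OF poly2])
  \<comment> \<open>The normalization and the four remaining entries; the enumeration of the rows serves to number the five equations.\<close>
  define G :: "real \<times> (real^5) \<Rightarrow> real^5" where
    "G z = (\<chi> e. if e = p1 then snd z $ k - 1 else if e = p2 then W z $ r1 $ s1
      else if e = p3 then W z $ r1 $ s2 else if e = r1 then W z $ r2 $ s1 else W z $ r2 $ s2)" for z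
  have Gnth: "G z $ p1 = snd z $ k - 1" "G z $ p2 = W z $ r1 $ s1" "G z $ p3 = W z $ r1 $ s2"
    "G z $ r1 = W z $ r2 $ s1" "G z $ r2 = W z $ r2 $ s2" for z
    using rows by (auto simp: G_def)
  have G0: "G z = 0 \<longleftrightarrow> snd z $ k = 1 \<and> (\<forall>r\<in>{r1, r2}. \<forall>s\<in>{s1, s2}. W z $ r $ s = 0)" for z
  proof -
    have "G z = 0 \<longleftrightarrow> (\<forall>e\<in>UNIV. G z $ e = 0)" by (simp add: vec_eq_iff)
    also have "\<dots> \<longleftrightarrow> snd z $ k = 1 \<and> (\<forall>r\<in>{r1, r2}. \<forall>s\<in>{s1, s2}. W z $ r $ s = 0)"
      unfolding distinct_UNIV_5[OF rows] by (auto simp: Gnth)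
    finally show ?thesis .
  qed
  have "real_polynomial_function (\<lambda>z. G z $ e)" for e
  proof -
    have "real_polynomial_function (\<lambda>z. G z $ e)" if "e \<in> {p1, p2, p3, r1, r2}" for e
      using that real_polynomial_function_nth(2)[of k] polyW
      by (auto simp: Gnth intro!: real_polynomial_function_diff)
    then show ?thesis using distinct_UNIV_5[OF rows] by blast
  qed
  then have polyG: "polynomial_function G"
    by (auto simp: polynomial_function_iff_Basis_inner Basis_vec_def inner_axis)
  have W0: "W (0, y) $ r $ s = h y * f r s y" if "r \<in> {r1, r2}" "s \<in> {s1, s2}" for r s y
    using fac[OF that] by (simp add: W_def S_def)
  have "G (0, y0) = 0" unfolding G0 using W0 f yk by simp
  moreover have "v = 0" if v: "((\<lambda>s. G (0, y0 + s *\<^sub>R v)) has_vector_derivative 0) (at 0)" for v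
  proof (rule nondeg)
    have d: "((\<lambda>s. G (0, y0 + s *\<^sub>R v) $ e) has_real_derivative 0) (at 0)" for e
      using bounded_linear.has_vector_derivative[OF bounded_linear_vec_nth v, of e]
      by (simp add: has_real_derivative_iff_has_vector_derivative)
    have "((\<lambda>s. (y0 + s *\<^sub>R v) $ k - 1) has_real_derivative v $ k) (at 0)"
      by (auto intro!: derivative_eq_intros)
    with d[of p1] show "v $ k = 0" using DERIV_unique unfolding Gnth by fastforce
    fix r s assume rs: "r \<in> {r1, r2}" "s \<in> {s1, s2}"
    then have "\<exists>e\<in>{p2, p3, r1, r2}. \<forall>z. G z $ e = W z $ r $ s" by (auto simp: Gnth)
    then obtain e where "\<forall>z. G z $ e = W z $ r $ s" by blast
    then have Wd: "((\<lambda>x. h (y0 + x *\<^sub>R v) * f r s (y0 + x *\<^sub>R v)) has_real_derivative 0) (at 0)"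
      using d[of e] by (simp add: W0[OF rs])
    obtain D where D: "((\<lambda>x. f r s (y0 + x *\<^sub>R v)) has_real_derivative D) (at 0)"
      using has_real_derivative_along_line[OF poly(2)[OF rs]] by blast
    obtain E where E: "((\<lambda>x. h (y0 + x *\<^sub>R v)) has_real_derivative E) (at 0)"
      using has_real_derivative_along_line[OF poly(1)] by blast
    have "h y0 * D = 0"
      using DERIV_unique[OF DERIV_mult[OF E D] Wd] f[OF rs] by (simp add: mult.commute)
    then show "((\<lambda>x. f r s (y0 + x *\<^sub>R v)) has_real_derivative 0) (at 0)"
      using D h by simp
  qed
  ultimately obtain g \<epsilon> where g: "\<epsilon> > 0" "(g \<longlongrightarrow> y0) (at_right 0)"
    "\<forall>\<^sub>F t in at_right 0. G (t, g t) = 0"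
    "\<forall>\<^sub>F t in at_right 0. \<forall>y\<in>ball y0 \<epsilon>. G (t, y) = 0 \<longrightarrow> y = g t"
    using implicit_function_polynomial[OF polyG] by blast
  define N where "N = {z. S z $ p1 $ q1 \<noteq> 0 \<and> pivot p1 q1 (S z) $ p2 $ q2 \<noteq> 0
      \<and> pivot p2 q2 (pivot p1 q1 (S z)) $ p3 $ q3 \<noteq> 0}"
  have "open N"
  proof -
    have "open {z. u z \<noteq> 0}" if "real_polynomial_function u" for u :: "real \<times> (real^5) \<Rightarrow> real"
      using continuous_on_polymonial_function[of u] that
      by (intro open_Collect_neq) (auto simp: real_polynomial_function_eq)
    then show ?thesis unfolding N_def by (intro open_Collect_conj) (auto intro: polyS poly1 poly2)
  qed
  moreover have "(0, y0) \<in> N" using nz by (simp add: N_def S_def)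
  ultimately obtain A B where AB: "open A" "open B" "0 \<in> A" "y0 \<in> B" "A \<times> B \<subseteq> N"
    by (metis open_prod_elim mem_Sigma_iff)
  obtain \<delta> where \<delta>: "\<delta> > 0" "ball y0 \<delta> \<subseteq> B" using AB openE by blast
  have key: "rank (scaled_symbol c I t y) + 2 \<le> CARD(5) \<longleftrightarrow>
      (\<forall>r\<in>{r1, r2}. \<forall>s\<in>{s1, s2}. W (t, y) $ r $ s = 0)" if "t \<in> A" "y \<in> B" for t y
  proof -
    have "(t, y) \<in> N" using AB that by blast
    then show ?thesis
      unfolding N_def using rank_le_3_iff[OF rows cols, of "scaled_symbol c I t y"]
      by (simp add: W_def S_def)
  qed
  have evA: "\<forall>\<^sub>F t in at_right 0. t \<in> A"
    using AB by (intro topological_tendstoD[of "\<lambda>t. t"] tendsto_intros) auto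
  have evB: "\<forall>\<^sub>F t in at_right 0. g t \<in> B"
    using AB g(2) by (intro topological_tendstoD)
  have "\<forall>\<^sub>F t in at_right 0. g t $ k = 1 \<and> rank (scaled_symbol c I t (g t)) + 2 \<le> CARD(5)"
    using g(3) evA evB by eventually_elim (use key G0 in auto)
  moreover have "\<forall>\<^sub>F t in at_right 0. \<forall>y'\<in>ball y0 (min \<epsilon> \<delta>).
      y' $ k = 1 \<and> rank (scaled_symbol c I t y') + 2 \<le> CARD(5) \<longrightarrow> y' = g t"
    using g(4) evA
  proof eventually_elim
    case (elim t)
    show ?case
    proof (intro ballI impI)
      fix y' assume y': "y' \<in> ball y0 (min \<epsilon> \<delta>)"
        "y' $ k = 1 \<and> rank (scaled_symbol c I t y') + 2 \<le> CARD(5)"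
      then have "y' \<in> B" "y' \<in> ball y0 \<epsilon>" using \<delta> by auto
      with y' elim key G0 have "G (t, y') = 0" by simp
      then show "y' = g t" using elim \<open>y' \<in> ball y0 \<epsilon>\<close> by blast
    qed
  qed
  ultimately show ?thesis
    unfolding persists_def using g(1,2) \<delta>(1)
    by (intro exI[of _ g] exI[of _ "min \<epsilon> \<delta>"]) simp
qed

section \<open>Two small coordinates\<close>

lemma compl_5:
  assumes "distinct [i, j, p, q, k :: 5]"
  shows "- {i, j} = {p, q, k}" "- {i, j, p} = {q, k}" "- {i, j, p, q} = {k}"
  using assms distinct_UNIV_5[OF assms] by auto

lemma core_add: "core c I (x + y) = core c I x + core c I y"
  by (simp add: core_def vec_eq_iff algebra_simps sum.distrib)

lemma core_line: "core c I (y + x *\<^sub>R v) $ a $ b = core c I y $ a $ b + x * core c I v $ a $ b"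
  by (simp add: core_add core_scaleR)

lemma core_eq_0: "(\<And>a b. a \<in> I \<Longrightarrow> b \<in> I \<Longrightarrow> core c I y $ a $ b = 0) \<Longrightarrow> core c I y = 0"
  by (auto simp: vec_eq_iff core_def)

lemma real_polynomial_function_core: "real_polynomial_function (\<lambda>y. core c I y $ a $ b)"
proof -
  have "bounded_linear (\<lambda>y. core c I y $ a $ b)"
    by (intro linear_conv_bounded_linear[THEN iffD1] linearI) (simp_all add: core_add core_scaleR)
  then show ?thesis by (rule real_polynomial_function.intros(1))
qed

lemma two_forms_zero:
  fixes x y :: real
  assumes "a * x + b * y = 0" "a' * x + b' * y = 0" "a * b' \<noteq> a' * b"
  shows "x = 0 \<and> y = 0"
proof -
  have "(a * b' - a' * b) * x = b' * (a * x + b * y) - b * (a' * x + b' * y)"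
    "(a * b' - a' * b) * y = a * (a' * x + b' * y) - a' * (a * x + b * y)"
    by (simp_all add: algebra_simps)
  then have "(a * b' - a' * b) * x = 0" "(a * b' - a' * b) * y = 0"
    unfolding assms(1,2) by simp_all
  then show ?thesis using assms(3) by simp
qed

lemma core_pair:
  assumes d: "distinct [i, j, k, l, m :: 5]"
  shows "core c {i, j} y $ i $ j = c i k j * y $ k + c i l j * y $ l + c i m j * y $ m"
    "core c {i, j} y $ j $ i = c j k i * y $ k + c j l i * y $ l + c j m i * y $ m"
    "core c {i, j} y $ i $ i = y $ i + (c i k i * y $ k + c i l i * y $ l + c i m i * y $ m)"
    "core c {i, j} y $ j $ j = y $ j + (c j k j * y $ k + c j l j * y $ l + c j m j * y $ m)"
  using d by (auto simp: core_def compl_5[OF d])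

lemma core_pair_eq_0_iff:
  assumes d: "distinct [i, j, k, l, m :: 5]"
  shows "core c {i, j} y = 0 \<longleftrightarrow>
    c i k j * y $ k + c i l j * y $ l + c i m j * y $ m = 0 \<and>
    c j k i * y $ k + c j l i * y $ l + c j m i * y $ m = 0 \<and>
    y $ i + (c i k i * y $ k + c i l i * y $ l + c i m i * y $ m) = 0 \<and>
    y $ j + (c j k j * y $ k + c j l j * y $ l + c j m j * y $ m) = 0"
  (is "_ \<longleftrightarrow> ?R")
proof
  assume "core c {i, j} y = 0"
  then show ?R using core_pair[OF d, of c y] by simp
next
  assume ?R
  then show "core c {i, j} y = 0"
    by (intro core_eq_0) (auto simp: core_pair[OF d])
qed

text \<open>The three inequalities say that the off-diagonal entries of \<open>core c {i, j}\<close>, two linear forms in the coordinates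
  \<open>k\<close>, \<open>l\<close>, \<open>m\<close>, have nonzero \<open>2 \<times> 2\<close> minors.  The minors are the homogeneous coordinates of their common zero,
  which therefore lies on no coordinate line.\<close>

locale pair_case =
  fixes c :: "5 params" and i j k l m :: 5
  assumes d: "distinct [i, j, k, l, m]"
    and minors: "c i k j * c j l i \<noteq> c j k i * c i l j" "c i k j * c j m i \<noteq> c j k i * c i m j"
      "c i l j * c j m i \<noteq> c j l i * c i m j"
begin

lemma support:
  assumes "core c {i, j} \<zeta> = 0" "a \<notin> {i, j}" "\<zeta> $ a \<noteq> 0" "b \<notin> {i, j}"
  shows "\<zeta> $ b \<noteq> 0"
proof
  assume b: "\<zeta> $ b = 0"
  note z = assms(1)[unfolded core_pair_eq_0_iff[OF d]]
  have "b \<in> {k, l, m}" "a \<in> {k, l, m}" using assms distinct_UNIV_5[OF d] by blast+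
  consider "b = k" | "b = l" | "b = m" using \<open>b \<in> {k, l, m}\<close> by blast
  then have "\<zeta> $ k = 0 \<and> \<zeta> $ l = 0 \<and> \<zeta> $ m = 0"
  proof cases
    case 1
    then show ?thesis using z b two_forms_zero[OF _ _ minors(3), of "\<zeta> $ l" "\<zeta> $ m"] by simp
  next
    case 2
    then show ?thesis using z b two_forms_zero[OF _ _ minors(2), of "\<zeta> $ k" "\<zeta> $ m"] by simp
  next
    case 3
    then show ?thesis using z b two_forms_zero[OF _ _ minors(1), of "\<zeta> $ k" "\<zeta> $ l"] by simp
  qed
  with \<open>a \<in> {k, l, m}\<close> assms(3) show False by auto
qed

lemma unique_config: "\<exists>!y. y $ k = 1 \<and> core c {i, j} y = 0"
proof -
  define D where "D = c i l j * c j m i - c j l i * c i m j"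
  define L where "L = (c j k i * c i m j - c i k j * c j m i) / D"
  define M where "M = (c i k j * c j l i - c j k i * c i l j) / D"
  have D: "D \<noteq> 0" using minors by (simp add: D_def)
  define y :: "real^5" where "y = (\<chi> a. if a = k then 1 else if a = l then L else if a = m then M
    else - (c a k a + c a l a * L + c a m a * M))"
  have y: "y $ k = 1" "y $ l = L" "y $ m = M" "y $ i = - (c i k i + c i l i * L + c i m i * M)"
    "y $ j = - (c j k j + c j l j * L + c j m j * M)"
    using d by (auto simp: y_def)
  have "c i k j + c i l j * L + c i m j * M = 0" "c j k i + c j l i * L + c j m i * M = 0"
    using D by (simp_all add: L_def M_def field_simps) (simp_all add: D_def algebra_simps)
  then have "core c {i, j} y = 0"
    unfolding core_pair_eq_0_iff[OF d] y by simp
  moreover have "z = y" if z: "z $ k = 1" "core c {i, j} z = 0" for z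
  proof -
    define v where "v = z - y"
    have v: "core c {i, j} v = 0" "v $ k = 0"
      using z y \<open>core c {i, j} y = 0\<close> core_add[of c "{i, j}" v y] by (simp_all add: v_def)
    note v' = v(1)[unfolded core_pair_eq_0_iff[OF d]]
    have "v $ l = 0 \<and> v $ m = 0"
      using v' v(2) minors two_forms_zero[of "c i l j" "v $ l" "c i m j" "v $ m" "c j l i" "c j m i"] by auto
    with v' v(2) have "v $ a = 0" if "a \<in> {i, j, k, l, m}" for a using that by auto
    then have "v = 0" using distinct_UNIV_5[OF d] by (metis UNIV_I vec_eq_iff zero_index)
    then show ?thesis by (simp add: v_def)
  qed
  ultimately show ?thesis using y(1) by blast
qed

lemma config_persists:
  assumes y: "y $ k = 1" "core c {i, j} y = 0"
  shows "persists c {i, j} k y"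
proof -
  have nz: "y $ l \<noteq> 0" "y $ m \<noteq> 0" using support[OF y(2), of k] y d by auto
  show ?thesis
  proof (rule persists_by_pivots[where ?p1.0 = k and ?q1.0 = k and ?p2.0 = l and ?q2.0 = l and ?p3.0 = m and ?q3.0 = m
        and ?r1.0 = i and ?s1.0 = i and ?r2.0 = j and ?s2.0 = j and h = "\<lambda>y. y $ k ^ 4 * y $ l ^ 2 * y $ m"
        and f = "\<lambda>r s y. core c {i, j} y $ r $ s"])
    show "distinct [k, l, m, i, j]" "distinct [k, l, m, i, j]" using d by auto
    show "scaled_symbol c {i, j} 0 y $ k $ k \<noteq> 0"
      "pivot k k (scaled_symbol c {i, j} 0 y) $ l $ l \<noteq> 0"
      "pivot l l (pivot k k (scaled_symbol c {i, j} 0 y)) $ m $ m \<noteq> 0"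
      using d y nz by (auto simp: scaled_symbol_0 pivot_def)
    fix r s and z :: "real^5" assume rs: "r \<in> {i, j}" "s \<in> {i, j}"
    have "k \<notin> {i, j}" "l \<notin> {i, j}" "m \<notin> {i, j}" "k \<noteq> r" "l \<noteq> r" "m \<noteq> r" "k \<noteq> s" "l \<noteq> s" "m \<noteq> s"
      using rs d by auto
    with rs d show "pivot m m (pivot l l (pivot k k (scaled_symbol c {i, j} 0 z))) $ r $ s
        = z $ k ^ 4 * z $ l ^ 2 * z $ m * core c {i, j} z $ r $ s"
      by (simp add: scaled_symbol_0 pivot_def power_def eval_nat_numeral)
  next
    show "real_polynomial_function (\<lambda>y::real^5. y $ k ^ 4 * y $ l ^ 2 * y $ m)"
      by (intro real_polynomial_function.intros(4) real_polynomial_function_power real_polynomial_function_nth)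
  next
    fix v :: "real^5"
    assume v: "v $ k = 0" and der: "\<And>r s. r \<in> {i, j} \<Longrightarrow> s \<in> {i, j} \<Longrightarrow>
      ((\<lambda>x. core c {i, j} (y + x *\<^sub>R v) $ r $ s) has_real_derivative 0) (at 0)"
    have "core c {i, j} v = 0"
    proof (rule core_eq_0)
      fix r s assume rs: "r \<in> {i, j}" "s \<in> {i, j}"
      have "((\<lambda>x. core c {i, j} (y + x *\<^sub>R v) $ r $ s) has_real_derivative core c {i, j} v $ r $ s) (at 0)"
        unfolding core_line by (auto intro!: derivative_eq_intros)
      then show "core c {i, j} v $ r $ s = 0" using der[OF rs] DERIV_unique by blast
    qed
    then have "core c {i, j} (y + v) = 0" "(y + v) $ k = 1" using y v by (simp_all add: core_add)
    then have "y + v = y" using unique_config y by blast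
    then show "v = 0" by simp
  qed (use y nz real_polynomial_function_core in auto)
qed

end

section \<open>Real roots of quadratics and cubics\<close>

definition disc2 :: "real \<Rightarrow> real \<Rightarrow> real \<Rightarrow> real" where
  "disc2 a b c = b * b - 4 * (a * c)"

definition disc3 :: "real \<Rightarrow> real \<Rightarrow> real \<Rightarrow> real \<Rightarrow> real" where
  "disc3 a b c d = b * b * (c * c) - 4 * (a * (c * c * c)) - 4 * (b * b * b * d) - 27 * (a * a * (d * d))
    + 18 * (a * b * (c * d))"

lemma quadratic_simple_root:
  fixes a b c x :: real
  assumes "disc2 a b c \<noteq> 0" "a * x\<^sup>2 + b * x + c = 0"
  shows "2 * a * x + b \<noteq> 0"
proof -
  have "(2 * a * x + b)\<^sup>2 = 4 * a * (a * x\<^sup>2 + b * x + c) + disc2 a b c"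
    by (simp add: disc2_def power2_eq_square algebra_simps)
  then show ?thesis using assms by auto
qed

lemma card_quadratic_roots:
  fixes a b c :: real
  assumes "a \<noteq> 0" "disc2 a b c \<noteq> 0"
  shows "finite {x. a * x\<^sup>2 + b * x + c = 0}" "card {x. a * x\<^sup>2 + b * x + c = 0} \<in> {0, 2}"
proof -
  let ?D = "disc2 a b c" and ?R = "{x. a * x\<^sup>2 + b * x + c = 0}"
  have sq: "a * x\<^sup>2 + b * x + c = 0 \<longleftrightarrow> (2 * a * x + b)\<^sup>2 = ?D" for x
  proof -
    have "(2 * a * x + b)\<^sup>2 - ?D = 4 * a * (a * x\<^sup>2 + b * x + c)"
      by (simp add: disc2_def power2_eq_square algebra_simps)
    then show ?thesis using assms(1) by (metis eq_iff_diff_eq_0 mult_eq_0_iff zero_neq_numeral)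
  qed
  have "finite ?R \<and> card ?R \<in> {0, 2}"
  proof (cases "?D < 0")
    case True
    then have "(2 * a * x + b)\<^sup>2 \<noteq> ?D" for x by (metis not_less zero_le_power2)
    then have "?R = {}" using sq by blast
    then show ?thesis by simp
  next
    case False
    define w where "w = sqrt ?D"
    have w: "w > 0" "w\<^sup>2 = ?D" using False assms(2) by (auto simp: w_def)
    have "?R = {(- b + w) / (2 * a), (- b - w) / (2 * a)}"
      unfolding sq w(2)[symmetric] power2_eq_iff using assms(1) by (auto simp: field_simps)
    moreover have "(- b + w) / (2 * a) \<noteq> (- b - w) / (2 * a)"
      using w(1) assms(1) by (simp add: field_simps)
    ultimately show ?thesis by simp
  qed
  then show "finite ?R" "card ?R \<in> {0, 2}" by auto
qed

text \<open>If \<open>r\<close> is a root of a cubic, the discriminant is that of the cofactor of \<open>x - r\<close> times the square of the derivative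
  at \<open>r\<close>.\<close>

lemma disc3_at_root:
  fixes a b c d r :: real
  assumes "a * r ^ 3 + b * r\<^sup>2 + c * r + d = 0"
  shows "disc3 a b c d = disc2 a (b + a * r) (c + b * r + a * r\<^sup>2) * (3 * a * r\<^sup>2 + 2 * b * r + c)\<^sup>2"
proof -
  have d: "d = - (a * r ^ 3 + b * r\<^sup>2 + c * r)" using assms by simp
  show ?thesis
    unfolding d disc3_def disc2_def by (simp add: power2_eq_square power3_eq_cube algebra_simps)
qed

lemma cubic_has_root:
  fixes a b c d :: real
  assumes "a \<noteq> 0"
  shows "\<exists>r. a * r ^ 3 + b * r\<^sup>2 + c * r + d = 0"
proof -
  define f where "f x = x ^ 3 + (b / a) * x\<^sup>2 + (c / a) * x + d / a" for x
  \<comment> \<open>Outside \<open>[- R, R]\<close> the leading term dominates, so the cubic has opposite signs at the end points.\<close>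
  define R where "R = 1 + \<bar>b / a\<bar> + \<bar>c / a\<bar> + \<bar>d / a\<bar>"
  have R: "R \<ge> 1" by (simp add: R_def)
  have est: "\<bar>(b / a) * x\<^sup>2 + (c / a) * x + d / a\<bar> < R ^ 3" if x: "\<bar>x\<bar> = R" for x
  proof -
    have sq: "x\<^sup>2 = R\<^sup>2" using x power2_abs[of x] by simp
    have "1 * R \<le> R * R" using R by (intro mult_right_mono) auto
    with R have R2: "R \<le> R\<^sup>2" "1 \<le> R\<^sup>2" unfolding power2_eq_square by linarith+
    have "\<bar>(b / a) * x\<^sup>2 + (c / a) * x + d / a\<bar> \<le> \<bar>(b / a) * x\<^sup>2\<bar> + \<bar>(c / a) * x\<bar> + \<bar>d / a\<bar>" by linarith
    also have "\<dots> = \<bar>b / a\<bar> * R\<^sup>2 + \<bar>c / a\<bar> * R + \<bar>d / a\<bar> * 1"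
      using sq by (simp add: abs_mult x)
    also have "\<dots> \<le> \<bar>b / a\<bar> * R\<^sup>2 + \<bar>c / a\<bar> * R\<^sup>2 + \<bar>d / a\<bar> * R\<^sup>2"
      using R2 by (intro add_mono mult_left_mono) auto
    also have "\<dots> = (R - 1) * R\<^sup>2" by (simp add: R_def algebra_simps)
    also have "\<dots> < R * R\<^sup>2" using R2 by (intro mult_strict_right_mono) auto
    also have "\<dots> = R ^ 3" by (simp add: power2_eq_square power3_eq_cube)
    finally show ?thesis .
  qed
  have absR: "\<bar>R\<bar> = R" "\<bar>- R\<bar> = R" using R by auto
  have "0 \<le> v + u" "- v + u \<le> 0" if "\<bar>u\<bar> < v" for u v :: real using that by linarith+
  from this(1)[OF est[OF absR(1)]] this(2)[OF est[OF absR(2)]]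
  have "f R \<ge> 0" "f (- R) \<le> 0" by (simp_all add: f_def add.assoc)
  moreover have "continuous_on {- R..R} f" unfolding f_def by (intro continuous_intros)
  ultimately obtain r where "f r = 0" using IVT'[of f "- R" 0 R] R by auto
  then have "a * f r = 0" by simp
  then show ?thesis using assms by (intro exI[of _ r]) (simp add: f_def algebra_simps)
qed

lemma cubic_simple_root:
  fixes a b c d x :: real
  assumes "disc3 a b c d \<noteq> 0" "a * x ^ 3 + b * x\<^sup>2 + c * x + d = 0"
  shows "3 * a * x\<^sup>2 + 2 * b * x + c \<noteq> 0"
  using disc3_at_root[OF assms(2)] assms(1) by auto

lemma card_cubic_roots:
  fixes a b c d :: real
  assumes "a \<noteq> 0" "disc3 a b c d \<noteq> 0"
  shows "finite {x. a * x ^ 3 + b * x\<^sup>2 + c * x + d = 0}"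
    "card {x. a * x ^ 3 + b * x\<^sup>2 + c * x + d = 0} \<in> {1, 3}"
proof -
  obtain r where r: "a * r ^ 3 + b * r\<^sup>2 + c * r + d = 0"
    using cubic_has_root[OF assms(1)] by blast
  let ?Q = "{x. a * x\<^sup>2 + (b + a * r) * x + (c + b * r + a * r\<^sup>2) = 0}"
  have "disc2 a (b + a * r) (c + b * r + a * r\<^sup>2) \<noteq> 0"
    using disc3_at_root[OF r] assms(2) by auto
  note Q = card_quadratic_roots[OF assms(1) this]
  have "a * x ^ 3 + b * x\<^sup>2 + c * x + d = (x - r) * (a * x\<^sup>2 + (b + a * r) * x + (c + b * r + a * r\<^sup>2))
      + (a * r ^ 3 + b * r\<^sup>2 + c * r + d)" for x
    by (simp add: power2_eq_square power3_eq_cube algebra_simps)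
  then have set: "{x. a * x ^ 3 + b * x\<^sup>2 + c * x + d = 0} = insert r ?Q"
    using r by auto
  have "r \<notin> ?Q"
    using cubic_simple_root[OF assms(2) r] by (simp add: power2_eq_square algebra_simps)
  then show "finite {x. a * x ^ 3 + b * x\<^sup>2 + c * x + d = 0}"
    "card {x. a * x ^ 3 + b * x\<^sup>2 + c * x + d = 0} \<in> {1, 3}"
    unfolding set using Q by auto
qed

section \<open>Three small coordinates\<close>

text \<open>An off-diagonal entry of \<open>core c {i, j, p} y\<close>, when \<open>k\<close> and \<open>l\<close> are the two other indices.\<close>

definition entry_form :: "5 params \<Rightarrow> 5 \<Rightarrow> 5 \<Rightarrow> real^5 \<Rightarrow> 5 \<Rightarrow> 5 \<Rightarrow> real" where
  "entry_form c k l y a b = c a k b * y $ k + c a l b * y $ l"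

lemma core_triple:
  assumes d: "distinct [i, j, p, k, l :: 5]" and ab: "a \<in> {i, j, p}" "b \<in> {i, j, p}"
  shows "core c {i, j, p} y $ a $ b = (if a = b then y $ a else 0) + entry_form c k l y a b"
  using d ab by (auto simp: core_def compl_5[OF d] entry_form_def)

text \<open>With \<open>n\<^sub>a\<^sub>b\<close> the off-diagonal entries, the coefficients of the binary cubic
  \<open>n\<^sub>i\<^sub>j n\<^sub>j\<^sub>p n\<^sub>p\<^sub>i - n\<^sub>j\<^sub>i n\<^sub>p\<^sub>j n\<^sub>i\<^sub>p\<close> are sums of the following expressions, in which \<open>x\<close>, \<open>y\<close>, \<open>z\<close> record the variable
  taken from each factor.\<close>

definition cycle_form :: "5 params \<Rightarrow> 5 \<Rightarrow> 5 \<Rightarrow> 5 \<Rightarrow> 5 \<Rightarrow> 5 \<Rightarrow> 5 \<Rightarrow> real" where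
  "cycle_form c i j p x y z = c i x j * c j y p * c p z i - c j x i * c p y j * c i z p"

definition cubic_coeff1 where "cubic_coeff1 c i j p k l = cycle_form c i j p l k k + cycle_form c i j p k l k + cycle_form c i j p k k l"
definition cubic_coeff2 where "cubic_coeff2 c i j p k l = cycle_form c i j p k l l + cycle_form c i j p l k l + cycle_form c i j p l l k"

text \<open>A matrix of rank one with nonzero off-diagonal entries is determined by these entries, which only have to
  satisfy the cubic relation.  By \<open>opposite\<close>, \<open>row\<close> and \<open>col\<close>, an off-diagonal entry never vanishes together with
  another one in its row or column or opposite to it; this excludes zeros among them.  The two cycle conditions
  keep the zeros of the cubic away from the coordinate points.\<close>

locale triple_case =
  fixes c :: "5 params" and i j p k l :: 5
  assumes d: "distinct [i, j, p, k, l]"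
    and opposite: "\<And>a b. a \<in> {i, j, p} \<Longrightarrow> b \<in> {i, j, p} \<Longrightarrow> a \<noteq> b \<Longrightarrow> c a k b * c b l a \<noteq> c b k a * c a l b"
    and row: "\<And>a b e. a \<in> {i, j, p} \<Longrightarrow> b \<in> {i, j, p} \<Longrightarrow> e \<in> {i, j, p} \<Longrightarrow> distinct [a, b, e] \<Longrightarrow>
      c a k b * c a l e \<noteq> c a k e * c a l b"
    and col: "\<And>a b e. a \<in> {i, j, p} \<Longrightarrow> b \<in> {i, j, p} \<Longrightarrow> e \<in> {i, j, p} \<Longrightarrow> distinct [a, b, e] \<Longrightarrow>
      c a k b * c e l b \<noteq> c e k b * c a l b"
    and cyc_k: "cycle_form c i j p k k k \<noteq> 0" and cyc_l: "cycle_form c i j p l l l \<noteq> 0"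
    and disc: "disc3 (cycle_form c i j p l l l) (cubic_coeff2 c i j p k l) (cubic_coeff1 c i j p k l) (cycle_form c i j p k k k) \<noteq> 0"
begin

abbreviation "n \<equiv> entry_form c k l"

abbreviation "f s \<equiv> cycle_form c i j p l l l * s ^ 3 + cubic_coeff2 c i j p k l * s\<^sup>2 + cubic_coeff1 c i j p k l * s + cycle_form c i j p k k k"

lemma cubic_eq:
  assumes "y $ k = 1"
  shows "n y i j * n y j p * n y p i - n y j i * n y p j * n y i p = f (y $ l)"
  using assms by (simp add: entry_form_def cycle_form_def cubic_coeff1_def cubic_coeff2_def power2_eq_square power3_eq_cube algebra_simps)

lemma row_nonzero:
  assumes "a \<in> {i, j, p}" "b \<in> {i, j, p}" "e \<in> {i, j, p}" "distinct [a, b, e]" "y $ k \<noteq> 0 \<or> y $ l \<noteq> 0"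
  shows "n y a b \<noteq> 0 \<or> n y a e \<noteq> 0" "n y a b \<noteq> 0 \<or> n y e b \<noteq> 0" "n y a b \<noteq> 0 \<or> n y b a \<noteq> 0"
proof -
  have ab: "a \<noteq> b" using assms(4) by simp
  show "n y a b \<noteq> 0 \<or> n y a e \<noteq> 0"
    using two_forms_zero[OF _ _ row[OF assms(1-4)], of "y $ k" "y $ l"] assms(5)
    unfolding entry_form_def by blast
  show "n y a b \<noteq> 0 \<or> n y e b \<noteq> 0"
    using two_forms_zero[OF _ _ col[OF assms(1-4)], of "y $ k" "y $ l"] assms(5)
    unfolding entry_form_def by blast
  show "n y a b \<noteq> 0 \<or> n y b a \<noteq> 0"
    using two_forms_zero[OF _ _ opposite[OF assms(1,2) ab], of "y $ k" "y $ l"] assms(5)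
    unfolding entry_form_def by blast
qed

lemma rank_1_relations:
  assumes r: "rank (core c {i, j, p} y) \<le> 1" and a: "a \<in> {i, j, p}" "b \<in> {i, j, p}" "e \<in> {i, j, p}" "distinct [a, b, e]"
  shows "n y a b * n y b e = (y $ b + n y b b) * n y a e"
    "n y a b * n y e a = n y e b * (y $ a + n y a a)"
    "n y a b * n y b a = (y $ b + n y b b) * (y $ a + n y a a)"
    "n y a b * (y $ e + n y e e) = n y e b * n y a e"
proof -
  have P: "core c {i, j, p} y $ r $ s * core c {i, j, p} y $ u $ v
      = core c {i, j, p} y $ u $ s * core c {i, j, p} y $ r $ v" for r s u v
    using pivot_eq_0_of_rank_le_1[OF r, of r s] by (simp add: pivot_def vec_eq_iff)
  have ne: "a \<noteq> b" "b \<noteq> a" "a \<noteq> e" "e \<noteq> a" "b \<noteq> e" "e \<noteq> b" using a(4) by auto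
  show "n y a b * n y b e = (y $ b + n y b b) * n y a e"
    "n y a b * n y e a = n y e b * (y $ a + n y a a)"
    "n y a b * n y b a = (y $ b + n y b b) * (y $ a + n y a a)"
    "n y a b * (y $ e + n y e e) = n y e b * n y a e"
    using P[of a b b e] P[of a b e a] P[of a b b a] P[of a b e e] a(1-3) ne
    by (simp_all add: core_triple[OF d] del: insert_iff)
qed

lemma rank_1_nonzero:
  assumes r: "rank (core c {i, j, p} y) \<le> 1" and y: "y $ k \<noteq> 0 \<or> y $ l \<noteq> 0"
    and a: "a \<in> {i, j, p}" "b \<in> {i, j, p}" "a \<noteq> b"
  shows "n y a b \<noteq> 0"
proof
  assume 0: "n y a b = 0"
  obtain e where e: "e \<in> {i, j, p}" "distinct [a, b, e]"
    using a d by (auto simp: eq_commute)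
  show False
    using rank_1_relations(4)[OF r a(1,2) e] row_nonzero[OF a(1,2) e y] 0 by auto
qed

text \<open>Multiplying two of the relations and substituting a third eliminates the diagonal.\<close>

lemma rank_1_cubic:
  assumes r: "rank (core c {i, j, p} y) \<le> 1" and y: "y $ k \<noteq> 0 \<or> y $ l \<noteq> 0"
  shows "n y i j * n y j p * n y p i = n y j i * n y p j * n y i p"
proof -
  have "distinct [i, j, p]" using d by auto
  note R = rank_1_relations[OF r _ _ _ this]
  have "n y i j * (n y i j * n y j p * n y p i) = (n y i j * n y j p) * (n y i j * n y p i)" by simp
  also have "\<dots> = ((y $ j + n y j j) * (y $ i + n y i i)) * n y p j * n y i p"
    using R(1,2) by simp
  also have "\<dots> = n y i j * (n y j i * n y p j * n y i p)" using R(3) by simp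
  finally show ?thesis using rank_1_nonzero[OF r y, of i j] d by simp
qed

lemma support:
  assumes r: "rank (core c {i, j, p} y) \<le> 1" and y: "y $ a \<noteq> 0" "a \<notin> {i, j, p}" and b: "b \<notin> {i, j, p}"
  shows "y $ b \<noteq> 0"
proof -
  have "a = k \<or> a = l" "b = k \<or> b = l" using y(2) b distinct_UNIV_5[OF d] by blast+
  moreover have kl: "y $ k \<noteq> 0 \<or> y $ l \<noteq> 0" using calculation y by auto
  moreover have "y $ k \<noteq> 0" if "y $ l \<noteq> 0"
    using rank_1_cubic[OF r kl] cyc_l that by (auto simp: entry_form_def cycle_form_def)
  moreover have "y $ l \<noteq> 0" if "y $ k \<noteq> 0"
    using rank_1_cubic[OF r kl] cyc_k that by (auto simp: entry_form_def cycle_form_def)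
  ultimately show ?thesis by auto
qed

lemma root_nonzero:
  assumes y: "y $ k = 1" and f: "f (y $ l) = 0" and a: "a \<in> {i, j, p}" "b \<in> {i, j, p}" "a \<noteq> b"
  shows "n y a b \<noteq> 0"
proof -
  have eq: "n y i j * n y j p * n y p i = n y j i * n y p j * n y i p"
    using cubic_eq[OF y] f by simp
  have y': "y $ k \<noteq> 0 \<or> y $ l \<noteq> 0" using y by simp
  obtain e where e: "e \<in> {i, j, p}" "distinct [a, b, e]"
    using a d by (auto simp: eq_commute)
  then have "n y a b * n y b e * n y e a = n y b a * n y e b * n y a e"
    using eq a by (auto simp: mult_ac)
  then show ?thesis
    using row_nonzero[OF a(1,2) e y'] by auto
qed

end

lemma pivots_triple:
  assumes d: "distinct [i, j, p, k, l :: 5]" and ab: "a \<in> {i, j, p}" "b \<in> {i, j, p}"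
  shows "pivot l l (pivot k k (scaled_symbol c {i, j, p} 0 y)) $ a $ b
    = y $ k ^ 2 * y $ l * core c {i, j, p} y $ a $ b"
proof -
  have "k \<notin> {i, j, p}" "l \<notin> {i, j, p}" "k \<noteq> a" "l \<noteq> a" "k \<noteq> b" "l \<noteq> b" "k \<noteq> l"
    using ab d by auto
  with ab show ?thesis by (simp add: scaled_symbol_0 pivot_def power2_eq_square)
qed

context triple_case
begin

lemma rank_1I:
  assumes ij: "core c {i, j, p} y $ i $ j \<noteq> 0"
    and R: "\<And>a b. a \<in> {j, p} \<Longrightarrow> b \<in> {i, p} \<Longrightarrow> core c {i, j, p} y $ i $ j * core c {i, j, p} y $ a $ b
      = core c {i, j, p} y $ a $ j * core c {i, j, p} y $ i $ b"
  shows "rank (core c {i, j, p} y) \<le> 1"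
proof -
  let ?M = "core c {i, j, p} y"
  have out: "?M $ a $ b = 0" if "a \<notin> {i, j, p} \<or> b \<notin> {i, j, p}" for a b
    using that by (auto simp: core_def)
  have "pivot i j ?M $ a $ b = 0" for a b
  proof -
    consider "a \<notin> {i, j, p} \<or> b \<notin> {i, j, p}" | "a = i \<or> b = j" | "a \<in> {j, p}" "b \<in> {i, p}" by blast
    then show ?thesis
    proof cases
      case 1
      then show ?thesis using out[of a] out[of _ b] by (auto simp: pivot_def)
    next
      case 2
      then show ?thesis by (auto simp: pivot_def)
    next
      case 3
      from R[OF 3] show ?thesis by (simp add: pivot_def)
    qed
  qed
  then have "pivot i j ?M = 0" by (simp add: vec_eq_iff)
  then show ?thesis using rank_pivot[of ?M i j, OF ij] by simp
qed

text \<open>The three diagonal entries are read off from vanishing \<open>2 \<times> 2\<close> minors that contain just one of them.\<close>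

lemma root_config:
  assumes f: "f s = 0"
  shows "\<exists>!y. y $ k = 1 \<and> y $ l = s \<and> rank (core c {i, j, p} y) \<le> 1"
proof -
  define z :: "real^5" where "z = (\<chi> a. if a = k then 1 else s)"
  have z: "z $ k = 1" "z $ l = s" using d by (auto simp: z_def)
  have n_eq: "n y a b = n z a b" if "y $ k = 1" "y $ l = s" for y a b
    using that z by (simp add: entry_form_def)
  define y :: "real^5" where "y = (\<chi> a. if a = i then n z i j * n z p i / n z p j - n z i i
    else if a = j then n z i j * n z j p / n z i p - n z j j
    else if a = p then n z p j * n z i p / n z i j - n z p p else z $ a)"
  have y: "y $ i = n z i j * n z p i / n z p j - n z i i" "y $ j = n z i j * n z j p / n z i p - n z j j"
    "y $ p = n z p j * n z i p / n z i j - n z p p" "y $ k = 1" "y $ l = s"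
    using d z by (auto simp: y_def)
  have nz: "n z a b \<noteq> 0" if "a \<in> {i, j, p}" "b \<in> {i, j, p}" "a \<noteq> b" for a b
    using root_nonzero[OF z(1), unfolded z(2), OF f that] .
  have ne: "i \<noteq> j" "j \<noteq> i" "i \<noteq> p" "p \<noteq> i" "j \<noteq> p" "p \<noteq> j" using d by auto
  have cub: "n z i j * n z j p * n z p i = n z j i * n z p j * n z i p"
    using cubic_eq[OF z(1)] f z(2) by simp
  have "rank (core c {i, j, p} y) \<le> 1"
  proof (rule rank_1I)
    show "core c {i, j, p} y $ i $ j \<noteq> 0"
      using nz[of i j] ne by (simp add: core_triple[OF d] n_eq[OF y(4,5)])
    fix a b assume ab: "a \<in> {j, p}" "b \<in> {i, p}"
    have "n z i j * n z j i = (n z i j * n z j p / n z i p) * (n z i j * n z p i / n z p j)"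
      using cub nz[of i p] nz[of p j] ne by (simp add: field_simps)
    then show "core c {i, j, p} y $ i $ j * core c {i, j, p} y $ a $ b
      = core c {i, j, p} y $ a $ j * core c {i, j, p} y $ i $ b"
      using ab ne nz by (auto simp: core_triple[OF d] n_eq[OF y(4,5)] y(1-3))
  qed
  moreover have "w = y" if w: "w $ k = 1" "w $ l = s" "rank (core c {i, j, p} w) \<le> 1" for w
  proof -
    have ds: "distinct [i, j, p]" using ne by simp
    note R = rank_1_relations[OF w(3) _ _ _ ds, unfolded n_eq[OF w(1,2)], simplified]
    have "w $ i = y $ i" "w $ j = y $ j" "w $ p = y $ p"
      using R nz ne by (simp_all add: y(1-3) field_simps)
    then have "w $ a = y $ a" if "a \<in> {i, j, p, k, l}" for a using that y w by auto
    then show ?thesis using distinct_UNIV_5[OF d] by (metis UNIV_I vec_eq_iff)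
  qed
  ultimately show ?thesis using y(4,5) by blast
qed

lemma configs:
  "bij_betw (\<lambda>y. y $ l) {y. y $ k = 1 \<and> rank (core c {i, j, p} y) \<le> 1} {s. f s = 0}"
proof (rule bij_betw_imageI)
  have "f (y $ l) = 0" if "y $ k = 1" "rank (core c {i, j, p} y) \<le> 1" for y
    using rank_1_cubic[OF that(2)] cubic_eq[OF that(1)] that(1) by simp
  note root = this
  show "inj_on (\<lambda>y. y $ l) {y. y $ k = 1 \<and> rank (core c {i, j, p} y) \<le> 1}"
    by (rule inj_onI) (use root root_config in blast)
  show "(\<lambda>y. y $ l) ` {y. y $ k = 1 \<and> rank (core c {i, j, p} y) \<le> 1} = {s. f s = 0}"
  proof (intro equalityI subsetI)
    fix s assume "s \<in> {s. f s = 0}"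
    then obtain y where "y $ k = 1" "y $ l = s" "rank (core c {i, j, p} y) \<le> 1"
      using root_config by blast
    then show "s \<in> (\<lambda>y. y $ l) ` {y. y $ k = 1 \<and> rank (core c {i, j, p} y) \<le> 1}" by blast
  qed (use root in auto)
qed

lemma card_configs:
  "finite {y. y $ k = 1 \<and> rank (core c {i, j, p} y) \<le> 1}"
  "card {y. y $ k = 1 \<and> rank (core c {i, j, p} y) \<le> 1} \<in> {1, 3}"
  using card_cubic_roots[OF cyc_l disc] bij_betw_same_card[OF configs] bij_betw_finite[OF configs] by auto

lemma config_persists:
  assumes y: "y $ k = 1" "rank (core c {i, j, p} y) \<le> 1"
  shows "persists c {i, j, p} k y"
proof -
  let ?M = "core c {i, j, p}"
  have ne: "i \<noteq> j" "j \<noteq> i" "i \<noteq> p" "p \<noteq> i" "j \<noteq> p" "p \<noteq> j" "k \<noteq> l" "l \<noteq> k" using d by auto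
  have yl: "y $ l \<noteq> 0" using support[OF y(2), of k l] y(1) d by auto
  have y': "y $ k \<noteq> 0 \<or> y $ l \<noteq> 0" using y(1) by simp
  have nz: "n y a b \<noteq> 0" if "a \<in> {i, j, p}" "b \<in> {i, j, p}" "a \<noteq> b" for a b
    using rank_1_nonzero[OF y(2) y' that] .
  have core_entry: "?M z $ a $ b = n z a b" if "a \<in> {i, j, p}" "b \<in> {i, j, p}" "a \<noteq> b" for a b z
    using core_triple[OF d that(1,2)] that(3) by simp
  have froot: "f (y $ l) = 0"
    using configs y unfolding bij_betw_def by blast
  define F where "F r s z = ?M z $ i $ j * ?M z $ r $ s - ?M z $ r $ j * ?M z $ i $ s" for r s z
  have Piv: "pivot i j (?M y) = 0" by (rule pivot_eq_0_of_rank_le_1[OF y(2)])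
  have F0: "F r s y = 0" for r s
    using Piv by (simp add: F_def pivot_def vec_eq_iff)
  show ?thesis
  proof (rule persists_by_pivots[where ?p1.0 = k and ?q1.0 = k and ?p2.0 = l and ?q2.0 = l and ?p3.0 = i and ?q3.0 = j
        and ?r1.0 = j and ?s1.0 = i and ?r2.0 = p and ?s2.0 = p and h = "\<lambda>y. (y $ k ^ 2 * y $ l) ^ 2" and f = F])
    show "distinct [k, l, i, j, p]" "distinct [k, l, j, i, p]" using d by auto
    show "scaled_symbol c {i, j, p} 0 y $ k $ k \<noteq> 0"
      "pivot k k (scaled_symbol c {i, j, p} 0 y) $ l $ l \<noteq> 0"
      using d y yl by (auto simp: scaled_symbol_0 pivot_def)
    show "pivot l l (pivot k k (scaled_symbol c {i, j, p} 0 y)) $ i $ j \<noteq> 0"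
      using y yl nz[of i j] ne by (simp add: pivots_triple[OF d] core_entry)
    fix r s and z :: "real^5" assume rs: "r \<in> {j, p}" "s \<in> {i, p}"
    then have rs': "r \<in> {i, j, p}" "s \<in> {i, j, p}" by auto
    show "pivot i j (pivot l l (pivot k k (scaled_symbol c {i, j, p} 0 z))) $ r $ s
        = ((z $ k)\<^sup>2 * z $ l)\<^sup>2 * F r s z"
      unfolding pivot_def[of i j] F_def using rs'
      by (simp add: pivots_triple[OF d] power2_eq_square algebra_simps del: insert_iff)
        (simp add: pivots_triple[OF d] power2_eq_square algebra_simps)
  next
    show "real_polynomial_function (\<lambda>y::real^5. ((y $ k)\<^sup>2 * y $ l)\<^sup>2)"
      by (intro real_polynomial_function.intros(4) real_polynomial_function_power real_polynomial_function_nth)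
    show "real_polynomial_function (F r s)" for r s
      unfolding F_def[abs_def]
      by (intro real_polynomial_function_diff real_polynomial_function.intros(4) real_polynomial_function_core)
  next
    fix v :: "real^5"
    assume v: "v $ k = 0" and der: "\<And>r s. r \<in> {j, p} \<Longrightarrow> s \<in> {i, p} \<Longrightarrow>
      ((\<lambda>x. F r s (y + x *\<^sub>R v)) has_real_derivative 0) (at 0)"
    have dF: "?M y $ i $ j * ?M v $ r $ s + ?M v $ i $ j * ?M y $ r $ s
        = ?M y $ r $ j * ?M v $ i $ s + ?M v $ r $ j * ?M y $ i $ s" if "r \<in> {j, p}" "s \<in> {i, p}" for r s
    proof -
      have "((\<lambda>x. F r s (y + x *\<^sub>R v)) has_real_derivative
        (?M y $ i $ j * ?M v $ r $ s + ?M v $ i $ j * ?M y $ r $ s)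
        - (?M y $ r $ j * ?M v $ i $ s + ?M v $ r $ j * ?M y $ i $ s)) (at 0)"
        unfolding F_def core_line by (auto intro!: derivative_eq_intros)
      from DERIV_unique[OF this der[OF that]] show ?thesis by simp
    qed
    have G: "((\<lambda>x. n (y + x *\<^sub>R v) a b) has_real_derivative n v a b) (at 0)" for a b
      unfolding entry_form_def by (auto intro!: derivative_eq_intros)
    let ?A = "\<lambda>x. n (y + x *\<^sub>R v) i p * n (y + x *\<^sub>R v) p j"
      and ?B = "\<lambda>x. n (y + x *\<^sub>R v) i j * n (y + x *\<^sub>R v) p i"
      and ?C = "\<lambda>x. n (y + x *\<^sub>R v) i j * n (y + x *\<^sub>R v) j p"
    obtain A B C where ABC: "(?A has_real_derivative A) (at 0)" "(?B has_real_derivative B) (at 0)"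
      "(?C has_real_derivative C) (at 0)"
      using DERIV_mult[OF G G] by blast
    \<comment> \<open>Eliminating the diagonal from three of the equations produces \<open>n\<^sub>i\<^sub>j\<close> times the cubic, so its derivative along \<open>v\<close>
      vanishes, too; as its roots are simple, \<open>v\<close> vanishes at \<open>l\<close>, and then the equations are linear in the diagonal.\<close>
    have "((\<lambda>x. - (F j i (y + x *\<^sub>R v) * ?A x - F j p (y + x *\<^sub>R v) * ?B x - F p i (y + x *\<^sub>R v) * ?C x
        + F j p (y + x *\<^sub>R v) * F p i (y + x *\<^sub>R v))) has_real_derivative 0) (at 0)"
      by (rule derivative_eq_intros der ABC refl | simp add: F0)+
    moreover have "- (F j i z * (n z i p * n z p j) - F j p z * (n z i j * n z p i) - F p i z * (n z i j * n z j p)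
        + F j p z * F p i z) = n z i j * (n z i j * n z j p * n z p i - n z j i * n z p j * n z i p)" for z
      unfolding F_def using ne by (simp add: core_entry algebra_simps)
    moreover have "(y + x *\<^sub>R v) $ k = 1" for x using y v by simp
    ultimately have "((\<lambda>x. n (y + x *\<^sub>R v) i j * f (y $ l + x * v $ l)) has_real_derivative 0) (at 0)"
      using cubic_eq by simp
    moreover have "((\<lambda>x. n (y + x *\<^sub>R v) i j * f (y $ l + x * v $ l)) has_real_derivative
        n y i j * ((3 * cycle_form c i j p l l l * (y $ l)\<^sup>2 + 2 * cubic_coeff2 c i j p k l * y $ l + cubic_coeff1 c i j p k l) * v $ l)) (at 0)"
      by (rule derivative_eq_intros G refl | simp)+ (use froot in \<open>simp add: algebra_simps power2_eq_square\<close>)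
    ultimately have "n y i j * ((3 * cycle_form c i j p l l l * (y $ l)\<^sup>2 + 2 * cubic_coeff2 c i j p k l * y $ l + cubic_coeff1 c i j p k l) * v $ l) = 0"
      using DERIV_unique by blast
    then have vl: "v $ l = 0"
      using nz[of i j] cubic_simple_root[OF disc froot] ne by auto
    have nv: "n v a b = 0" for a b using v vl by (simp add: entry_form_def)
    have "v $ a = ?M v $ a $ a" if "a \<in> {i, j, p}" for a using core_triple[OF d that that] nv by simp
    moreover have "?M v $ j $ j = 0" using dF[of j p] nz[of i p] ne by (simp add: core_entry nv)
    moreover have "?M v $ i $ i = 0" using dF[of p i] nz[of p j] ne by (simp add: core_entry nv)
    moreover have "?M v $ p $ p = 0" using dF[of p p] nz[of i j] ne by (simp add: core_entry nv)
    ultimately have "v $ a = 0" if "a \<in> {i, j, p, k, l}" for a using that v vl by auto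
    then show "v = 0" using distinct_UNIV_5[OF d] by (metis UNIV_I vec_eq_iff zero_index)
  qed (use y yl F0 in auto)
qed

end

section \<open>Four small coordinates\<close>

text \<open>Cancelling the product \<open>x y\<close> leaves a linear relation, and substituting \<open>y\<close> from it leaves a quadratic equation
  for \<open>x\<close>.\<close>

lemma bilinear_system:
  fixes A1 B1 C1 D1 A2 B2 C2 D2 x y :: real
  defines "a0 \<equiv> D2 * A1 - D1 * A2" and "a \<equiv> D2 * B1 - D1 * B2" and "b \<equiv> D2 * C1 - D1 * C2"
  assumes nz: "b \<noteq> 0" "D1 \<noteq> 0"
  shows "A1 + B1 * x + C1 * y - D1 * (x * y) = 0 \<and> A2 + B2 * x + C2 * y - D2 * (x * y) = 0 \<longleftrightarrow>
    y = - (a0 + a * x) / b \<and>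
    D1 * a * x\<^sup>2 + (B1 * b - C1 * a + D1 * a0) * x + (A1 * b - C1 * a0) = 0" (is "?E1 = 0 \<and> ?E2 = 0 \<longleftrightarrow> _ \<and> ?Q = 0")
proof -
  have comb: "D2 * ?E1 - D1 * ?E2 = a0 + a * x + b * y"
    by (simp add: a0_def a_def b_def algebra_simps)
  have y: "y = - (a0 + a * x) / b \<longleftrightarrow> a0 + a * x + b * y = 0"
    using nz(1) by (auto simp: field_simps)
  have Q: "?Q = b * ?E1 - (C1 - D1 * x) * (a0 + a * x + b * y)"
    by (simp add: algebra_simps power2_eq_square)
  show ?thesis
    unfolding y using comb Q nz by auto
qed

text \<open>The linearized system reduces in the same way to \<open>\<xi>\<close> times the derivative of the quadratic.\<close>

lemma bilinear_system_nondegenerate: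
  fixes A1 B1 C1 D1 A2 B2 C2 D2 x y \<xi> \<eta> :: real
  defines "a0 \<equiv> D2 * A1 - D1 * A2" and "a \<equiv> D2 * B1 - D1 * B2" and "b \<equiv> D2 * C1 - D1 * C2"
  assumes nz: "b \<noteq> 0" "D1 \<noteq> 0" "disc2 (D1 * a) (B1 * b - C1 * a + D1 * a0) (A1 * b - C1 * a0) \<noteq> 0"
    and sol: "A1 + B1 * x + C1 * y - D1 * (x * y) = 0" "A2 + B2 * x + C2 * y - D2 * (x * y) = 0"
    and der: "B1 * \<xi> + C1 * \<eta> - D1 * (\<xi> * y + x * \<eta>) = 0" "B2 * \<xi> + C2 * \<eta> - D2 * (\<xi> * y + x * \<eta>) = 0"
  shows "\<xi> = 0 \<and> \<eta> = 0"
proof -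
  have "a * \<xi> + b * \<eta> = D2 * (B1 * \<xi> + C1 * \<eta> - D1 * (\<xi> * y + x * \<eta>))
      - D1 * (B2 * \<xi> + C2 * \<eta> - D2 * (\<xi> * y + x * \<eta>))"
    by (simp add: a_def b_def algebra_simps)
  then have \<eta>: "a * \<xi> + b * \<eta> = 0" unfolding der by simp
  have "a0 + a * x + b * y = D2 * (A1 + B1 * x + C1 * y - D1 * (x * y)) - D1 * (A2 + B2 * x + C2 * y - D2 * (x * y))"
    by (simp add: a0_def a_def b_def algebra_simps)
  then have y: "a0 + a * x + b * y = 0" unfolding sol by simp
  have "(2 * (D1 * a) * x + (B1 * b - C1 * a + D1 * a0)) * \<xi>
      = b * (B1 * \<xi> + C1 * \<eta> - D1 * (\<xi> * y + x * \<eta>)) - (C1 - D1 * x) * (a * \<xi> + b * \<eta>)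
        + D1 * \<xi> * (a0 + a * x + b * y)"
    by (simp add: algebra_simps)
  then have "(2 * (D1 * a) * x + (B1 * b - C1 * a + D1 * a0)) * \<xi> = 0" unfolding der \<eta> y by simp
  moreover have "(D1 * a) * x\<^sup>2 + (B1 * b - C1 * a + D1 * a0) * x + (A1 * b - C1 * a0) = 0"
    using bilinear_system[of D2 C1 D1 C2 A1 B1 x y A2 B2] nz sol unfolding a0_def a_def b_def by blast
  ultimately have "\<xi> = 0" using quadratic_simple_root[OF nz(3)] by auto
  then show ?thesis using \<eta> nz(1) by simp
qed

lemma core_quadruple:
  assumes d: "distinct [i, j, p, q, k :: 5]" and ab: "a \<in> {i, j, p, q}" "b \<in> {i, j, p, q}"
  shows "core c {i, j, p, q} y $ a $ b = (if a = b then y $ a else 0) + c a k b * y $ k"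
  using d ab by (auto simp: core_def compl_5[OF d])

lemma pivots_quadruple:
  assumes d: "distinct [i, j, p, q, k :: 5]" and ab: "a \<in> {i, j, p, q}" "b \<in> {i, j, p, q}"
  shows "pivot k k (scaled_symbol c {i, j, p, q} 0 y) $ a $ b = y $ k * core c {i, j, p, q} y $ a $ b"
proof -
  have "k \<notin> {i, j, p, q}" "k \<noteq> a" "k \<noteq> b" using ab d by auto
  with ab show ?thesis by (simp add: scaled_symbol_0 pivot_def)
qed

text \<open>The constant term of the first bilinear equation.  The quadratic coefficients below are those of
  \<open>bilinear_system\<close>, with the determinants \<open>a\<close> and \<open>b\<close> recognized as values of \<open>cycle_form\<close>.\<close>

definition bilinear_const where
  "bilinear_const c i j p q k = c j k i * (c i k j * c p k q - c p k j * c i k q) - c i k j * (c p k i * c j k q)"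

definition quadratic_coeff0 where
  "quadratic_coeff0 c i j p q k = bilinear_const c i j p q k * cycle_form c q p i k k k
    - c p k i * c i k q * (c q k p * bilinear_const c i j p q k - c p k q * bilinear_const c i j q p k)"

definition quadratic_coeff1 where
  "quadratic_coeff1 c i j p q k = c p k j * c j k q * cycle_form c q p i k k k - c p k i * c i k q * cycle_form c q p j k k k
    + c p k q * (c q k p * bilinear_const c i j p q k - c p k q * bilinear_const c i j q p k)"

definition quadratic_coeff2 where
  "quadratic_coeff2 c i j p q k = c p k q * cycle_form c q p j k k k"

text \<open>With \<open>y\<^sub>k = 1\<close> the off-diagonal entries of \<open>core\<close> are the constants \<open>c a k b\<close>.  The upper left \<open>2 \<times> 2\<close> block, with
  unknown diagonal, is eliminated through its off-diagonal entries \<open>(i, j)\<close> and \<open>(j, i)\<close>; the conditions \<open>blocks\<close>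
  and \<open>cycles\<close> ensure that this block is invertible, both on matrices of rank two and at the roots of the
  resulting system.\<close>

locale quadruple_case =
  fixes c :: "5 params" and i j p q k :: 5
  assumes d: "distinct [i, j, p, q, k]"
    and entries: "c i k j \<noteq> 0" "c p k q \<noteq> 0"
    and blocks: "c i k p * c j k q \<noteq> c i k q * c j k p" "c p k i * c q k j \<noteq> c p k j * c q k i"
    and cycles: "cycle_form c i j p k k k \<noteq> 0" "cycle_form c i j q k k k \<noteq> 0" "cycle_form c q p i k k k \<noteq> 0" "cycle_form c q p j k k k \<noteq> 0"
    and disc: "disc2 (quadratic_coeff2 c i j p q k) (quadratic_coeff1 c i j p q k) (quadratic_coeff0 c i j p q k) \<noteq> 0"
begin

abbreviation "M \<equiv> core c {i, j, p, q}"
abbreviation "P y \<equiv> pivot i j (M y)"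

text \<open>The entries after the second pivot.  For \<open>r \<noteq> s\<close> they involve only the diagonal entries at \<open>i\<close> and \<open>j\<close>, and
  are bilinear in them; for \<open>r = s\<close> they determine the diagonal entry at \<open>r\<close>.\<close>

definition F :: "5 \<Rightarrow> 5 \<Rightarrow> real^5 \<Rightarrow> real" where
  "F r s y = P y $ j $ i * P y $ r $ s - P y $ r $ i * P y $ j $ s"

abbreviation "e1 x y \<equiv> bilinear_const c i j p q k + (c p k j * c j k q) * x + (c p k i * c i k q) * y - c p k q * (x * y)"
abbreviation "e2 x y \<equiv> bilinear_const c i j q p k + (c q k j * c j k p) * x + (c q k i * c i k p) * y - c q k p * (x * y)"
abbreviation "quad x \<equiv> quadratic_coeff2 c i j p q k * x\<^sup>2 + quadratic_coeff1 c i j p q k * x + quadratic_coeff0 c i j p q k"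

lemma ne: "i \<noteq> j" "j \<noteq> i" "i \<noteq> p" "p \<noteq> i" "i \<noteq> q" "q \<noteq> i" "j \<noteq> p" "p \<noteq> j" "j \<noteq> q" "q \<noteq> j" "p \<noteq> q" "q \<noteq> p"
    "k \<noteq> i" "i \<noteq> k" "k \<noteq> j" "j \<noteq> k" "k \<noteq> p" "p \<noteq> k" "k \<noteq> q" "q \<noteq> k"
  using d by auto

lemma core_entry:
  assumes "y $ k = 1" "a \<in> {i, j, p, q}" "b \<in> {i, j, p, q}"
  shows "M y $ a $ b = (if a = b then y $ a + c a k a else c a k b)"
  using core_quadruple[OF d assms(2,3)] assms(1) by auto

lemma P_entries:
  assumes "y $ k = 1"
  shows "P y $ j $ i = c i k j * c j k i - (y $ j + c j k j) * (y $ i + c i k i)"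
    "P y $ p $ i = c i k j * c p k i - c p k j * (y $ i + c i k i)"
    "P y $ q $ i = c i k j * c q k i - c q k j * (y $ i + c i k i)"
    "P y $ j $ p = c i k j * c j k p - (y $ j + c j k j) * c i k p"
    "P y $ j $ q = c i k j * c j k q - (y $ j + c j k j) * c i k q"
    "P y $ p $ q = c i k j * c p k q - c p k j * c i k q"
    "P y $ q $ p = c i k j * c q k p - c q k j * c i k p"
    "P y $ p $ p = c i k j * (y $ p + c p k p) - c p k j * c i k p"
    "P y $ q $ q = c i k j * (y $ q + c q k q) - c q k j * c i k q"
  using ne by (simp_all add: pivot_def core_entry[OF assms])

lemma F_off:
  assumes "y $ k = 1"
  shows "F p q y = c i k j * e1 (y $ i + c i k i) (y $ j + c j k j)"
    "F q p y = c i k j * e2 (y $ i + c i k i) (y $ j + c j k j)"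
proof -
  define x z where "x = y $ i + c i k i" and "z = y $ j + c j k j"
  show "F p q y = c i k j * e1 (y $ i + c i k i) (y $ j + c j k j)"
    "F q p y = c i k j * e2 (y $ i + c i k i) (y $ j + c j k j)"
    unfolding F_def P_entries[OF assms] x_def[symmetric] z_def[symmetric] bilinear_const_def
    by (simp_all add: algebra_simps)
qed

lemma system_iff:
  "e1 x y = 0 \<and> e2 x y = 0 \<longleftrightarrow>
    y = - ((c q k p * bilinear_const c i j p q k - c p k q * bilinear_const c i j q p k) + cycle_form c q p j k k k * x) / cycle_form c q p i k k k
    \<and> quad x = 0"
  and system_nondegenerate:
  "e1 x y = 0 \<Longrightarrow> e2 x y = 0 \<Longrightarrow>
    (c p k j * c j k q) * \<xi> + (c p k i * c i k q) * \<eta> - c p k q * (\<xi> * y + x * \<eta>) = 0 \<Longrightarrow>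
    (c q k j * c j k p) * \<xi> + (c q k i * c i k p) * \<eta> - c q k p * (\<xi> * y + x * \<eta>) = 0 \<Longrightarrow> \<xi> = 0 \<and> \<eta> = 0"
proof -
  have cycle_form: "cycle_form c q p j k k k = c q k p * (c p k j * c j k q) - c p k q * (c q k j * c j k p)"
    "cycle_form c q p i k k k = c q k p * (c p k i * c i k q) - c p k q * (c q k i * c i k p)"
    by (simp_all add: cycle_form_def)
  show "e1 x y = 0 \<and> e2 x y = 0 \<longleftrightarrow>
    y = - ((c q k p * bilinear_const c i j p q k - c p k q * bilinear_const c i j q p k) + cycle_form c q p j k k k * x) / cycle_form c q p i k k k
    \<and> quad x = 0"
    unfolding quadratic_coeff0_def quadratic_coeff1_def quadratic_coeff2_def
    using bilinear_system[of "c q k p" "c p k i * c i k q" "c p k q" "c q k i * c i k p"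
        "bilinear_const c i j p q k" "c p k j * c j k q" x y "bilinear_const c i j q p k" "c q k j * c j k p", folded cycle_form]
      cycles entries by blast
  assume "e1 x y = 0" "e2 x y = 0"
    "(c p k j * c j k q) * \<xi> + (c p k i * c i k q) * \<eta> - c p k q * (\<xi> * y + x * \<eta>) = 0"
    "(c q k j * c j k p) * \<xi> + (c q k i * c i k p) * \<eta> - c q k p * (\<xi> * y + x * \<eta>) = 0"
  with bilinear_system_nondegenerate[of "c q k p" "c p k i * c i k q" "c p k q" "c q k i * c i k p"
        "c p k j * c j k q" "c q k j * c j k p" "bilinear_const c i j p q k" "bilinear_const c i j q p k" x y \<xi> \<eta>, folded cycle_form]
  show "\<xi> = 0 \<and> \<eta> = 0"
    using cycles entries disc unfolding quadratic_coeff0_def quadratic_coeff1_def quadratic_coeff2_def by blast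
qed

lemma P_columns:
  assumes y: "y $ k = 1"
  shows "P y $ p $ i \<noteq> 0 \<or> P y $ q $ i \<noteq> 0" "P y $ j $ p \<noteq> 0 \<or> P y $ j $ q \<noteq> 0"
proof -
  have "c q k j * P y $ p $ i - c p k j * P y $ q $ i = c i k j * (c p k i * c q k j - c p k j * c q k i)"
    "c i k q * P y $ j $ p - c i k p * P y $ j $ q = c i k j * (c i k q * c j k p - c i k p * c j k q)"
    unfolding P_entries[OF y] by (simp_all add: algebra_simps)
  then show "P y $ p $ i \<noteq> 0 \<or> P y $ q $ i \<noteq> 0" "P y $ j $ p \<noteq> 0 \<or> P y $ j $ q \<noteq> 0"
    using entries blocks by auto
qed

text \<open>If the block were singular, the two equations would say that two products vanish.  By \<open>P_columns\<close> the vanishing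
  factors then belong to the same index \<open>r\<close>, one in column \<open>i\<close> and one in row \<open>j\<close>, and together with the singularity
  of the block they give the cycle relation on \<open>{i, j, r}\<close>.\<close>

lemma P_nonzero_of_system:
  assumes y: "y $ k = 1" and F: "F p q y = 0" "F q p y = 0"
  shows "P y $ j $ i \<noteq> 0"
proof
  assume 0: "P y $ j $ i = 0"
  have prod: "P y $ p $ i = 0 \<or> P y $ j $ q = 0" "P y $ q $ i = 0 \<or> P y $ j $ p = 0"
    using F 0 by (auto simp: F_def)
  define x z where "x = y $ i + c i k i" and "z = y $ j + c j k j"
  have xz: "c i k j * c j k i = z * x" using 0 unfolding P_entries[OF y] x_def z_def by simp
  have *: "c i k j * cycle_form c i j r k k k = 0"
    if "c i k j * c r k i = c r k j * x" "c i k j * c j k r = z * c i k r" for r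
  proof -
    have "c i k j * (c i k j * (c i k j * (c j k r * c r k i))) = c i k j * ((c i k j * c j k r) * (c i k j * c r k i))"
      by simp
    also have "\<dots> = c i k j * ((z * x) * (c r k j * c i k r))" unfolding that by simp
    also have "\<dots> = c i k j * (c i k j * (c j k i * c r k j * c i k r))" unfolding xz[symmetric] by simp
    finally show ?thesis using entries by (simp add: cycle_form_def)
  qed
  have "\<not> (P y $ p $ i = 0 \<and> P y $ j $ p = 0)" "\<not> (P y $ q $ i = 0 \<and> P y $ j $ q = 0)"
    using *[of p] *[of q] cycles entries unfolding P_entries[OF y] x_def z_def by auto
  then show False using prod P_columns[OF y] by blast
qed

lemma rank_2D:
  assumes y: "y $ k = 1" and r: "rank (M y) \<le> 2"
  shows "F a b y = 0" "P y $ j $ i \<noteq> 0"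
proof -
  have "M y $ i $ j \<noteq> 0" using entries ne by (simp add: core_entry[OF y])
  from rank_pivot[OF this] r have r1: "rank (P y) \<le> 1" by simp
  have F: "F a b y = 0" for a b
    using pivot_eq_0_of_rank_le_1[OF r1, of j i] by (simp add: pivot_def[of j i] F_def vec_eq_iff)
  show "F a b y = 0" "P y $ j $ i \<noteq> 0" using F P_nonzero_of_system[OF y] by blast+
qed

lemma rank_2I:
  assumes y: "y $ k = 1" and F: "\<And>a b. a \<in> {p, q} \<Longrightarrow> b \<in> {p, q} \<Longrightarrow> F a b y = 0"
  shows "rank (M y) \<le> 2"
proof -
  have ij: "M y $ i $ j \<noteq> 0" using entries ne by (simp add: core_entry[OF y])
  have ji: "P y $ j $ i \<noteq> 0" using P_nonzero_of_system[OF y] F by blast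
  have out: "P y $ a $ b = 0" if "a \<notin> {j, p, q} \<or> b \<notin> {i, p, q}" for a b
    using that by (auto simp: pivot_def core_def)
  have "pivot j i (P y) $ a $ b = 0" for a b
  proof -
    consider "a \<notin> {j, p, q} \<or> b \<notin> {i, p, q}" | "a = j \<or> b = i" | "a \<in> {p, q}" "b \<in> {p, q}" by blast
    then show ?thesis
    proof cases
      case 1
      then show ?thesis using out[of a] out[of _ b] by (auto simp: pivot_def[of j i])
    next
      case 2
      then show ?thesis by (auto simp: pivot_def[of j i])
    next
      case 3
      from F[OF 3] show ?thesis by (simp add: pivot_def[of j i] F_def)
    qed
  qed
  then have "pivot j i (P y) = 0" by (simp add: vec_eq_iff)
  then show ?thesis using rank_pivot[OF ij] rank_pivot[OF ji] by simp
qed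

lemma root_config:
  assumes x: "quad x = 0"
  shows "\<exists>!y. y $ k = 1 \<and> y $ i + c i k i = x \<and> rank (M y) \<le> 2"
proof -
  define z where "z = - ((c q k p * bilinear_const c i j p q k - c p k q * bilinear_const c i j q p k) + cycle_form c q p j k k k * x) / cycle_form c q p i k k k"
  have sys: "e1 x z = 0" "e2 x z = 0" using system_iff[of x z] x z_def by blast+
  define D where "D = c i k j * c j k i - z * x"
  define xp where "xp = (c p k j * c i k p + (c i k j * c p k i - c p k j * x) * (c i k j * c j k p - z * c i k p) / D) / c i k j"
  define xq where "xq = (c q k j * c i k q + (c i k j * c q k i - c q k j * x) * (c i k j * c j k q - z * c i k q) / D) / c i k j"
  define y :: "real^5" where "y = (\<chi> a. if a = i then x - c i k i else if a = j then z - c j k j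
    else if a = p then xp - c p k p else if a = q then xq - c q k q else 1)"
  have y: "y $ k = 1" "y $ i + c i k i = x" "y $ j + c j k j = z" "y $ p + c p k p = xp" "y $ q + c q k q = xq"
    using ne by (auto simp: y_def)
  have off: "F p q y = 0" "F q p y = 0" unfolding F_off[OF y(1)] y sys by simp_all
  have "P y $ j $ i = D" unfolding P_entries[OF y(1)] y D_def by simp
  then have D: "D \<noteq> 0" using P_nonzero_of_system[OF y(1) off] by simp
  have diag: "F p p y = 0" "F q q y = 0"
    unfolding F_def P_entries[OF y(1)] y D_def[symmetric] using D entries by (simp_all add: xp_def xq_def)
  have "rank (M y) \<le> 2"
    by (rule rank_2I[OF y(1)]) (use off diag in auto)
  moreover have "w = y" if w: "w $ k = 1" "w $ i + c i k i = x" "rank (M w) \<le> 2" for w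
  proof -
    note Fw = rank_2D(1)[OF w(1,3)] and Dw = rank_2D(2)[OF w(1,3)]
    have "e1 x (w $ j + c j k j) = 0 \<and> e2 x (w $ j + c j k j) = 0"
      using Fw[of p q] Fw[of q p] entries unfolding F_off[OF w(1)] w(2) by simp
    then have wj: "w $ j + c j k j = z" unfolding system_iff z_def by blast
    have D': "P w $ j $ i = D" unfolding P_entries[OF w(1)] w(2) wj D_def by simp
    have "D * (c i k j * (w $ p + c p k p) - c p k j * c i k p)
        = (c i k j * c p k i - c p k j * x) * (c i k j * c j k p - z * c i k p)"
      "D * (c i k j * (w $ q + c q k q) - c q k j * c i k q)
        = (c i k j * c q k i - c q k j * x) * (c i k j * c j k q - z * c i k q)"
      using Fw[of p p] Fw[of q q] unfolding F_def D' unfolding P_entries[OF w(1)] w(2) wj by simp_all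
    then have "w $ p + c p k p = xp" "w $ q + c q k q = xq"
      using D entries by (simp_all add: xp_def xq_def field_simps)
    then have "w $ i = y $ i" "w $ j = y $ j" "w $ p = y $ p" "w $ q = y $ q" "w $ k = y $ k"
      using y w wj by simp_all
    then have "w $ a = y $ a" if "a \<in> {i, j, p, q, k}" for a using that by auto
    then show ?thesis using distinct_UNIV_5[OF d] by (metis UNIV_I vec_eq_iff)
  qed
  ultimately show ?thesis using y(1,2) by blast
qed

lemma config_root:
  assumes "y $ k = 1" "rank (M y) \<le> 2"
  shows "quad (y $ i + c i k i) = 0"
    "e1 (y $ i + c i k i) (y $ j + c j k j) = 0" "e2 (y $ i + c i k i) (y $ j + c j k j) = 0"
proof -
  have "e1 (y $ i + c i k i) (y $ j + c j k j) = 0 \<and> e2 (y $ i + c i k i) (y $ j + c j k j) = 0"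
    using rank_2D(1)[OF assms, of p q] rank_2D(1)[OF assms, of q p] entries unfolding F_off[OF assms(1)] by simp
  then show "quad (y $ i + c i k i) = 0"
    "e1 (y $ i + c i k i) (y $ j + c j k j) = 0" "e2 (y $ i + c i k i) (y $ j + c j k j) = 0"
    using system_iff by blast+
qed

lemma configs:
  "bij_betw (\<lambda>y. y $ i + c i k i) {y. y $ k = 1 \<and> rank (M y) \<le> 2} {x. quad x = 0}"
proof (rule bij_betw_imageI)
  show "inj_on (\<lambda>y. y $ i + c i k i) {y. y $ k = 1 \<and> rank (M y) \<le> 2}"
  proof (rule inj_onI)
    fix y z assume "y \<in> {y. y $ k = 1 \<and> rank (M y) \<le> 2}" "z \<in> {y. y $ k = 1 \<and> rank (M y) \<le> 2}"
      "y $ i + c i k i = z $ i + c i k i"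
    then show "y = z" using root_config[OF config_root(1)[of y]] by auto
  qed
  show "(\<lambda>y. y $ i + c i k i) ` {y. y $ k = 1 \<and> rank (M y) \<le> 2} = {x. quad x = 0}"
  proof (intro equalityI subsetI)
    fix x assume "x \<in> {x. quad x = 0}"
    then obtain y where "y $ k = 1" "y $ i + c i k i = x" "rank (M y) \<le> 2"
      using root_config by blast
    then show "x \<in> (\<lambda>y. y $ i + c i k i) ` {y. y $ k = 1 \<and> rank (M y) \<le> 2}" by blast
  qed (use config_root in auto)
qed

lemma card_configs:
  "finite {y. y $ k = 1 \<and> rank (M y) \<le> 2}"
  "card {y. y $ k = 1 \<and> rank (M y) \<le> 2} \<in> {0, 2}"
proof -
  have "quadratic_coeff2 c i j p q k \<noteq> 0" using entries cycles by (simp add: quadratic_coeff2_def)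
  note card_quadratic_roots[OF this disc]
  then show "finite {y. y $ k = 1 \<and> rank (M y) \<le> 2}" "card {y. y $ k = 1 \<and> rank (M y) \<le> 2} \<in> {0, 2}"
    using bij_betw_same_card[OF configs] bij_betw_finite[OF configs] by auto
qed

lemma config_persists:
  assumes y: "y $ k = 1" "rank (M y) \<le> 2"
  shows "persists c {i, j, p, q} k y"
proof -
  have ij: "M y $ i $ j \<noteq> 0" using entries ne by (simp add: core_entry[OF y(1)])
  have sub: "pivot i j (pivot k k (scaled_symbol c {i, j, p, q} 0 z)) $ a $ b = (z $ k)\<^sup>2 * P z $ a $ b"
    if "a \<in> {i, j, p, q}" "b \<in> {i, j, p, q}" for a b z
    unfolding pivot_def[of i j] using that
    by (simp add: pivots_quadruple[OF d] power2_eq_square algebra_simps del: insert_iff)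
      (simp add: pivots_quadruple[OF d] power2_eq_square algebra_simps)
  show ?thesis
  proof (rule persists_by_pivots[where ?p1.0 = k and ?q1.0 = k and ?p2.0 = i and ?q2.0 = j and ?p3.0 = j and ?q3.0 = i
        and ?r1.0 = p and ?s1.0 = p and ?r2.0 = q and ?s2.0 = q and h = "\<lambda>y. y $ k ^ 4" and f = F])
    show "distinct [k, i, j, p, q]" "distinct [k, j, i, p, q]" using d by auto
    show "scaled_symbol c {i, j, p, q} 0 y $ k $ k \<noteq> 0"
      using ne y by (auto simp: scaled_symbol_0)
    show "pivot k k (scaled_symbol c {i, j, p, q} 0 y) $ i $ j \<noteq> 0"
      using ij y by (simp add: pivots_quadruple[OF d])
    show "pivot i j (pivot k k (scaled_symbol c {i, j, p, q} 0 y)) $ j $ i \<noteq> 0"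
      using rank_2D(2)[OF y] y(1) by (simp add: sub)
    fix r s and z :: "real^5" assume rs: "r \<in> {p, q}" "s \<in> {p, q}"
    then have rs': "r \<in> {i, j, p, q}" "s \<in> {i, j, p, q}" by auto
    have ji: "j \<in> {i, j, p, q}" "i \<in> {i, j, p, q}" by auto
    show "pivot j i (pivot i j (pivot k k (scaled_symbol c {i, j, p, q} 0 z))) $ r $ s = z $ k ^ 4 * F r s z"
      unfolding pivot_def[of j i] F_def
      by (simp add: sub[OF rs'] sub[OF ji] sub[OF rs'(1) ji(2)] sub[OF ji(1) rs'(2)]
          power2_eq_square power4_eq_xxxx algebra_simps)
  next
    show "real_polynomial_function (\<lambda>y::real^5. (y $ k) ^ 4)"
      by (intro real_polynomial_function_power real_polynomial_function_nth)
    show "real_polynomial_function (F r s)" for r s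
      unfolding F_def[abs_def]
      by (intro real_polynomial_function_diff real_polynomial_function.intros(4)
          real_polynomial_function_pivot real_polynomial_function_core)
  next
    fix v :: "real^5"
    assume v: "v $ k = 0" and der: "\<And>r s. r \<in> {p, q} \<Longrightarrow> s \<in> {p, q} \<Longrightarrow>
      ((\<lambda>x. F r s (y + x *\<^sub>R v)) has_real_derivative 0) (at 0)"
    define X Z where "X = y $ i + c i k i" and "Z = y $ j + c j k j"
    have one: "(y + x *\<^sub>R v) $ k = 1" for x using y v by simp
    have XZ: "(y + x *\<^sub>R v) $ i + c i k i = X + x * v $ i" "(y + x *\<^sub>R v) $ j + c j k j = Z + x * v $ j" for x
      by (simp_all add: X_def Z_def)
    have "((\<lambda>x. F p q (y + x *\<^sub>R v)) has_real_derivative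
        c i k j * ((c p k j * c j k q) * v $ i + (c p k i * c i k q) * v $ j - c p k q * (v $ i * Z + X * v $ j))) (at 0)"
      unfolding F_off[OF one] XZ by (rule derivative_eq_intros refl | simp)+
    from DERIV_unique[OF this der] entries
    have 1: "(c p k j * c j k q) * v $ i + (c p k i * c i k q) * v $ j - c p k q * (v $ i * Z + X * v $ j) = 0"
      by simp
    have "((\<lambda>x. F q p (y + x *\<^sub>R v)) has_real_derivative
        c i k j * ((c q k j * c j k p) * v $ i + (c q k i * c i k p) * v $ j - c q k p * (v $ i * Z + X * v $ j))) (at 0)"
      unfolding F_off[OF one] XZ by (rule derivative_eq_intros refl | simp)+
    from DERIV_unique[OF this der] entries
    have 2: "(c q k j * c j k p) * v $ i + (c q k i * c i k p) * v $ j - c q k p * (v $ i * Z + X * v $ j) = 0"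
      by simp
    have vij: "v $ i = 0" "v $ j = 0"
      using system_nondegenerate[OF config_root(2,3)[OF y], folded X_def Z_def, OF 1 2] by auto
    have "v $ r = 0" if r: "r \<in> {p, q}" for r
    proof -
      have Pr: "P (y + x *\<^sub>R v) $ r $ r = P y $ r $ r + x * (c i k j * v $ r)" for x
        using r by (auto simp: P_entries(8,9)[OF one] P_entries(8,9)[OF y(1)] algebra_simps)
      have "F r r (y + x *\<^sub>R v) = F r r y + x * (P y $ j $ i * c i k j * v $ r)" for x
        unfolding F_def Pr using r vij
        by (auto simp: P_entries[OF one] P_entries[OF y(1)] algebra_simps)
      then have "((\<lambda>x. F r r (y + x *\<^sub>R v)) has_real_derivative P y $ j $ i * c i k j * v $ r) (at 0)"
        by (auto intro!: derivative_eq_intros)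
      from DERIV_unique[OF this der[OF r r]] show ?thesis using rank_2D(2)[OF y] entries by simp
    qed
    then have "v $ a = 0" if "a \<in> {i, j, p, q, k}" for a using that v vij by auto
    then show "v = 0" using distinct_UNIV_5[OF d] by (metis UNIV_I vec_eq_iff zero_index)
  qed (use y rank_2D(1)[OF y] in auto)
qed

end

section \<open>The generic condition\<close>

lemma homogeneous_mult:
  assumes "homogeneous_polynomial d f" "homogeneous_polynomial e g" "m = d + e"
  shows "homogeneous_polynomial m (\<lambda>c. f c * g c)"
  using homogeneous_polynomial.mult[OF assms(1,2)] assms(3) by simp

lemma homogeneous_cmult:
  assumes "homogeneous_polynomial d f"
  shows "homogeneous_polynomial d (\<lambda>c. r * f c)"
  by (rule homogeneous_mult[OF homogeneous_polynomial.const assms]) simp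

lemma homogeneous_diff:
  assumes "homogeneous_polynomial d f" "homogeneous_polynomial d g"
  shows "homogeneous_polynomial d (\<lambda>c. f c - g c)"
  using homogeneous_polynomial.add[OF assms(1) homogeneous_cmult[OF assms(2), of "- 1"]] by simp

lemma homogeneous_disc2:
  assumes "homogeneous_polynomial m f" "homogeneous_polynomial n g" "homogeneous_polynomial (2 * n - m) h" "m \<le> 2 * n"
  shows "homogeneous_polynomial (2 * n) (\<lambda>c. disc2 (f c) (g c) (h c))"
  unfolding disc2_def
  by (intro homogeneous_diff homogeneous_cmult homogeneous_mult[OF assms(2,2)] homogeneous_mult[OF assms(1,3)])
    (use assms(4) in auto)

lemma homogeneous_disc3:
  assumes "homogeneous_polynomial n a" "homogeneous_polynomial n b" "homogeneous_polynomial n f" "homogeneous_polynomial n d"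
  shows "homogeneous_polynomial (4 * n) (\<lambda>c. disc3 (a c) (b c) (f c) (d c))"
proof -
  note m = homogeneous_polynomial.mult
  have "homogeneous_polynomial (4 * n) (\<lambda>c. b c * b c * (f c * f c))"
    by (rule homogeneous_mult[OF m[OF assms(2,2)] m[OF assms(3,3)]]) simp
  moreover have "homogeneous_polynomial (4 * n) (\<lambda>c. 4 * (a c * (f c * f c * f c)))"
    by (rule homogeneous_cmult, rule homogeneous_mult[OF assms(1) m[OF m[OF assms(3,3)] assms(3)]]) simp
  moreover have "homogeneous_polynomial (4 * n) (\<lambda>c. 4 * (b c * b c * b c * d c))"
    by (rule homogeneous_cmult, rule homogeneous_mult[OF m[OF m[OF assms(2,2)] assms(2)] assms(4)]) simp
  moreover have "homogeneous_polynomial (4 * n) (\<lambda>c. 27 * (a c * a c * (d c * d c)))"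
    by (rule homogeneous_cmult, rule homogeneous_mult[OF m[OF assms(1,1)] m[OF assms(4,4)]]) simp
  moreover have "homogeneous_polynomial (4 * n) (\<lambda>c. 18 * (a c * b c * (f c * d c)))"
    by (rule homogeneous_cmult, rule homogeneous_mult[OF m[OF assms(1,2)] m[OF assms(3,4)]]) simp
  ultimately show ?thesis
    unfolding disc3_def by (intro homogeneous_polynomial.add homogeneous_diff)
qed

definition row_minor where "row_minor i j p q k c = c i k j * c i q p - c i k p * c i q j"
definition col_minor where "col_minor i j p q k c = c i k j * c p q j - c p k j * c i q j"
definition block_minor where "block_minor i j p q k c = c i k p * c j k q - c i k q * c j k p"
definition cubic_disc where "cubic_disc i j p q k c =
  disc3 (cycle_form c i j p q q q) (cubic_coeff2 c i j p k q) (cubic_coeff1 c i j p k q) (cycle_form c i j p k k k)"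
definition quadratic_disc where "quadratic_disc i j p q k c =
  disc2 (quadratic_coeff2 c i j p q k) (quadratic_coeff1 c i j p q k) (quadratic_coeff0 c i j p q k)"

text \<open>Letting the five indices range over all orderings covers every choice of \<open>I\<close> and of the roles of the indices
  in the elimination.\<close>

definition generic_polynomials :: "5 \<Rightarrow> 5 \<Rightarrow> 5 \<Rightarrow> 5 \<Rightarrow> 5 \<Rightarrow> (5 params \<Rightarrow> real) set" where
  "generic_polynomials i j p q k = {(\<lambda>c. c i k j), row_minor i j p q k, col_minor i j p q k, block_minor i j p q k,
    (\<lambda>c. cycle_form c i j p k k k), cubic_disc i j p q k, quadratic_disc i j p q k}"

definition generic_set :: "(5 params \<Rightarrow> real) set" where
  "generic_set = (\<Union>(i, j, p, q, k)\<in>{(i, j, p, q, k). distinct [i, j, p, q, k]}. generic_polynomials i j p q k)"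

text \<open>Sparse parameters: an entry of \<open>S\<close> names a row \<open>a\<close> and an unordered pair of indices, so that the symmetry
  of a parameter collection is built in.\<close>

definition indicator_params :: "('n \<times> 'n set) set \<Rightarrow> 'n params" where
  "indicator_params S = (\<lambda>a x y. if (a, {x, y}) \<in> S then 1 else 0)"

lemma parameter_collection_indicator: "parameter_collection (indicator_params S)"
  by (simp add: parameter_collection_def indicator_params_def insert_commute)

lemma homogeneous_cycle_form:
  assumes "distinct [i, j, p, k]" "distinct [i, j, p, l]" "distinct [i, j, p, m]"
  shows "homogeneous_polynomial 3 (\<lambda>c. cycle_form c i j p k l m)"
  unfolding cycle_form_def
  by (intro homogeneous_diff homogeneous_mult[OF homogeneous_mult, OF homogeneous_polynomial.entry
      homogeneous_polynomial.entry _ homogeneous_polynomial.entry]) (use assms in auto)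

lemma homogeneous_entry_product:
  assumes "x \<noteq> y" "x' \<noteq> y'"
  shows "homogeneous_polynomial 2 (\<lambda>c. c a x y * c b x' y')"
  by (rule homogeneous_mult[OF homogeneous_polynomial.entry homogeneous_polynomial.entry]) (use assms in auto)

lemma generic_polynomials_homogeneous:
  assumes d: "distinct [i, j, p, q, k]" and f: "f \<in> generic_polynomials i j p q k"
  shows "\<exists>d. homogeneous_polynomial d f"
proof -
  have ne: "i \<noteq> j" "j \<noteq> i" "i \<noteq> p" "p \<noteq> i" "i \<noteq> q" "q \<noteq> i" "j \<noteq> p" "p \<noteq> j" "j \<noteq> q" "q \<noteq> j" "p \<noteq> q" "q \<noteq> p"
    "k \<noteq> i" "i \<noteq> k" "k \<noteq> j" "j \<noteq> k" "k \<noteq> p" "p \<noteq> k" "k \<noteq> q" "q \<noteq> k"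
    using d by auto
  note e2 = homogeneous_entry_product and e1 = homogeneous_polynomial.entry
  have bilinear_const: "homogeneous_polynomial 3 (\<lambda>c. bilinear_const c a b r s k)"
    if "a \<noteq> k" "b \<noteq> k" "r \<noteq> k" "s \<noteq> k" for a b r s :: 5
    unfolding bilinear_const_def using that
    by (intro homogeneous_diff homogeneous_mult[OF e1 homogeneous_diff[OF e2 e2]] homogeneous_mult[OF e1 e2]) auto
  have cycle_form: "homogeneous_polynomial 3 (\<lambda>c. cycle_form c a b r k k k)" if "distinct [a, b, r, k]" for a b r :: 5
    by (rule homogeneous_cycle_form) (use that in auto)
  have a0: "homogeneous_polynomial 4 (\<lambda>c. c q k p * bilinear_const c i j p q k - c p k q * bilinear_const c i j q p k)"
    using ne by (intro homogeneous_diff homogeneous_mult[OF e1 bilinear_const]) auto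
  have q0: "homogeneous_polynomial 6 (\<lambda>c. quadratic_coeff0 c i j p q k)"
    unfolding quadratic_coeff0_def using ne
    by (intro homogeneous_diff homogeneous_mult[OF bilinear_const cycle_form] homogeneous_mult[OF e2 a0]) auto
  have q1: "homogeneous_polynomial 5 (\<lambda>c. quadratic_coeff1 c i j p q k)"
    unfolding quadratic_coeff1_def using ne
    by (intro homogeneous_diff homogeneous_polynomial.add homogeneous_mult[OF e2 cycle_form] homogeneous_mult[OF e1 a0]) auto
  have q2: "homogeneous_polynomial 4 (\<lambda>c. quadratic_coeff2 c i j p q k)"
    unfolding quadratic_coeff2_def using ne by (intro homogeneous_mult[OF e1 cycle_form]) auto
  have quad: "homogeneous_polynomial 10 (\<lambda>c. quadratic_disc i j p q k c)"
    unfolding quadratic_disc_def using homogeneous_disc2[OF q2 q1] q0 by simp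
  have cubic: "homogeneous_polynomial 12 (\<lambda>c. cubic_disc i j p q k c)"
    unfolding cubic_disc_def cubic_coeff1_def cubic_coeff2_def
    using ne
    by (auto intro!: homogeneous_disc3[of 3, simplified] homogeneous_polynomial.add homogeneous_cycle_form)
  have minors: "homogeneous_polynomial 2 (row_minor i j p q k)" "homogeneous_polynomial 2 (col_minor i j p q k)"
    "homogeneous_polynomial 2 (block_minor i j p q k)"
    unfolding row_minor_def[abs_def] col_minor_def[abs_def] block_minor_def[abs_def] using ne
    by (intro homogeneous_diff e2; simp)+
  show ?thesis
    using f minors cubic quad e1[OF ne(13)] cycle_form[of i j p] e1[of k j i] ne unfolding generic_polynomials_def by auto
qed

lemma generic_polynomials_nonzero:
  assumes d: "distinct [i, j, p, q, k]" and f: "f \<in> generic_polynomials i j p q k"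
  shows "\<exists>c. parameter_collection c \<and> f c \<noteq> 0"
proof -
  have ne: "i \<noteq> j" "j \<noteq> i" "i \<noteq> p" "p \<noteq> i" "i \<noteq> q" "q \<noteq> i" "j \<noteq> p" "p \<noteq> j" "j \<noteq> q" "q \<noteq> j" "p \<noteq> q" "q \<noteq> p"
    "k \<noteq> i" "i \<noteq> k" "k \<noteq> j" "j \<noteq> k" "k \<noteq> p" "p \<noteq> k" "k \<noteq> q" "q \<noteq> k"
    using d by auto
  note I = indicator_params_def doubleton_eq_iff
  have "indicator_params {(i, {k, j})} i k j \<noteq> 0" by (simp add: I)
  moreover have "row_minor i j p q k (indicator_params {(i, {k, j}), (i, {q, p})}) \<noteq> 0"
    using ne by (simp add: row_minor_def I)
  moreover have "col_minor i j p q k (indicator_params {(i, {k, j}), (p, {q, j})}) \<noteq> 0"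
    using ne by (simp add: col_minor_def I)
  moreover have "block_minor i j p q k (indicator_params {(i, {k, p}), (j, {k, q})}) \<noteq> 0"
    using ne by (simp add: block_minor_def I)
  moreover have "cycle_form (indicator_params {(i, {k, j}), (j, {k, p}), (p, {k, i})}) i j p k k k \<noteq> 0"
    using ne by (simp add: cycle_form_def I)
  \<comment> \<open>Here the cubic is \<open>s (1 + s)\<close>, of discriminant \<open>1\<close> as a binary form with a third root at infinity.\<close>
  moreover have "cubic_disc i j p q k (indicator_params {(i, {k, j}), (j, {q, p}), (p, {k, i}), (p, {q, i})}) \<noteq> 0"
    using ne by (simp add: cubic_disc_def disc3_def cubic_coeff1_def cubic_coeff2_def cycle_form_def I)
  \<comment> \<open>Here both determinants \<open>a\<close> and \<open>b\<close> vanish, and the quadratic degenerates to \<open>x\<close>, again of discriminant \<open>1\<close>.\<close>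
  moreover have "quadratic_disc i j p q k (indicator_params {(p, {k, q}), (j, {k, i}), (q, {k, j}), (i, {k, p})}) \<noteq> 0"
    using ne by (simp add: quadratic_disc_def disc2_def quadratic_coeff0_def quadratic_coeff1_def quadratic_coeff2_def bilinear_const_def cycle_form_def I)
  ultimately show ?thesis
    using f parameter_collection_indicator unfolding generic_polynomials_def by blast
qed

lemma generic_condition_generic_set: "generic_condition generic_set"
  unfolding generic_condition_def generic_set_def
proof (intro conjI ballI)
  show "finite (\<Union>(i, j, p, q, k)\<in>{(i, j, p, q, k). distinct [i, j, p, q, k]}. generic_polynomials i j p q k)"
    by (intro finite_UN_I) (auto simp: generic_polynomials_def)
  fix f assume "f \<in> (\<Union>(i, j, p, q, k)\<in>{(i, j, p, q, k). distinct [i, j, p, q, k]}. generic_polynomials i j p q k)"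
  then obtain i j p q k where "distinct [i, j, p, q, k]" "f \<in> generic_polynomials i j p q k" by auto
  then show "\<exists>d. homogeneous_polynomial d f" "\<exists>c. parameter_collection c \<and> f c \<noteq> 0"
    using generic_polynomials_homogeneous generic_polynomials_nonzero by blast+
qed

section \<open>Counting the singular points\<close>

text \<open>A choice of the coordinate that is normalized to \<open>1\<close>.\<close>

definition outside :: "5 set \<Rightarrow> 5" where "outside I = (SOME k. k \<notin> I)"

definition limit_points :: "5 params \<Rightarrow> 5 set \<Rightarrow> (real^5) set" where
  "limit_points c I = {y. y $ outside I = 1 \<and> rank (core c I y) + 2 \<le> card I}"

text \<open>What the counting needs to know about a single set \<open>I\<close>; \<open>N\<close> lists the possible numbers of configurations.  By the
  last clause the single nonzero coordinate provided by \<open>limit_configuration\<close> entails that all coordinates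
  outside \<open>I\<close> are nonzero.\<close>

definition well_behaved :: "5 params \<Rightarrow> 5 set \<Rightarrow> nat set \<Rightarrow> bool" where
  "well_behaved c I N \<longleftrightarrow> finite (limit_points c I) \<and> card (limit_points c I) \<in> N \<and>
    (\<forall>y\<in>limit_points c I. persists c I (outside I) y) \<and>
    (\<forall>\<zeta> a b. rank (core c I \<zeta>) + 2 \<le> card I \<longrightarrow> a \<notin> I \<longrightarrow> \<zeta> $ a \<noteq> 0 \<longrightarrow> b \<notin> I \<longrightarrow> \<zeta> $ b \<noteq> 0)"

lemma outside: "card I < 5 \<Longrightarrow> outside I \<notin> I"
proof -
  assume "card I < 5"
  then have "I \<noteq> UNIV" by auto
  then have "\<exists>k. k \<notin> I" by blast
  then show "outside I \<notin> I" unfolding outside_def by (rule someI_ex)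
qed

lemma card_compl_5: "card (- I) = 5 - card (I :: 5 set)"
  by (simp add: Compl_eq_Diff_UNIV card_Diff_subset)

lemma well_behaved_pair:
  assumes c: "\<And>i j. i \<noteq> j \<Longrightarrow> condition1 c i j" and I: "card I = 2"
  shows "well_behaved c I {1}"
proof -
  obtain i j where ij: "I = {i, j}" "i \<noteq> j" using I by (auto simp: card_2_iff)
  define k where "k = outside I"
  have k: "k \<notin> I" using outside[of I] I by (simp add: k_def)
  have "card (- insert k I) = 2" using k I by (simp add: card_compl_5)
  then obtain l m where lm: "- insert k I = {l, m}" "l \<noteq> m" by (auto simp: card_2_iff)
  then have d: "distinct [i, j, k, l, m]" using ij k by auto
  have c1: "c i x j * c j y i \<noteq> c j x i * c i y j" if "x \<noteq> y" "x \<in> {k, l, m}" "y \<in> {k, l, m}" for x y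
    using c[OF ij(2)] that d unfolding condition1_def by auto
  interpret pair_case c i j k l m
    by unfold_locales (use d c1 in auto)
  have lp: "limit_points c I = {y. y $ k = 1 \<and> core c {i, j} y = 0}"
    unfolding limit_points_def k_def[symmetric] ij(1)[symmetric] using I by (simp add: rank_eq_0)
  from unique_config obtain y where y: "{y. y $ k = 1 \<and> core c {i, j} y = 0} = {y}" by blast
  show ?thesis
    unfolding well_behaved_def
  proof (intro conjI ballI allI impI)
    show "finite (limit_points c I)" "card (limit_points c I) \<in> {1}" unfolding lp y by simp_all
    show "persists c I (outside I) y" if "y \<in> limit_points c I" for y
    proof -
      have "persists c {i, j} k y" using that config_persists unfolding lp by blast
      then show ?thesis by (simp only: ij(1)[symmetric] k_def)
    qed
    show "\<zeta> $ b \<noteq> 0" if "rank (core c I \<zeta>) + 2 \<le> card I" "a \<notin> I" "\<zeta> $ a \<noteq> 0" "b \<notin> I" for \<zeta> a b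
    proof -
      have "core c I \<zeta> = 0" using that(1) I by (simp add: rank_eq_0)
      then show ?thesis using support[of \<zeta> a b] that(2-4) unfolding ij(1) by blast
    qed
  qed
qed

lemma generic_setD:
  assumes "\<forall>f\<in>generic_set. f c \<noteq> 0" "distinct [i, j, p, q, k]"
  shows "c i k j \<noteq> 0" "c i k j * c i q p \<noteq> c i k p * c i q j" "c i k j * c p q j \<noteq> c p k j * c i q j"
    "c i k p * c j k q \<noteq> c i k q * c j k p" "cycle_form c i j p k k k \<noteq> 0"
    "disc3 (cycle_form c i j p q q q) (cubic_coeff2 c i j p k q) (cubic_coeff1 c i j p k q) (cycle_form c i j p k k k) \<noteq> 0"
    "disc2 (quadratic_coeff2 c i j p q k) (quadratic_coeff1 c i j p q k) (quadratic_coeff0 c i j p q k) \<noteq> 0"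
proof -
  have "generic_polynomials i j p q k \<subseteq> generic_set" using assms(2) unfolding generic_set_def by blast
  then have *: "f c \<noteq> 0" if "f \<in> generic_polynomials i j p q k" for f using that assms(1) by blast
  show "c i k j \<noteq> 0" "c i k j * c i q p \<noteq> c i k p * c i q j" "c i k j * c p q j \<noteq> c p k j * c i q j"
    "c i k p * c j k q \<noteq> c i k q * c j k p" "cycle_form c i j p k k k \<noteq> 0"
    "disc3 (cycle_form c i j p q q q) (cubic_coeff2 c i j p k q) (cubic_coeff1 c i j p k q) (cycle_form c i j p k k k) \<noteq> 0"
    "disc2 (quadratic_coeff2 c i j p q k) (quadratic_coeff1 c i j p q k) (quadratic_coeff0 c i j p q k) \<noteq> 0"
    using *[of "\<lambda>c. c i k j"] *[of "row_minor i j p q k"] *[of "col_minor i j p q k"]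
      *[of "block_minor i j p q k"] *[of "\<lambda>c. cycle_form c i j p k k k"] *[of "cubic_disc i j p q k"]
      *[of "quadratic_disc i j p q k"]
    by (simp_all add: generic_polynomials_def)
      (simp_all add: row_minor_def col_minor_def block_minor_def cubic_disc_def quadratic_disc_def)
qed

lemma well_behaved_triple:
  assumes c: "\<And>i j. i \<noteq> j \<Longrightarrow> condition1 c i j" and G: "\<forall>f\<in>generic_set. f c \<noteq> 0" and I: "card I = 3"
  shows "well_behaved c I {1, 3}"
proof -
  obtain i j p where ij: "I = {i, j, p}" "i \<noteq> j" "i \<noteq> p" "j \<noteq> p" using I by (auto simp: card_3_iff)
  define k where "k = outside I"
  have k: "k \<notin> I" using outside[of I] I by (simp add: k_def)
  have "card (- insert k I) = 1" using k I by (simp add: card_compl_5)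
  then obtain l where l: "- insert k I = {l}" by (auto simp: card_1_singleton_iff)
  then have d: "distinct [i, j, p, k, l]" using ij k by auto
  have perm: "distinct [a, b, e, l, k]" if "a \<in> {i, j, p}" "b \<in> {i, j, p}" "e \<in> {i, j, p}" "distinct [a, b, e]" for a b e
    using that d by auto
  interpret triple_case c i j p k l
  proof unfold_locales
    show "distinct [i, j, p, k, l]" by (rule d)
    show "c a k b * c b l a \<noteq> c b k a * c a l b" if "a \<in> {i, j, p}" "b \<in> {i, j, p}" "a \<noteq> b" for a b
    proof -
      have "k \<noteq> l" "k \<notin> {a, b}" "l \<notin> {a, b}" using that d by auto
      then show ?thesis using c[OF that(3)] unfolding condition1_def by blast
    qed
    show "c a k b * c a l e \<noteq> c a k e * c a l b" "c a k b * c e l b \<noteq> c e k b * c a l b"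
      if "a \<in> {i, j, p}" "b \<in> {i, j, p}" "e \<in> {i, j, p}" "distinct [a, b, e]" for a b e
      using generic_setD(2,3)[OF G perm[OF that]] .
    have "distinct [i, j, p, l, k]" "distinct [i, j, p, k, l]" using d by auto
    note D = generic_setD[OF G this(1)] generic_setD[OF G this(2)]
    show "cycle_form c i j p k k k \<noteq> 0" "cycle_form c i j p l l l \<noteq> 0"
      "disc3 (cycle_form c i j p l l l) (cubic_coeff2 c i j p k l) (cubic_coeff1 c i j p k l) (cycle_form c i j p k k k) \<noteq> 0"
      using D(5,12,6) by auto
  qed
  have lp: "limit_points c I = {y. y $ k = 1 \<and> rank (core c {i, j, p} y) \<le> 1}"
    unfolding limit_points_def k_def[symmetric] ij(1)[symmetric] using I by auto
  show ?thesis
    unfolding well_behaved_def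
  proof (intro conjI ballI allI impI)
    show "finite (limit_points c I)" "card (limit_points c I) \<in> {1, 3}" unfolding lp by (fact card_configs)+
    show "persists c I (outside I) y" if "y \<in> limit_points c I" for y
    proof -
      have "persists c {i, j, p} k y" using that config_persists unfolding lp by blast
      then show ?thesis by (simp only: ij(1)[symmetric] k_def)
    qed
    show "\<zeta> $ b \<noteq> 0" if "rank (core c I \<zeta>) + 2 \<le> card I" "a \<notin> I" "\<zeta> $ a \<noteq> 0" "b \<notin> I" for \<zeta> a b
    proof -
      have "rank (core c I \<zeta>) \<le> 1" using that(1) I by simp
      then show ?thesis using support[of \<zeta> a b] that(2-4) unfolding ij(1) by blast
    qed
  qed
qed

lemma well_behaved_quadruple:
  assumes G: "\<forall>f\<in>generic_set. f c \<noteq> 0" and I: "card I = 4"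
  shows "well_behaved c I {0, 2}"
proof -
  define k where "k = outside I"
  have k: "k \<notin> I" using outside[of I] I by (simp add: k_def)
  obtain i J where iJ: "I = insert i J" "i \<notin> J" "card J = 3"
    using card_eq_SucD[of I 3] I by auto
  then obtain j p q where J: "J = {j, p, q}" "j \<noteq> p" "j \<noteq> q" "p \<noteq> q" by (auto simp: card_3_iff)
  have Ieq: "I = {i, j, p, q}" using iJ J by auto
  have d: "distinct [i, j, p, q, k]" using k iJ J by auto
  interpret quadruple_case c i j p q k
  proof unfold_locales
    show "distinct [i, j, p, q, k]" by (rule d)
    have ds: "distinct [p, q, i, j, k]" "distinct [i, j, q, p, k]" "distinct [q, p, i, j, k]" "distinct [q, p, j, i, k]"
      using d by auto
    note D = generic_setD[OF G d] generic_setD[OF G ds(1)] generic_setD[OF G ds(2)] generic_setD[OF G ds(3)]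
      generic_setD[OF G ds(4)]
    show "c i k j \<noteq> 0" "c p k q \<noteq> 0" "c i k p * c j k q \<noteq> c i k q * c j k p" "c p k i * c q k j \<noteq> c p k j * c q k i"
      "cycle_form c i j p k k k \<noteq> 0" "cycle_form c i j q k k k \<noteq> 0" "cycle_form c q p i k k k \<noteq> 0" "cycle_form c q p j k k k \<noteq> 0"
      "disc2 (quadratic_coeff2 c i j p q k) (quadratic_coeff1 c i j p q k) (quadratic_coeff0 c i j p q k) \<noteq> 0"
      by (fact D)+
  qed
  have lp: "limit_points c I = {y. y $ k = 1 \<and> rank (core c {i, j, p, q} y) \<le> 2}"
    unfolding limit_points_def k_def[symmetric] Ieq[symmetric] using I by auto
  have supp: "a = k" if "a \<notin> I" for a using that Ieq distinct_UNIV_5[OF d] by blast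
  show ?thesis
    unfolding well_behaved_def
  proof (intro conjI ballI allI impI)
    show "finite (limit_points c I)" "card (limit_points c I) \<in> {0, 2}" unfolding lp by (fact card_configs)+
    show "persists c I (outside I) y" if "y \<in> limit_points c I" for y
    proof -
      have "persists c {i, j, p, q} k y" using that config_persists unfolding lp by blast
      then show ?thesis by (simp only: Ieq[symmetric] k_def)
    qed
    show "\<zeta> $ b \<noteq> 0" if "a \<notin> I" "\<zeta> $ a \<noteq> 0" "b \<notin> I" for \<zeta> :: "real^5" and a b
      using supp that by metis
  qed
qed

lemma card_subsets_5: "card {I :: 5 set. card I = m} = 5 choose m"
  using n_subsets[of "UNIV :: 5 set" m] by simp

lemma limit_points_branches:
  fixes T :: "5 set set"
  assumes T: "\<And>I. I \<in> T \<Longrightarrow> card I < 5" and wb: "\<And>I. I \<in> T \<Longrightarrow> well_behaved c I (N I)"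
  obtains \<Phi>
  where "\<forall>\<^sub>F t in at_right 0. inj_on (\<Phi> t) (Sigma T (limit_points c)) \<and>
      \<Phi> t ` Sigma T (limit_points c) \<subseteq> projective_image (Sigma_sing (scale_params t c))"
    and "(\<forall>I \<zeta> l. l \<notin> I \<and> \<zeta> $ l \<noteq> 0 \<and> rank (core c I \<zeta>) + 2 \<le> card I \<longrightarrow> I \<in> T)
      \<longrightarrow> (\<forall>\<^sub>F t in at_right 0.
        projective_image (Sigma_sing (scale_params t c)) \<subseteq> \<Phi> t ` Sigma T (limit_points c))"
proof -
  let ?Z = "Sigma T (limit_points c)"
  have out: "outside I \<notin> I" if "I \<in> T" for I using outside T[OF that] by blast
  have supp: "\<zeta> $ b \<noteq> 0"
    if "I \<in> T" "rank (core c I \<zeta>) + 2 \<le> card I" "a \<notin> I" "\<zeta> $ a \<noteq> 0" "b \<notin> I" for I \<zeta> a b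
    using wb[OF that(1)] that(2-5) unfolding well_behaved_def by blast
  have "finite ?Z" using wb unfolding well_behaved_def by (intro finite_SigmaI) auto
  moreover have "y $ l \<noteq> 0" if "(I, y) \<in> ?Z" "l \<notin> I" for I y l
    using that supp[of I y "outside I" l] out[of I] by (auto simp: limit_points_def)
  moreover have "outside I \<notin> I" "persists c I (outside I) y" if "(I, y) \<in> ?Z" for I y
    using that out wb[of I] by (auto simp: well_behaved_def)
  ultimately obtain \<Phi>
    where \<Phi>: "\<forall>\<^sub>F t in at_right 0. inj_on (\<Phi> t) ?Z \<and> \<Phi> t ` ?Z \<subseteq> projective_image (Sigma_sing (scale_params t c))"
    and surj: "(\<forall>I \<zeta> l. l \<notin> I \<and> \<zeta> $ l \<noteq> 0 \<and> rank (core c I \<zeta>) + 2 \<le> card I \<longrightarrow>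
        \<zeta> $ outside I \<noteq> 0 \<and> (I, (1 / \<zeta> $ outside I) *\<^sub>R \<zeta>) \<in> ?Z)
      \<longrightarrow> (\<forall>\<^sub>F t in at_right 0. projective_image (Sigma_sing (scale_params t c)) \<subseteq> \<Phi> t ` ?Z)"
    by (rule branches[of ?Z outside c])
  show ?thesis
  proof (rule that[OF \<Phi>], intro impI, rule surj[rule_format], elim conjE)
    fix I \<zeta> l
    assume "\<forall>I \<zeta> l. l \<notin> I \<and> \<zeta> $ l \<noteq> 0 \<and> rank (core c I \<zeta>) + 2 \<le> card I \<longrightarrow> I \<in> T"
      and l: "l \<notin> I" "\<zeta> $ l \<noteq> 0" and r: "rank (core c I \<zeta>) + 2 \<le> card I"
    then have I: "I \<in> T" by blast
    have nz: "\<zeta> $ outside I \<noteq> 0" by (rule supp[OF I r l out[OF I]])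
    then have "(1 / \<zeta> $ outside I) *\<^sub>R \<zeta> \<in> limit_points c I"
      using r by (simp add: limit_points_def core_scaleR rank_scaleR)
    then show "\<zeta> $ outside I \<noteq> 0 \<and> (I, (1 / \<zeta> $ outside I) *\<^sub>R \<zeta>) \<in> ?Z" using nz I by blast
  qed
qed

theorem theorem4p4:
  "(\<forall>c :: 5 params.
      parameter_collection c \<and> (\<forall>i j. i \<noteq> j \<longrightarrow> condition1 c i j \<and> condition2 c i j) \<longrightarrow>
      (\<forall>\<^sub>F t in at_right 0.
        \<exists>S \<subseteq> projective_image (Sigma_sing (scale_params t c)). card S = 10))
   \<and>
   (\<exists>F :: (5 params \<Rightarrow> real) set. generic_condition F \<and>
      (\<forall>c. parameter_collection c \<and> (\<forall>i j. i \<noteq> j \<longrightarrow> condition1 c i j \<and> condition2 c i j) \<and>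
           (\<forall>f\<in>F. f c \<noteq> 0) \<longrightarrow>
        (\<exists>\<alpha> \<beta> \<gamma> :: nat. \<alpha> + \<gamma> = 10 \<and> \<beta> \<le> 5 \<and>
          (\<forall>\<^sub>F t in at_right 0.
            finite (projective_image (Sigma_sing (scale_params t c))) \<and>
            card (projective_image (Sigma_sing (scale_params t c))) = 10 + \<alpha> + 2 * \<beta> + 3 * \<gamma>))))"
proof (intro conjI allI impI exI[of _ generic_set])
  let ?PI = "\<lambda>t c. projective_image (Sigma_sing (scale_params t c))"
  show "generic_condition generic_set" by (rule generic_condition_generic_set)
  {
    fix c :: "5 params"
    assume "parameter_collection c \<and> (\<forall>i j. i \<noteq> j \<longrightarrow> condition1 c i j \<and> condition2 c i j)"
    then have c: "\<And>i j. i \<noteq> j \<Longrightarrow> condition1 c i j" by blast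
    let ?T = "{I :: 5 set. card I = 2}"
    let ?Z = "Sigma ?T (limit_points c)"
    have wb: "well_behaved c I {1}" if "I \<in> ?T" for I using well_behaved_pair[OF c] that by blast
    have "card ?Z = (\<Sum>I\<in>?T. card (limit_points c I))"
      using wb by (intro card_SigmaI) (auto simp: well_behaved_def)
    also have "\<dots> = (\<Sum>I\<in>?T. 1)" using wb by (intro sum.cong) (auto simp: well_behaved_def)
    also have "\<dots> = 10" using card_subsets_5[of 2] by (simp add: eval_nat_numeral)
    finally have card: "card ?Z = 10" .
    have "I \<in> ?T \<Longrightarrow> card I < 5" for I by simp
    then obtain \<Phi>
      where "\<forall>\<^sub>F t in at_right 0. inj_on (\<Phi> t) ?Z \<and> \<Phi> t ` ?Z \<subseteq> ?PI t c"
      by (rule limit_points_branches[OF _ wb])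
    then show "\<forall>\<^sub>F t in at_right 0. \<exists>S \<subseteq> ?PI t c. card S = 10"
    proof eventually_elim
      case (elim t)
      then show ?case using card by (intro exI[of _ "\<Phi> t ` ?Z"]) (simp add: card_image)
    qed
  }
  fix c :: "5 params"
  assume "parameter_collection c \<and> (\<forall>i j. i \<noteq> j \<longrightarrow> condition1 c i j \<and> condition2 c i j) \<and>
    (\<forall>f\<in>generic_set. f c \<noteq> 0)"
  then have c: "\<And>i j. i \<noteq> j \<Longrightarrow> condition1 c i j" and G: "\<forall>f\<in>generic_set. f c \<noteq> 0" by blast+
  let ?L = "\<lambda>I. card (limit_points c I)"
  let ?T2 = "{I :: 5 set. card I = 2}" and ?T3 = "{I :: 5 set. card I = 3}" and ?T4 = "{I :: 5 set. card I = 4}"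
  let ?T = "?T2 \<union> ?T3 \<union> ?T4"
  let ?Z = "Sigma ?T (limit_points c)"
  define N :: "5 set \<Rightarrow> nat set" where "N I = (if card I = 2 then {1} else if card I = 3 then {1, 3} else {0, 2})" for I
  define \<alpha> where "\<alpha> = card {I \<in> ?T3. ?L I = 1}"
  define \<gamma> where "\<gamma> = card {I \<in> ?T3. ?L I \<noteq> 1}"
  define \<beta> where "\<beta> = card {I \<in> ?T4. ?L I \<noteq> 0}"
  have wb: "well_behaved c I (N I)" if "I \<in> ?T" for I
    using that well_behaved_pair[OF c] well_behaved_triple[OF c G] well_behaved_quadruple[OF G] by (auto simp: N_def)
  have L: "?L I \<in> N I" "finite (limit_points c I)" if "I \<in> ?T" for I
    using wb[OF that] by (simp_all add: well_behaved_def)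
  have "\<alpha> + \<gamma> = card ({I \<in> ?T3. ?L I = 1} \<union> {I \<in> ?T3. ?L I \<noteq> 1})"
    unfolding \<alpha>_def \<gamma>_def by (rule card_Un_disjoint[symmetric]) auto
  also have "{I \<in> ?T3. ?L I = 1} \<union> {I \<in> ?T3. ?L I \<noteq> 1} = ?T3" by blast
  finally have \<alpha>\<gamma>: "\<alpha> + \<gamma> = 10" using card_subsets_5[of 3] by (simp add: eval_nat_numeral)
  have "\<beta> \<le> card ?T4" unfolding \<beta>_def by (intro card_mono) auto
  then have \<beta>: "\<beta> \<le> 5" using card_subsets_5[of 4] by (simp add: eval_nat_numeral)
  have "card ?Z = (\<Sum>I\<in>?T. ?L I)" using L(2) by (intro card_SigmaI) auto
  also have "\<dots> = (\<Sum>I\<in>?T2. ?L I) + (\<Sum>I\<in>?T3. ?L I) + (\<Sum>I\<in>?T4. ?L I)"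
    by (subst sum.union_disjoint; (subst sum.union_disjoint)?) auto
  also have "(\<Sum>I\<in>?T2. ?L I) = (\<Sum>I\<in>?T2. 1)"
  proof (rule sum.cong)
    fix I assume "I \<in> ?T2"
    then show "?L I = 1" using L(1)[of I] by (simp add: N_def)
  qed simp
  also have "\<dots> = 10" using card_subsets_5[of 2] by (simp add: eval_nat_numeral)
  also have "(\<Sum>I\<in>?T3. ?L I) = (\<Sum>I\<in>?T3. (if ?L I = 1 then 1 else 0) + 3 * (if ?L I \<noteq> 1 then 1 else 0))"
  proof (rule sum.cong)
    fix I assume "I \<in> ?T3"
    then have "?L I \<in> {1, 3}" using L(1)[of I] by (simp add: N_def)
    then show "?L I = (if ?L I = 1 then 1 else 0) + 3 * (if ?L I \<noteq> 1 then 1 else 0)" by auto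
  qed simp
  also have "\<dots> = \<alpha> + 3 * \<gamma>"
    unfolding sum.distrib sum_distrib_left[symmetric] \<alpha>_def \<gamma>_def by (simp add: sum.If_cases Int_def)
  also have "(\<Sum>I\<in>?T4. ?L I) = (\<Sum>I\<in>?T4. 2 * (if ?L I \<noteq> 0 then 1 else 0))"
  proof (rule sum.cong)
    fix I assume "I \<in> ?T4"
    then have "?L I \<in> {0, 2}" using L(1)[of I] by (simp add: N_def)
    then show "?L I = 2 * (if ?L I \<noteq> 0 then 1 else 0)" by auto
  qed simp
  also have "\<dots> = 2 * \<beta>"
    unfolding sum_distrib_left[symmetric] \<beta>_def by (simp add: sum.If_cases Int_def)
  finally have card: "card ?Z = 10 + \<alpha> + 2 * \<beta> + 3 * \<gamma>" by simp
  have fin: "finite ?Z" using L(2) by (intro finite_SigmaI) auto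
  have small: "card I < 5" if "I \<in> ?T" for I using that by auto
  obtain \<Phi>
    where \<Phi>: "\<forall>\<^sub>F t in at_right 0. inj_on (\<Phi> t) ?Z \<and> \<Phi> t ` ?Z \<subseteq> ?PI t c"
    and surj: "(\<forall>I \<zeta> l. l \<notin> I \<and> \<zeta> $ l \<noteq> 0 \<and> rank (core c I \<zeta>) + 2 \<le> card I \<longrightarrow> I \<in> ?T)
      \<longrightarrow> (\<forall>\<^sub>F t in at_right 0. ?PI t c \<subseteq> \<Phi> t ` ?Z)"
    by (rule limit_points_branches[OF small wb])
  have "\<forall>\<^sub>F t in at_right 0. ?PI t c \<subseteq> \<Phi> t ` ?Z"
  proof (rule surj[rule_format], elim conjE)
    fix I l and \<zeta> :: "real^5" assume l: "l \<notin> I" and r: "rank (core c I \<zeta>) + 2 \<le> card I"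
    have "card I < card (UNIV :: 5 set)" using l by (intro psubset_card_mono) auto
    then show "I \<in> ?T" using r by auto
  qed
  with \<Phi> have "\<forall>\<^sub>F t in at_right 0. finite (?PI t c) \<and> card (?PI t c) = 10 + \<alpha> + 2 * \<beta> + 3 * \<gamma>"
  proof eventually_elim
    case (elim t)
    then have "?PI t c = \<Phi> t ` ?Z" by blast
    then show ?case using elim fin card by (simp add: card_image)
  qed
  then show "\<exists>\<alpha> \<beta> \<gamma> :: nat. \<alpha> + \<gamma> = 10 \<and> \<beta> \<le> 5 \<and>
      (\<forall>\<^sub>F t in at_right 0. finite (?PI t c) \<and> card (?PI t c) = 10 + \<alpha> + 2 * \<beta> + 3 * \<gamma>)"
    using \<alpha>\<gamma> \<beta> by blast
qed

end
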